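(* Fix $m,n,d\in\mathbb{N}$. Then we have the block matrix decomposition $$\mathsf{RSK}_{m,n,d}=\left(\mathrm{Id}_1^{\oplus N_0(m,n,d)}\right)\oplus\left(\bigoplus_{(\sigma,\pi)}\mathsf{RSK}_{\sigma,\pi}^{\oplus N_{\sigma,\pi}(m,n,d)}\right),$$ where $\mathrm{Id}_1$ is the $1\times1$ identity matrix, the sum is over all nonzero reduced weight pairs $(\sigma,\pi)$ (satisfying the normalization in the context) of degree $d'\leq d$, $$N_{\sigma,\pi}(m,n,d)=\begin{cases}A_{\sigma,\pi}(d)\left(\binom{m}{\ell(\sigma)}\binom{n}{\ell(\pi)}+\binom{m}{\ell(\pi)}\binom{n}{\ell(\sigma)}\right)&\text{if }\sigma\neq\pi,\\ A_{\sigma,\pi}(d)\binom{m}{\ell(\sigma)}\binom{n}{\ell(\pi)}&\text{if }\sigma=\pi,\end{cases}$$ and $$N_0(m,n,d)=\binom{d+n-1}{d}m+\binom{d+m-1}{d}n-mn.$$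
   Context: $\mathbb{N}=\{0,1,2,\dots\}$. RSK. A semistandard Young tableau is a filling of a Young diagram (English notation) by positive integers, weakly increasing along rows and strictly increasing down columns. Row insertion $P\leftarrow p$: if no label in the first row of $P$ exceeds $p$, append $p$ to the end of the first row; otherwise replace the leftmost occurrence of the smallest label $p'>p$ of the first row by $p$, and insert $p'$ in the same way into the tableau formed by the remaining rows. Inserting a biletter $(p|q)$ into a pair $(P,Q)$ of tableaux of the same shape yields $(P\leftarrow p,Q^\uparrow)$, where $Q^\uparrow$ is $Q$ with a new box labelled $q$ placed where $P\leftarrow p$ has a new box. For an $m\times n$ matrix $\alpha$ with entries in $\mathbb{N}$, list biletters by reading the entries of $\alpha$ down columns, columns from left to right, recording $\alpha_{i,j}$ copies of $(i|j)$. $\mathrm{RSK}(\alpha)=(P,Q)$ is the result of inserting these biletters successively into $(\emptyset,\emptyset)$. Operator. Let $R_{m,n}=\mathbb{C}[z_{ij}]_{1\le i\le m,1\le j\le n}$, $Z=[z_{ij}]$, and $z^\alpha=\prod_{i,j} z_{ij}^{\alpha_{i,j}}$. For semistandard $P,Q$ of the same shape, $[P|Q]\in R_{m,n}$ is the product over column positions $c$ of the minors of $Z$ whose row indices are the entries of the $c$-th column of $P$ and whose column indices are the entries of the $c$-th column of $Q$. Let $\mathsf{RSK}:R_{m,n}\to R_{m,n}$ be the linear map with $z^\alpha\mapsto[P|Q]$ where $(P,Q)=\mathrm{RSK}(\alpha)$. It preserves degree, and $\mathsf{RSK}_{m,n,d}$ denotes the matrix of its restriction to the span $R_{m,n,d}$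 of degree-$d$ monomials, in the monomial basis. The block decomposition is understood after reordering the monomial basis (the same permutation applied to rows and columns). Weight spaces. A weight pair of degree $d$ is a pair $(\sigma,\pi)$ of tuples of nonnegative integers with $\sum_i\sigma_i=\sum_j\pi_j=d$; $\ell(\sigma)$ is the number of entries of $\sigma$. $R_{\sigma,\pi}$ is the span of the monomials $z^\alpha$ in $R_{\ell(\sigma),\ell(\pi)}$ for which $\alpha$ has row sums $\sigma$ and column sums $\pi$; it is preserved by $\mathsf{RSK}$, and $\mathsf{RSK}_{\sigma,\pi}$ is the matrix of the restriction in the monomial basis. Normalization. A weight pair $(\sigma,\pi)$ is normalized if all entries of $\sigma$ and $\pi$ are nonzero, $\ell(\sigma)\leq\ell(\pi)$, and, when $\ell(\sigma)=\ell(\pi)$, either $\sigma=\pi$ or $\sigma_i>\pi_i$ for the least $i$ with $\sigma_i\neq\pi_i$. The weight pairs indexing the sum are normalized. Reduction. Let $\vec e_k$ denote a standard basis vector. Let $\mathcal{P}$ be the poset on weight pairs, graded by degree, with covering relations $(\sigma,\pi)\prec(\sigma+\vec e_k,\pi+\vec e_l)$ whenever $\sigma_k+\pi_l\geq d$, where $d$ is the degree of $(\sigma,\pi)$. A weight pair of degree $d$ is reduced if $\max_i\sigma_i+\max_j\pi_j\leq d$, equivalently if it is a minimal element of $\mathcal{P}$. The connected component of any weight pair in $\mathcal{P}$ contains a unique minimal element, called its reduction; a weight pair is said to reduce to its reduction. The numbers $A_{\sigma,\pi}(d)$. For a nonzero reduced pair $(\sigma,\pi)$ of degree $d'\leq d$,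 $A_{\sigma,\pi}(d)$ denotes the number of normalized degree-$d$ weight pairs that reduce to $(\sigma,\pi)$.
   Formalization: Assumes d>0 (for d=0, m=n=2 the formula gives N_0=0 but the matrix is 1x1); when σ=π, A also counts pairs whose transpose is normalized, since counting normalized pairs only gives size 18 instead of 20 for m=n=2, d=3. *)

theory Defs
  imports
    "HOL-Library.Poly_Mapping"
    "Jordan_Normal_Form.Determinant"
    Complex_Main
begin

section \<open>RSK\<close>

text \<open>A tableau is the list of its rows. Row insertion returns the new tableau and the index of
  the row that received the new box; as that box ends its row, this index locates it.\<close>

type_synonym tableau = "nat list list"

fun row_insert :: "tableau \<Rightarrow> nat \<Rightarrow> tableau \<times> nat" where
  "row_insert [] p = ([[p]], 0)"
| "row_insert (r # P) p =
    (if \<forall>x\<in>set r. x \<le> p then ((r @ [p]) # P, 0)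
     else let p' = Min {x \<in> set r. p < x};
              k = (LEAST k. k < length r \<and> r ! k = p');
              (P', i) = row_insert P p'
          in (r[k := p] # P', Suc i))"

definition add_box :: "tableau \<Rightarrow> nat \<Rightarrow> nat \<Rightarrow> tableau" where
  "add_box Q i q = (if i < length Q then Q[i := Q ! i @ [q]] else Q @ [[q]])"

definition insert_biletter :: "tableau \<times> tableau \<Rightarrow> nat \<times> nat \<Rightarrow> tableau \<times> tableau" where
  "insert_biletter PQ pq =
    (let (P', i) = row_insert (fst PQ) (fst pq) in (P', add_box (snd PQ) i (snd pq)))"

text \<open>An \<open>m\<times>n\<close> matrix over \<open>\<nat>\<close> is a finitely supported map from 1-based positions
  \<open>(i, j)\<close> with support in \<open>positions m n\<close>; it is also the exponent of a monomial.\<close>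

type_synonym exponent = "nat \<times> nat \<Rightarrow>\<^sub>0 nat"

definition positions :: "nat \<Rightarrow> nat \<Rightarrow> (nat \<times> nat) set" where
  "positions m n = {1..m} \<times> {1..n}"

definition biletters :: "nat \<Rightarrow> nat \<Rightarrow> exponent \<Rightarrow> (nat \<times> nat) list" where
  "biletters m n \<alpha> =
    concat [replicate (Poly_Mapping.lookup \<alpha> (i, j)) (i, j). j \<leftarrow> [1..<Suc n], i \<leftarrow> [1..<Suc m]]"

definition rsk :: "nat \<Rightarrow> nat \<Rightarrow> exponent \<Rightarrow> tableau \<times> tableau" where
  "rsk m n \<alpha> = foldl insert_biletter ([], []) (biletters m n \<alpha>)"

section \<open>The operator\<close>

text \<open>Polynomials over \<open>\<complex>\<close> in the variables \<open>z\<^sub>i\<^sub>j\<close>, as the monoid algebra of the exponents.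
  The ring \<open>R\<^bsub>m,n\<^esub>\<close> consists of those whose exponents are supported in \<open>positions m n\<close>.\<close>

type_synonym zpoly = "exponent \<Rightarrow>\<^sub>0 complex"

definition monomial :: "exponent \<Rightarrow> zpoly" where
  "monomial \<alpha> = Poly_Mapping.single \<alpha> 1"

definition zvar :: "nat \<Rightarrow> nat \<Rightarrow> zpoly" where
  "zvar i j = monomial (Poly_Mapping.single (i, j) 1)"

definition zminor :: "nat list \<Rightarrow> nat list \<Rightarrow> zpoly" where
  "zminor I J = det (mat (length I) (length J) (\<lambda>(a, b). zvar (I ! a) (J ! b)))"

definition tab_column :: "tableau \<Rightarrow> nat \<Rightarrow> nat list" where
  "tab_column P c = [r ! c. r \<leftarrow> P, c < length r]"

definition num_columns :: "tableau \<Rightarrow> nat" where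
  "num_columns P = (if P = [] then 0 else length (hd P))"

definition bitableau :: "tableau \<Rightarrow> tableau \<Rightarrow> zpoly" where
  "bitableau P Q = (\<Prod>c<num_columns P. zminor (tab_column P c) (tab_column Q c))"

definition RSK_op :: "nat \<Rightarrow> nat \<Rightarrow> zpoly \<Rightarrow> zpoly" where
  "RSK_op m n f =
    (\<Sum>\<alpha>\<in>Poly_Mapping.keys f.
      Poly_Mapping.single 0 (Poly_Mapping.lookup f \<alpha>) * case_prod bitableau (rsk m n \<alpha>))"

section \<open>Matrices of the restrictions\<close>

definition degree_exponents :: "nat \<Rightarrow> nat \<Rightarrow> nat \<Rightarrow> exponent set" where
  "degree_exponents m n d =
    {\<alpha>. Poly_Mapping.keys \<alpha> \<subseteq> positions m n \<and>
        (\<Sum>ij\<in>positions m n. Poly_Mapping.lookup \<alpha> ij) = d}"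

definition weight_exponents :: "nat list \<Rightarrow> nat list \<Rightarrow> exponent set" where
  "weight_exponents \<sigma> \<pi> =
    {\<alpha>. Poly_Mapping.keys \<alpha> \<subseteq> positions (length \<sigma>) (length \<pi>) \<and>
        (\<forall>i\<in>{1..length \<sigma>}. (\<Sum>j=1..length \<pi>. Poly_Mapping.lookup \<alpha> (i, j)) = \<sigma> ! (i - 1)) \<and>
        (\<forall>j\<in>{1..length \<pi>}. (\<Sum>i=1..length \<sigma>. Poly_Mapping.lookup \<alpha> (i, j)) = \<pi> ! (j - 1))}"

text \<open>An unspecified enumeration without repetitions, for finite sets only. The orders chosen are
  immaterial below, where matrices are compared up to reordering the basis.\<close>

definition enum_list :: "'a set \<Rightarrow> 'a list" where
  "enum_list S = (SOME xs. distinct xs \<and> set xs = S)"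

text \<open>Column \<open>j\<close> holds the coefficients of the image of the \<open>j\<close>-th basis monomial.\<close>

definition monomial_matrix :: "(zpoly \<Rightarrow> zpoly) \<Rightarrow> exponent list \<Rightarrow> complex mat" where
  "monomial_matrix T bs =
    mat (length bs) (length bs) (\<lambda>(i, j). Poly_Mapping.lookup (T (monomial (bs ! j))) (bs ! i))"

definition RSK_degree :: "nat \<Rightarrow> nat \<Rightarrow> nat \<Rightarrow> complex mat" where
  "RSK_degree m n d = monomial_matrix (RSK_op m n) (enum_list (degree_exponents m n d))"

definition RSK_weight :: "nat list \<Rightarrow> nat list \<Rightarrow> complex mat" where
  "RSK_weight \<sigma> \<pi> =
    monomial_matrix (RSK_op (length \<sigma>) (length \<pi>)) (enum_list (weight_exponents \<sigma> \<pi>))"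

definition equal_up_to_reordering :: "'a mat \<Rightarrow> 'a mat \<Rightarrow> bool" where
  "equal_up_to_reordering A B \<longleftrightarrow>
    (\<exists>N p. A \<in> carrier_mat N N \<and> p permutes {..<N} \<and>
           B = mat N N (\<lambda>(i, j). A $$ (p i, p j)))"

section \<open>Weight pairs and reduction\<close>

type_synonym wpair = "nat list \<times> nat list"

definition weight_pair :: "nat \<Rightarrow> wpair \<Rightarrow> bool" where
  "weight_pair d w \<longleftrightarrow> sum_list (fst w) = d \<and> sum_list (snd w) = d"

definition normalized :: "wpair \<Rightarrow> bool" where
  "normalized w \<longleftrightarrow> (case w of (\<sigma>, \<pi>) \<Rightarrow>
    0 \<notin> set \<sigma> \<and> 0 \<notin> set \<pi> \<and> length \<sigma> \<le> length \<pi> \<and>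
    (length \<sigma> = length \<pi> \<longrightarrow>
      \<sigma> = \<pi> \<or> (\<exists>i<length \<sigma>. \<sigma> ! i > \<pi> ! i \<and> (\<forall>j<i. \<sigma> ! j = \<pi> ! j))))"

definition covers :: "wpair \<Rightarrow> wpair \<Rightarrow> bool" where
  "covers v w \<longleftrightarrow> (case v of (\<sigma>, \<pi>) \<Rightarrow> \<exists>d k l.
    weight_pair d (\<sigma>, \<pi>) \<and> k < length \<sigma> \<and> l < length \<pi> \<and> \<sigma> ! k + \<pi> ! l \<ge> d \<and>
    w = (\<sigma>[k := Suc (\<sigma> ! k)], \<pi>[l := Suc (\<pi> ! l)]))"

definition wp_le :: "wpair \<Rightarrow> wpair \<Rightarrow> bool" where
  "wp_le = covers\<^sup>*\<^sup>*"

definition wp_minimal :: "wpair \<Rightarrow> bool" where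
  "wp_minimal v \<longleftrightarrow> (\<exists>d. weight_pair d v) \<and> (\<forall>u. wp_le u v \<longrightarrow> u = v)"

text \<open>The \<open>0\<close> inserted below only matters for an empty tuple.\<close>

definition reduced :: "wpair \<Rightarrow> bool" where
  "reduced w \<longleftrightarrow> (case w of (\<sigma>, \<pi>) \<Rightarrow> \<exists>d.
    weight_pair d (\<sigma>, \<pi>) \<and> Max (insert 0 (set \<sigma>)) + Max (insert 0 (set \<pi>)) \<le> d)"

text \<open>\<open>v\<close> is a minimal element of the connected component of \<open>w\<close>.\<close>

definition reduces_to :: "wpair \<Rightarrow> wpair \<Rightarrow> bool" where
  "reduces_to w v \<longleftrightarrow> equivclp covers w v \<and> wp_minimal v"

text \<open>Pairs are counted when normalized. If \<open>\<sigma> = \<pi>\<close>, their transposes are counted as well: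
  a pair with unequal components, such as \<open>([2,1],[1,2])\<close>, can reduce to \<open>(\<sigma>, \<sigma>)\<close>, and then its
  transpose labels a further weight space, but \<open>block_mult\<close> has no transposed summand for
  \<open>\<sigma> = \<pi>\<close>.
  Counting normalized pairs only would make the block sizes add up to 18 instead of
  \<open>dim R\<^bsub>2,2,3\<^esub> = 20\<close> for \<open>m = n = 2\<close>, \<open>d = 3\<close>.\<close>

definition num_reducing :: "nat list \<Rightarrow> nat list \<Rightarrow> nat \<Rightarrow> nat" where
  "num_reducing \<sigma> \<pi> d =
    card {w. weight_pair d w \<and> reduces_to w (\<sigma>, \<pi>) \<and>
             (normalized w \<or> \<sigma> = \<pi> \<and> normalized (prod.swap w))}"

definition block_mult :: "nat list \<Rightarrow> nat list \<Rightarrow> nat \<Rightarrow> nat \<Rightarrow> nat \<Rightarrow> nat" where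
  "block_mult \<sigma> \<pi> m n d =
    (if \<sigma> \<noteq> \<pi>
     then num_reducing \<sigma> \<pi> d *
       ((m choose length \<sigma>) * (n choose length \<pi>) + (m choose length \<pi>) * (n choose length \<sigma>))
     else num_reducing \<sigma> \<pi> d * ((m choose length \<sigma>) * (n choose length \<pi>)))"

text \<open>For \<open>d > 0\<close> none of the subtractions truncates to a wrong value; see \<open>block_mult0_int\<close>.\<close>

definition block_mult0 :: "nat \<Rightarrow> nat \<Rightarrow> nat \<Rightarrow> nat" where
  "block_mult0 m n d = ((d + n - 1) choose d) * m + ((d + m - 1) choose d) * n - m * n"

definition block_index :: "nat \<Rightarrow> wpair set" where
  "block_index d =
    {w. normalized w \<and> reduced w \<and> (\<exists>d'. weight_pair d' w \<and> 0 < d' \<and> d' \<le> d)}"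

section \<open>Well-formedness of the definitions\<close>

lemma enum_list:
  assumes "finite S"
  shows "distinct (enum_list S)" "set (enum_list S) = S"
proof -
  have "\<exists>xs. distinct xs \<and> set xs = S"
    using finite_distinct_list[OF assms] by blast
  then have "distinct (enum_list S) \<and> set (enum_list S) = S"
    unfolding enum_list_def by (rule someI_ex)
  then show "distinct (enum_list S)" "set (enum_list S) = S" by auto
qed

lemma RSK_op_monomial: "RSK_op m n (monomial \<alpha>) = case_prod bitableau (rsk m n \<alpha>)"
  by (simp add: RSK_op_def monomial_def)

lemma finite_degree_exponents: "finite (degree_exponents m n d)"
proof -
  let ?S = "positions m n"
  have fin: "finite ?S" by (simp add: positions_def)
  let ?F = "{f. \<forall>x. (x \<in> ?S \<longrightarrow> f x \<in> {..d}) \<and> (x \<notin> ?S \<longrightarrow> f x = (0::nat))}"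
  have "Poly_Mapping.lookup ` degree_exponents m n d \<subseteq> ?F"
  proof (intro image_subsetI CollectI allI conjI impI)
    fix \<alpha> x assume a: "\<alpha> \<in> degree_exponents m n d"
    { assume x: "x \<in> ?S"
      have "Poly_Mapping.lookup \<alpha> x \<le> (\<Sum>ij\<in>?S. Poly_Mapping.lookup \<alpha> ij)"
        using member_le_sum[OF x _ fin, of "Poly_Mapping.lookup \<alpha>"] by simp
      then show "Poly_Mapping.lookup \<alpha> x \<in> {..d}"
        using a by (simp add: degree_exponents_def) }
    { assume "x \<notin> ?S"
      then show "Poly_Mapping.lookup \<alpha> x = 0"
        using a by (auto simp: degree_exponents_def in_keys_iff) }
  qed
  then have "finite (Poly_Mapping.lookup ` degree_exponents m n d)"
    using finite_set_of_finite_funs[OF fin, of "{..d}" 0] finite_subset by blast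
  moreover have "inj_on Poly_Mapping.lookup (degree_exponents m n d)"
    by (simp add: inj_on_def lookup_inject)
  ultimately show ?thesis by (rule finite_imageD)
qed

lemma finite_weight_exponents: "finite (weight_exponents \<sigma> \<pi>)"
proof (rule finite_subset)
  let ?d = "\<Sum>i\<in>{1..length \<sigma>}. \<sigma> ! (i - 1)"
  show "weight_exponents \<sigma> \<pi> \<subseteq> degree_exponents (length \<sigma>) (length \<pi>) ?d"
  proof
    fix \<alpha> assume \<alpha>: "\<alpha> \<in> weight_exponents \<sigma> \<pi>"
    have "(\<Sum>ij\<in>positions (length \<sigma>) (length \<pi>). Poly_Mapping.lookup \<alpha> ij) =
        (\<Sum>i\<in>{1..length \<sigma>}. \<Sum>j\<in>{1..length \<pi>}. Poly_Mapping.lookup \<alpha> (i, j))"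
      by (simp add: positions_def sum.cartesian_product)
    also have "\<dots> = ?d"
      using \<alpha> by (intro sum.cong) (simp_all add: weight_exponents_def)
    finally show "\<alpha> \<in> degree_exponents (length \<sigma>) (length \<pi>) ?d"
      using \<alpha> by (simp add: weight_exponents_def degree_exponents_def)
  qed
qed (rule finite_degree_exponents)

lemma finite_weight_pairs:
  "finite {w :: wpair. length (fst w) \<le> a \<and> length (snd w) \<le> b \<and> (\<exists>d'\<le>d. weight_pair d' w)}"
  (is "finite ?W")
proof (rule finite_subset)
  let ?L = "\<lambda>c. {xs :: nat list. set xs \<subseteq> {..d} \<and> length xs \<le> c}"
  show "?W \<subseteq> ?L a \<times> ?L b"
  proof
    fix w assume w: "w \<in> ?W"
    then have "sum_list (fst w) \<le> d" "sum_list (snd w) \<le> d"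
      by (auto simp: weight_pair_def)
    then have "set (fst w) \<subseteq> {..d}" "set (snd w) \<subseteq> {..d}"
      using member_le_sum_list order_trans by blast+
    with w show "w \<in> ?L a \<times> ?L b" by (simp add: mem_Times_iff)
  qed
  show "finite (?L a \<times> ?L b)"
    by (intro finite_cartesian_product finite_lists_length_le) simp_all
qed

lemma length_le_sum_list: "0 \<notin> set xs \<Longrightarrow> length xs \<le> sum_list (xs :: nat list)"
  by (induction xs) auto

lemma finite_block_index: "finite (block_index d)"
proof (rule finite_subset[OF subsetI finite_weight_pairs[of d d d]])
  fix w assume "w \<in> block_index d"
  then obtain d' where w: "normalized w" "weight_pair d' w" "d' \<le> d"
    by (auto simp: block_index_def)
  then have "length (fst w) \<le> d'" "length (snd w) \<le> d'"
    using length_le_sum_list[of "fst w"] length_le_sum_list[of "snd w"]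
    by (simp_all add: normalized_def weight_pair_def case_prod_beta)
  then show "w \<in> {w. length (fst w) \<le> d \<and> length (snd w) \<le> d \<and> (\<exists>d'\<le>d. weight_pair d' w)}"
    using w by auto
qed

lemma equivclp_covers_length:
  "equivclp covers w v \<Longrightarrow> length (fst w) = length (fst v) \<and> length (snd w) = length (snd v)"
proof (induction rule: equivclp_induct)
  case (step y z)
  then show ?case by (elim disjE) (clarsimp simp: covers_def)+
qed simp

lemma finite_reducing: "finite {w. weight_pair d w \<and> reduces_to w (\<sigma>, \<pi>)}"
proof (rule finite_subset[OF subsetI finite_weight_pairs[of "length \<sigma>" "length \<pi>" d]])
  fix w assume "w \<in> {w. weight_pair d w \<and> reduces_to w (\<sigma>, \<pi>)}"
  then have "weight_pair d w" "equivclp covers w (\<sigma>, \<pi>)"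
    by (simp_all add: reduces_to_def)
  then show "w \<in> {w. length (fst w) \<le> length \<sigma> \<and> length (snd w) \<le> length \<pi> \<and>
      (\<exists>d'\<le>d. weight_pair d' w)}"
    using equivclp_covers_length[of w "(\<sigma>, \<pi>)"] by auto
qed

lemma block_mult0_int:
  assumes "0 < d"
  shows "int (block_mult0 m n d) =
    int ((d + n - 1) choose d) * int m + int ((d + m - 1) choose d) * int n - int m * int n"
proof -
  have ge: "n \<le> ((d + n - 1) choose d)"
  proof (cases n)
    case (Suc k)
    have "Suc k \<le> ((d + k) choose k)"
    proof (cases k)
      case (Suc l)
      have "(d + k) choose k \<ge> Suc k choose k"
        using assms by (intro binomial_right_mono) auto
      then show ?thesis by simp
    qed simp
    also have "\<dots> = ((d + n - 1) choose d)"
      using Suc binomial_symmetric[of k "d + k"] by simp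
    finally show ?thesis using Suc by simp
  qed simp
  then have "m * n \<le> ((d + n - 1) choose d) * m"
    by (simp add: mult.commute)
  then have "m * n \<le> ((d + n - 1) choose d) * m + ((d + m - 1) choose d) * n"
    by linarith
  then show ?thesis by (simp add: block_mult0_def of_nat_diff)
qed

end

theory Submission
  imports Defs "HOL-Library.Confluence"
begin

text \<open>Let \<open>G\<close> be the last passage percolation function of the matrix \<open>\<alpha>\<close>,
  \<open>G(i, j) = max (G(i-1, j)) (G(i, j-1)) + \<alpha>\<^sub>i\<^sub>j\<close>. The first rows of \<open>P\<close> and \<open>Q\<close> contain
  \<open>G(i, n) - G(i-1, n)\<close> letters \<open>i\<close> and \<open>G(m, j) - G(m, j-1)\<close> letters \<open>j\<close>, and the letters bumped
  out of the first row are the biletters of the matrix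
  \<open>min (G(i-1, j)) (G(i, j-1)) - G(i-1, j-1)\<close>. All this is symmetric under transposition, so
  transposing \<open>\<alpha>\<close> exchanges \<open>P\<close> and \<open>Q\<close>.

  If \<open>\<sigma>\<^sub>k + \<pi>\<^sub>l\<close> is at least the degree, every optimal path to a position south-east of \<open>(k, l)\<close> may be
  taken through \<open>(k, l)\<close>. Adding \<open>1\<close> to \<open>\<alpha>\<^sub>k\<^sub>l\<close> then adds \<open>1\<close> to \<open>G\<close> exactly at these positions,
  leaves the bumped matrix unchanged, and inserts a column \<open>(k | l)\<close> of length one into \<open>(P, Q)\<close>: the
  operator commutes with multiplication by \<open>z\<^sub>k\<^sub>l\<close>, and covering pairs have the same matrix.

  It remains to count weight pairs. Zero entries do not affect the matrix, transposition swaps the two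
  components, and reductions are unique because down-steps commute. A pair without zeros reduces to
  degree \<open>0\<close> iff one of its components has length one, and otherwise its reduction has no zeros.\<close>

section \<open>Row insertion, row by row\<close>

text \<open>Why optimal paths may pass through (k, l): if row k and column l together weigh at least
  the total, then the rows above k weigh at most the part of column l in rows 1 to k. A path staying
  above row k can be replaced by the one down column l and along row k; columns are treated by
  transposition. The delicate point is that P and Q gain a column of length one. A letter k may
  enter anywhere in its block of the first row of P, and l anywhere in its block of the first row of
  Q, but both must stand in the same column, beyond all lower rows. The hooks through (k, l) give
  G(k, n) + G(m, l) \<ge> total, while the lower rows hold only total - G(m, n) letters; so a common
  column exists, and the columns after it are merely shifted. Matrices are compared through
  coefficients indexed by exponents: a bijection of bases that preserves coefficients gives
  literally the same matrix for a suitable order. In the count, a pair without zeros whose reduction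
  has positive degree and is not symmetric is normalized iff its reduction is; for a symmetric
  reduction both orders are possible.\<close>

definition count_le :: "nat list \<Rightarrow> nat \<Rightarrow> nat" where
  "count_le R v = length (filter (\<lambda>x. x \<le> v) R)"

definition spell :: "(nat \<Rightarrow> nat) \<Rightarrow> nat \<Rightarrow> nat list" where
  "spell h m = concat (map (\<lambda>i. replicate (h i) i) [1..<Suc m])"

lemma spell_0 [simp]: "spell h 0 = []"
  by (simp add: spell_def)

lemma spell_Suc [simp]: "spell h (Suc m) = spell h m @ replicate (h (Suc m)) (Suc m)"
  by (simp add: spell_def)

lemma set_spell: "set (spell h m) \<subseteq> {1..m}"
  by (induction m) (auto split: if_splits)

lemma sorted_spell: "sorted (spell h m)"
proof (induction m)
  case (Suc m)
  then show ?case using set_spell[of h m] by (fastforce simp: sorted_append)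
qed simp

lemma count_list_spell: "count_list (spell h m) i = (if i \<in> {1..m} then h i else 0)"
proof (induction m)
  case (Suc m)
  have "count_list (replicate k x) y = (if x = y then k else 0)" for k and x y :: nat
    by (induction k) auto
  with Suc show ?case by (auto simp: count_list_append)
qed simp

lemma length_spell: "length (spell h m) = (\<Sum>i=1..m. h i)"
  by (induction m) auto

lemma spell_cong: "(\<And>i. 1 \<le> i \<Longrightarrow> i \<le> m \<Longrightarrow> h i = h' i) \<Longrightarrow> spell h m = spell h' m"
  unfolding spell_def by (intro arg_cong[of _ _ concat] map_cong) auto

lemma eq_spell:
  assumes "sorted R" "set R \<subseteq> {1..m}" "\<And>i. i \<in> {1..m} \<Longrightarrow> count_list R i = h i"
  shows "R = spell h m"
proof -
  have "count_list R i = count_list (spell h m) i" for i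
    using assms(2,3) by (auto simp: count_list_spell count_list_0_iff)
  then have "mset R = mset (spell h m)"
    by (intro multiset_eqI) (simp add: count_mset)
  then show ?thesis
    using assms(1) sorted_spell properties_for_sort by metis
qed

section \<open>Counting functions of rows\<close>

lemma count_le_append [simp]: "count_le (A @ B) v = count_le A v + count_le B v"
  by (simp add: count_le_def)

lemma count_le_Cons [simp]: "count_le (x # B) v = (if x \<le> v then Suc (count_le B v) else count_le B v)"
  by (simp add: count_le_def)

lemma count_le_Nil [simp]: "count_le [] v = 0"
  by (simp add: count_le_def)

lemma count_le_all: "\<forall>x\<in>set A. x \<le> v \<Longrightarrow> count_le A v = length A"
  by (simp add: count_le_def)

lemma count_le_none: "\<forall>x\<in>set A. v < x \<Longrightarrow> count_le A v = 0"
  by (auto simp: count_le_def filter_empty_conv)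

lemma count_le_Suc: "count_le A (Suc v) = count_le A v + count_list A (Suc v)"
  by (induction A) auto

lemma count_le_mono: "v \<le> w \<Longrightarrow> count_le A v \<le> count_le A w"
  by (induction A) auto

text \<open>The state \<open>(R, S, B)\<close> holds the first rows of the two tableaux and the
  biletters that have left the first row. A bumped entry carries on the label \<open>q\<close>,
  because the box that it finally creates is the one to be labelled \<open>q\<close>.\<close>

fun row_step :: "nat list \<times> nat list \<times> (nat \<times> nat) list \<Rightarrow> nat \<times> nat \<Rightarrow>
    nat list \<times> nat list \<times> (nat \<times> nat) list" where
  "row_step (R, S, B) (p, q) =
    (if \<forall>x\<in>set R. x \<le> p then (R @ [p], S @ [q], B)
     else let p' = Min {x \<in> set R. p < x};
              k = (LEAST k. k < length R \<and> R ! k = p')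
          in (R[k := p], S, B @ [(p', q)]))"

text \<open>In a sorted row the entry selected through \<open>Min\<close> and \<open>LEAST\<close>
  is the head of the \<open>dropWhile\<close>; the splitting \<open>A @ p' # C\<close> lets later
  arguments work with lists instead.\<close>

lemma bump_position:
  assumes "sorted R" "\<not> (\<forall>x\<in>set R. x \<le> p)"
  obtains A p' C where "R = A @ p' # C" "\<forall>x\<in>set A. x \<le> p" "p < p'" "\<forall>x\<in>set C. p' \<le> x"
    "Min {x \<in> set R. p < x} = p'" "(LEAST k. k < length R \<and> R ! k = p') = length A"
proof -
  let ?A = "takeWhile (\<lambda>x. x \<le> p) R"
  let ?D = "dropWhile (\<lambda>x. x \<le> p) R"
  have ne: "?D \<noteq> []" using assms(2) by auto
  obtain p' C where D: "?D = p' # C" using ne by (cases ?D) auto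
  have p': "p < p'" using hd_dropWhile[OF ne] D by auto
  have R: "R = ?A @ p' # C" using takeWhile_dropWhile_id[of "\<lambda>x. x \<le> p" R] D by simp
  have A: "\<forall>x\<in>set ?A. x \<le> p" by (auto dest: set_takeWhileD)
  have "sorted (?A @ p' # C)" using R assms(1) by simp
  then have C: "\<forall>x\<in>set C. p' \<le> x" by (simp add: sorted_append)
  have "Min (set (?A @ p' # C) \<inter> {x. p < x}) = p'"
    using A C p' by (intro Min_eqI) auto
  then have Min: "Min {x \<in> set R. p < x} = p'" using R by (simp add: Collect_conj_eq)
  have "(LEAST k. k < length R \<and> R ! k = p') = length ?A"
  proof (rule Least_equality)
    show "length ?A < length R \<and> R ! length ?A = p'"
      using R by (metis length_append length_Cons less_add_same_cancel1 nth_append_length zero_less_Suc)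
    fix k assume k: "k < length R \<and> R ! k = p'"
    show "length ?A \<le> k"
    proof (rule ccontr)
      assume "\<not> length ?A \<le> k"
      then have "k < length ?A" by simp
      then have "R ! k \<in> set ?A" by (metis nth_mem takeWhile_nth)
      then show False using A p' k by auto
    qed
  qed
  then show thesis using that[OF R A p' C Min] by blast
qed

lemma insert_biletter_append:
  "\<forall>x\<in>set R. x \<le> p \<Longrightarrow> insert_biletter (R # P, S # Q) (p, q) = ((R @ [p]) # P, (S @ [q]) # Q)"
  by (simp add: insert_biletter_def add_box_def)

lemma insert_biletter_bump:
  assumes "\<not> (\<forall>x\<in>set R. x \<le> p)" "p' = Min {x \<in> set R. p < x}" "k = (LEAST k. k < length R \<and> R ! k = p')"
  shows "insert_biletter (R # P, S # Q) (p, q) =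
    (R[k := p] # fst (insert_biletter (P, Q) (p', q)), S # snd (insert_biletter (P, Q) (p', q)))"
proof -
  obtain P' i where "row_insert P p' = (P', i)" by force
  then show ?thesis using assms by (auto simp: insert_biletter_def add_box_def Let_def)
qed

text \<open>The lower rows see only the bumped biletters, in the order in which they are bumped. For
  \<open>w = []\<close> the right-hand side would have a spurious empty first row.\<close>

lemma foldl_row_step:
  assumes "w \<noteq> []" "foldl row_step ([], [], []) w = (R, S, B)"
  shows "foldl insert_biletter ([], []) w =
    (R # fst (foldl insert_biletter ([], []) B), S # snd (foldl insert_biletter ([], []) B))"
  using assms
proof (induction w arbitrary: R S B rule: rev_induct)
  case (snoc x w)
  obtain R0 S0 B0 where st: "foldl row_step ([], [], []) w = (R0, S0, B0)" by (metis prod_cases3)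
  obtain p q where x: "x = (p, q)" by force
  obtain P Q where PQ: "foldl insert_biletter ([], []) B0 = (P, Q)" by force
  show ?case
  proof (cases "w = []")
    case True
    then show ?thesis using snoc.prems x
      by (auto simp: insert_biletter_def add_box_def)
  next
    case False
    note IH = snoc.IH[OF False st]
    show ?thesis
    proof (cases "\<forall>x\<in>set R0. x \<le> p")
      case True
      then show ?thesis using snoc.prems(2) st x IH
        by (auto simp: insert_biletter_append)
    next
      case False
      let ?p' = "Min {x \<in> set R0. p < x}"
      have "row_step (R0, S0, B0) (p, q) =
          (R0[LEAST k. k < length R0 \<and> R0 ! k = ?p' := p], S0, B0 @ [(?p', q)])"
        by (simp only: row_step.simps if_not_P[OF False] Let_def)
      then have "R = R0[LEAST k. k < length R0 \<and> R0 ! k = ?p' := p]" "S = S0" "B = B0 @ [(?p', q)]"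
        using snoc.prems(2) st x by simp_all
      then show ?thesis using x IH PQ insert_biletter_bump[OF False refl refl]
        by simp
    qed
  qed
qed simp

lemma row_step_cases [consumes 2, case_names app bump]:
  assumes "sorted R" "row_step (R, S, B) (p, q) = (R', S', B')"
  obtains
    (app) "\<forall>x\<in>set R. x \<le> p" "R' = R @ [p]" "S' = S @ [q]" "B' = B"
  | (bump) A p' C where "R = A @ p' # C" "\<forall>x\<in>set A. x \<le> p" "p < p'" "\<forall>x\<in>set C. p' \<le> x"
      "R' = A @ p # C" "S' = S" "B' = B @ [(p', q)]"
proof (cases "\<forall>x\<in>set R. x \<le> p")
  case True
  then show ?thesis using assms(2) app by simp
next
  case False
  obtain A p' C where *: "R = A @ p' # C" "\<forall>x\<in>set A. x \<le> p" "p < p'" "\<forall>x\<in>set C. p' \<le> x"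
    "Min {x \<in> set R. p < x} = p'" "(LEAST k. k < length R \<and> R ! k = p') = length A"
    using bump_position[OF assms(1) False] by blast
  have "R[length A := p] = A @ p # C" using *(1) by simp
  then show ?thesis using assms(2) False * bump[OF *(1-4)] by (simp add: Let_def)
qed

lemma row_step_invariants:
  assumes "sorted R" "row_step (R, S, B) (p, q) = (R', S', B')"
  shows "sorted R'" "mset R' + mset (map fst B') = add_mset p (mset R + mset (map fst B))"
    "mset S' + mset (map snd B') = add_mset q (mset S + mset (map snd B))"
    "length R = length S \<Longrightarrow> length R' = length S'" "R' \<noteq> []"
  using assms by (atomize (full), cases rule: row_step_cases[OF assms]) (auto simp: sorted_append)

lemma foldl_row_step_invariants:
  assumes "foldl row_step ([], [], []) w = (R, S, B)"
  shows "sorted R \<and> mset R + mset (map fst B) = mset (map fst w) \<and>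
    mset S + mset (map snd B) = mset (map snd w) \<and> length R = length S \<and> (w \<noteq> [] \<longrightarrow> R \<noteq> [])"
  using assms
proof (induction w arbitrary: R S B rule: rev_induct)
  case (snoc x w)
  obtain R0 S0 B0 where st: "foldl row_step ([], [], []) w = (R0, S0, B0)" by (metis prod_cases3)
  obtain p q where x: "x = (p, q)" by force
  have s: "row_step (R0, S0, B0) (p, q) = (R, S, B)" using snoc.prems st x by simp
  show ?case using snoc.IH[OF st] row_step_invariants[OF _ s] x by simp
qed simp

lemma length_bumped:
  assumes "foldl row_step ([], [], []) w = (R, S, B)"
  shows "length R + length B = length w"
  using foldl_row_step_invariants[OF assms]
  by (metis length_map size_mset size_union)

text \<open>At least one letter stays in the first row, so the bumped word is shorter and the lower
  rows are covered by induction.\<close>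

lemma insert_biletters_content:
  assumes "foldl insert_biletter ([], []) w = (P, Q)"
  shows "mset (concat P) = mset (map fst w) \<and> mset (concat Q) = mset (map snd w) \<and>
    map length P = map length Q"
  using assms
proof (induction "length w" arbitrary: w P Q rule: less_induct)
  case less
  obtain R S B where st: "foldl row_step ([], [], []) w = (R, S, B)" by (metis prod_cases3)
  obtain P' Q' where rec: "foldl insert_biletter ([], []) B = (P', Q')" by force
  show ?case
  proof (cases "w = []")
    case False
    note inv = foldl_row_step_invariants[OF st]
    have "length B < length w" using length_bumped[OF st] inv False by (cases R) auto
    note IH = less.hyps[OF this rec]
    have "P = R # P'" "Q = S # Q'" using foldl_row_step[OF False st] rec less.prems by auto
    then show ?thesis using IH inv by simp
  qed (use less.prems in simp)
qed

section \<open>Last passage percolation\<close>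

fun lpp :: "(nat \<Rightarrow> nat \<Rightarrow> nat) \<Rightarrow> nat \<Rightarrow> nat \<Rightarrow> nat" where
  "lpp a 0 j = 0"
| "lpp a (Suc i) 0 = 0"
| "lpp a (Suc i) (Suc j) = max (lpp a i (Suc j)) (lpp a (Suc i) j) + a (Suc i) (Suc j)"

definition bump :: "(nat \<Rightarrow> nat \<Rightarrow> nat) \<Rightarrow> nat \<Rightarrow> nat \<Rightarrow> nat" where
  "bump a i j = min (lpp a (i - 1) j) (lpp a i (j - 1)) - lpp a (i - 1) (j - 1)"

lemma lpp_0_right [simp]: "lpp a i 0 = 0"
  by (cases i) auto

lemma lpp_transpose: "lpp (\<lambda>i j. a j i) j i = lpp a i j"
  by (induction a i j rule: lpp.induct) (auto simp: max.commute)

lemma bump_transpose: "bump (\<lambda>i j. a j i) = (\<lambda>i j. bump a j i)"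
  by (auto simp: bump_def fun_eq_iff min.commute lpp_transpose[of a])

lemma lpp_Suc_left_mono: "lpp a i j \<le> lpp a (Suc i) j"
  by (cases j) auto

lemma lpp_Suc_right_mono: "lpp a i j \<le> lpp a i (Suc j)"
  by (cases i) auto

lemma lpp_mono: "i \<le> i' \<Longrightarrow> j \<le> j' \<Longrightarrow> lpp a i j \<le> lpp a i' j'"
  by (meson lift_Suc_mono_le lpp_Suc_left_mono lpp_Suc_right_mono order_trans)

text \<open>By monotonicity the subtraction in \<open>bump\<close> does not truncate; the additive
  form suits linear arithmetic.\<close>

lemma bump_Suc: "bump a (Suc i) (Suc j) + lpp a i j = min (lpp a i (Suc j)) (lpp a (Suc i) j)"
  using lpp_mono[of i i j "Suc j" a] lpp_mono[of i "Suc i" j j a] by (simp add: bump_def)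

section \<open>The first row of an insertion as a last passage time\<close>

definition letters :: "nat \<Rightarrow> nat \<Rightarrow> (nat \<Rightarrow> nat \<Rightarrow> nat) \<Rightarrow> (nat \<times> nat) list" where
  "letters m n a = concat (map (\<lambda>j. map (\<lambda>p. (p, j)) (spell (\<lambda>i. a i j) m)) [1..<Suc n])"

lemma letters_0 [simp]: "letters m 0 a = []"
  by (simp add: letters_def)

lemma letters_Suc [simp]:
  "letters m (Suc n) a = letters m n a @ map (\<lambda>p. (p, Suc n)) (spell (\<lambda>i. a i (Suc n)) m)"
  by (simp add: letters_def)

lemma concat_concat: "concat (concat xss) = concat (map concat xss)"
  by (induction xss) auto

lemma biletters_eq_letters:
  "biletters m n \<alpha> = letters m n (\<lambda>i j. Poly_Mapping.lookup \<alpha> (i, j))"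
  by (simp add: biletters_def letters_def spell_def map_concat o_def concat_concat del: upt_Suc)

lemma length_letters: "length (letters m n a) = (\<Sum>j=1..n. \<Sum>i=1..m. a i j)"
  by (induction n) (auto simp: length_spell)

text \<open>Replacing \<open>p'\<close> by \<open>p\<close> raises the count by one exactly for
  \<open>p \<le> v < p'\<close>, where it equals \<open>count_le R p\<close> because no entry lies
  in between; from \<open>p'\<close> on it already exceeds \<open>count_le R p\<close>. The maximum
  covers both ranges, and appending as well. These counts determine a sorted row, and they are what
  becomes \<open>lpp\<close>.\<close>

lemma count_le_insert:
  assumes "sorted R" "row_step (R, S, B) (p, q) = (R', S', B')"
  shows "count_le R' v = (if v < p then count_le R v else max (count_le R v) (Suc (count_le R p)))"
  using assms
proof (cases rule: row_step_cases)
  case app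
  then have "p \<le> v \<Longrightarrow> count_le R v = length R" "count_le R p = length R"
    by (meson count_le_all order_trans)+
  then show ?thesis using app by auto
next
  case (bump A p' C)
  have A: "p \<le> v \<Longrightarrow> count_le A v = length A" "count_le A p = length A"
    using bump(2) by (meson count_le_all order_trans)+
  have C: "v < p' \<Longrightarrow> count_le C v = 0" "count_le C p = 0"
    using bump(3,4) by (auto intro!: count_le_none)
  show ?thesis using bump A C by (cases "p' \<le> v") auto
qed

text \<open>A weakly increasing word bumps a weakly increasing word. In the induction
  \<open>c\<close> bounds the letters to come and \<open>q\<close> the letters to be bumped from
  below: an entry of \<open>R\<close> that is at most \<open>c\<close> is never bumped, and all
  others are at least \<open>q\<close>. After \<open>p\<close> has bumped \<open>p'\<close>, these
  two take over the roles of \<open>c\<close> and \<open>q\<close>.\<close>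

lemma row_step_column:
  assumes "sorted R" "sorted ps" "foldl row_step (R, S, B) (map (\<lambda>p. (p, j)) ps) = (R', S', B')"
    "\<forall>x\<in>set ps. c \<le> x" "\<forall>x\<in>set R. x \<le> c \<or> q \<le> x"
  shows "\<exists>bs. B' = B @ map (\<lambda>p. (p, j)) bs \<and> sorted bs \<and> (\<forall>b\<in>set bs. q \<le> b) \<and> sorted R' \<and>
    mset R' + mset bs = mset R + mset ps \<and> length R \<le> length R' \<and>
    S' = S @ replicate (length R' - length R) j"
  using assms
proof (induction ps arbitrary: R S B c q)
  case (Cons p ps)
  obtain R1 S1 B1 where st: "row_step (R, S, B) (p, j) = (R1, S1, B1)" by (metis prod_cases3)
  have st': "foldl row_step (R1, S1, B1) (map (\<lambda>p. (p, j)) ps) = (R', S', B')"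
    using Cons.prems st by simp
  have ps: "sorted ps" "\<forall>x\<in>set ps. p \<le> x" "c \<le> p" using Cons.prems by auto
  note inv = row_step_invariants[OF Cons.prems(1) st]
  from Cons.prems(1) st show ?case
  proof (cases rule: row_step_cases)
    case app
    have "\<forall>x\<in>set R1. x \<le> p \<or> q \<le> x" using app by auto
    from Cons.IH[OF inv(1) ps(1) st' ps(2) this] obtain bs where bs:
      "B' = B1 @ map (\<lambda>p. (p, j)) bs" "sorted bs" "\<forall>b\<in>set bs. q \<le> b" "sorted R'"
      "mset R' + mset bs = mset R1 + mset ps" "length R1 \<le> length R'"
      "S' = S1 @ replicate (length R' - length R1) j" by auto
    have "replicate (length R' - length R) j = j # replicate (length R' - length R1) j"
      using bs(6) app by (simp add: Suc_diff_Suc replicate_Suc[symmetric] del: replicate_Suc)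
    then show ?thesis using bs app by (intro exI[of _ bs]) auto
  next
    case (bump A p' C)
    have "q \<le> p'" using Cons.prems(5) bump ps(3) by auto
    have "\<forall>x\<in>set R1. x \<le> p \<or> p' \<le> x" using bump by auto
    from Cons.IH[OF inv(1) ps(1) st' ps(2) this] obtain bs where bs:
      "B' = B1 @ map (\<lambda>p. (p, j)) bs" "sorted bs" "\<forall>b\<in>set bs. p' \<le> b" "sorted R'"
      "mset R' + mset bs = mset R1 + mset ps" "length R1 \<le> length R'"
      "S' = S1 @ replicate (length R' - length R1) j" by auto
    then show ?thesis using bump \<open>q \<le> p'\<close>
      by (intro exI[of _ "p' # bs"]) (auto intro: order_trans)
  qed
qed auto

lemma count_le_replicate:
  assumes "sorted R" "foldl row_step (R, S, B) (map (\<lambda>p. (p, j)) (replicate x p)) = (R', S', B')"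
  shows "sorted R' \<and> count_le R' v =
    (if v < p \<or> x = 0 then count_le R v else max (count_le R v) (count_le R p + x))"
  using assms
proof (induction x arbitrary: R S B)
  case (Suc x)
  obtain R1 S1 B1 where st: "row_step (R, S, B) (p, j) = (R1, S1, B1)" by (metis prod_cases3)
  have st': "foldl row_step (R1, S1, B1) (map (\<lambda>p. (p, j)) (replicate x p)) = (R', S', B')"
    using Suc.prems st by simp
  have so: "sorted R1" using row_step_invariants[OF Suc.prems(1) st] by simp
  note IH = Suc.IH[OF so st']
  have c: "count_le R1 v = (if v < p then count_le R v else max (count_le R v) (Suc (count_le R p)))" for v
    by (rule count_le_insert[OF Suc.prems(1) st])
  show ?case using IH c[of v] c[of p] by auto
qed auto

text \<open>This is the recursion of \<open>lpp\<close> along one column: \<open>count_le R\<close>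
  is the previous column and \<open>h\<close> the new one. The value for \<open>v > m\<close> is
  needed in the induction, as the count at \<open>Suc m\<close> before the letters
  \<open>Suc m\<close> arrive.\<close>

lemma count_le_column:
  assumes "sorted R" "set R \<subseteq> {1..}" "h 0 = 0"
    and h: "\<And>i. i < m \<Longrightarrow> h (Suc i) = max (h i) (count_le R (Suc i)) + a (Suc i)"
    and "foldl row_step (R, S, B) (map (\<lambda>p. (p, j)) (spell a m)) = (R', S', B')"
  shows "sorted R' \<and> count_le R' v = (if v \<le> m then h v else max (count_le R v) (h m))"
  using assms(5) h
proof (induction m arbitrary: R' S' B' v)
  case 0
  have "count_le R 0 = 0" using assms(2) by (auto intro!: count_le_none)
  then show ?case using assms 0 by auto
next
  case (Suc m)
  obtain R1 S1 B1 where st: "foldl row_step (R, S, B) (map (\<lambda>p. (p, j)) (spell a m)) = (R1, S1, B1)"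
    by (metis prod_cases3)
  have IH: "sorted R1" "count_le R1 v = (if v \<le> m then h v else max (count_le R v) (h m))" for v
    using Suc.IH[OF st] Suc.prems(2) by auto
  have st': "foldl row_step (R1, S1, B1) (map (\<lambda>p. (p, j)) (replicate (a (Suc m)) (Suc m))) = (R', S', B')"
    using Suc.prems(1) st by simp
  have hm: "h (Suc m) = max (h m) (count_le R (Suc m)) + a (Suc m)" using Suc.prems(2) by simp
  note rep = count_le_replicate[OF IH(1) st', of v]
  consider "v \<le> m" | "v = Suc m" | "Suc m < v" by linarith
  then show ?case
  proof cases
    case 3
    have "count_le R (Suc m) \<le> count_le R v" using 3 by (intro count_le_mono) simp
    then show ?thesis using 3 rep IH(2)[of v] IH(2)[of "Suc m"] hm by (auto simp: max_def)
  qed (use rep IH(2)[of v] IH(2)[of "Suc m"] hm in \<open>auto simp: max_def\<close>)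
qed

lemma row_step_letters:
  assumes "foldl row_step ([], [], []) (letters m n a) = (R, S, B)"
  shows "sorted R \<and> set R \<subseteq> {1..m} \<and> (\<forall>v\<le>m. count_le R v = lpp a v n) \<and>
    S = spell (\<lambda>j. lpp a m j - lpp a m (j - 1)) n \<and> B = letters m n (bump a)"
  using assms
proof (induction n arbitrary: R S B)
  case (Suc n)
  obtain R0 S0 B0 where st: "foldl row_step ([], [], []) (letters m n a) = (R0, S0, B0)"
    by (metis prod_cases3)
  note IH = Suc.IH[OF st]
  let ?w = "spell (\<lambda>i. a i (Suc n)) m"
  have st': "foldl row_step (R0, S0, B0) (map (\<lambda>p. (p, Suc n)) ?w) = (R, S, B)"
    using Suc.prems st by simp
  have so: "sorted R0" and set0: "set R0 \<subseteq> {1..}" using IH by auto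
  from row_step_column[OF so sorted_spell st', of 0 0] obtain bs where bs:
    "B = B0 @ map (\<lambda>p. (p, Suc n)) bs" "sorted bs" "sorted R"
    "mset R + mset bs = mset R0 + mset ?w" "length R0 \<le> length R"
    "S = S0 @ replicate (length R - length R0) (Suc n)" by auto
  have cnt: "count_le R v = lpp a v (Suc n)" if "v \<le> m" for v
    using count_le_column[OF so set0, of "\<lambda>v. lpp a v (Suc n)" m "\<lambda>i. a i (Suc n)", OF _ _ st', of v]
      IH that by auto
  have "set R \<union> set bs = set R0 \<union> set ?w"
    using arg_cong[OF bs(4), of set_mset] by simp
  then have sets: "set R \<subseteq> {1..m}" "set bs \<subseteq> {1..m}" using IH set_spell[of "\<lambda>i. a i (Suc n)" m] by blast+
  \<comment> \<open>No entry exceeds \<open>m\<close>, so the count at \<open>m\<close> is the whole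
    length; the growth of the row is the number of labels \<open>Suc n\<close> appended to
    \<open>S\<close>.\<close>
  have len: "length R = lpp a m (Suc n)" "length R0 = lpp a m n"
    using cnt[of m] sets(1) IH count_le_all[of R m] count_le_all[of R0 m]
    by (metis atLeastAtMost_iff order_refl subsetD)+
  \<comment> \<open>Letters are conserved: what the row does not gain of the letter \<open>i\<close>
    is bumped. Since a maximum and a minimum of two numbers add up to their sum, the recursion of
    \<open>lpp\<close> turns this balance into the formula for \<open>bump\<close>.\<close>
  have "bs = spell (\<lambda>i. bump a i (Suc n)) m"
  proof (rule eq_spell[OF bs(2) sets(2)])
    fix i assume i: "i \<in> {1..m}"
    then obtain v where v: "i = Suc v" "v < m" by (cases i) auto
    have "count_list R i + count_list bs i = count_list R0 i + count_list ?w i"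
      using arg_cong[OF bs(4), of "\<lambda>M. count M i"] by (simp add: count_mset)
    moreover have "count_list ?w i = a i (Suc n)" using i by (simp add: count_list_spell)
    moreover have "lpp a v n + count_list R0 i = lpp a i n"
      using count_le_Suc[of R0 v] IH v by simp
    moreover have "lpp a v (Suc n) + count_list R i = lpp a i (Suc n)"
      using count_le_Suc[of R v] cnt[of v] cnt[of i] v by simp
    moreover have "lpp a i (Suc n) = max (lpp a v (Suc n)) (lpp a i n) + a i (Suc n)" using v by simp
    moreover have "bump a i (Suc n) + lpp a v n = min (lpp a v (Suc n)) (lpp a i n)"
      using bump_Suc[of a v n] v by simp
    ultimately show "count_list bs i = bump a i (Suc n)" by linarith
  qed
  then show ?case using bs sets cnt IH len by simp
qed (auto)

definition insert_letters :: "nat \<Rightarrow> nat \<Rightarrow> (nat \<Rightarrow> nat \<Rightarrow> nat) \<Rightarrow> tableau \<times> tableau" where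
  "insert_letters m n a = foldl insert_biletter ([], []) (letters m n a)"

lemma rsk_eq_insert_letters:
  "rsk m n \<alpha> = insert_letters m n (\<lambda>i j. Poly_Mapping.lookup \<alpha> (i, j))"
  by (simp add: rsk_def insert_letters_def biletters_eq_letters)

definition row_P :: "nat \<Rightarrow> nat \<Rightarrow> (nat \<Rightarrow> nat \<Rightarrow> nat) \<Rightarrow> nat list" where
  "row_P m n a = spell (\<lambda>i. lpp a i n - lpp a (i - 1) n) m"

definition row_Q :: "nat \<Rightarrow> nat \<Rightarrow> (nat \<Rightarrow> nat \<Rightarrow> nat) \<Rightarrow> nat list" where
  "row_Q m n a = spell (\<lambda>j. lpp a m j - lpp a m (j - 1)) n"

lemma row_step_letters_eq:
  "foldl row_step ([], [], []) (letters m n a) = (row_P m n a, row_Q m n a, letters m n (bump a))"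
proof -
  obtain R S B where st: "foldl row_step ([], [], []) (letters m n a) = (R, S, B)" by (metis prod_cases3)
  note * = row_step_letters[OF st]
  have "R = row_P m n a"
    unfolding row_P_def
  proof (rule eq_spell)
    fix i assume "i \<in> {1..m}"
    then obtain v where v: "i = Suc v" "v < m" by (cases i) auto
    then show "count_list R i = lpp a i n - lpp a (i - 1) n"
      using count_le_Suc[of R v] * by simp
  qed (use * in auto)
  then show ?thesis using * st by (simp add: row_Q_def)
qed

lemma insert_letters_rec:
  assumes "letters m n a \<noteq> []"
  shows "insert_letters m n a =
    (row_P m n a # fst (insert_letters m n (bump a)), row_Q m n a # snd (insert_letters m n (bump a)))"
  using foldl_row_step[OF assms row_step_letters_eq] by (simp add: insert_letters_def)

lemma spell_telescope: "mono f \<Longrightarrow> length (spell (\<lambda>i. f i - f (i - 1)) m) = f m - f 0"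
  by (induction m) (auto simp: mono_def)

lemma mono_lpp: "mono (\<lambda>i. lpp a i n)" "mono (\<lambda>j. lpp a m j)"
  by (auto intro!: monoI lpp_mono)

lemma length_row_P: "length (row_P m n a) = lpp a m n"
  unfolding row_P_def using spell_telescope[OF mono_lpp(1)] by simp

lemma length_row_Q: "length (row_Q m n a) = lpp a m n"
  unfolding row_Q_def using spell_telescope[OF mono_lpp(2)] by simp

lemma length_letters_bump: "lpp a m n + length (letters m n (bump a)) = length (letters m n a)"
  using length_bumped[OF row_step_letters_eq] length_row_P by metis

lemma lpp_pos: "letters m n a \<noteq> [] \<Longrightarrow> 0 < lpp a m n"
  using foldl_row_step_invariants[OF row_step_letters_eq[of m n a]] length_row_P[of m n a] by auto

lemma row_P_transpose: "row_P n m (\<lambda>i j. a j i) = row_Q m n a"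
  by (simp add: row_P_def row_Q_def lpp_transpose[of a])

lemma letters_transpose_Nil: "letters n m (\<lambda>i j. a j i) = [] \<longleftrightarrow> letters m n a = []"
proof -
  have "length (letters n m (\<lambda>i j. a j i)) = length (letters m n a)"
    unfolding length_letters by (rule sum.swap)
  then show ?thesis by (metis length_0_conv)
qed

theorem insert_letters_transpose:
  "insert_letters n m (\<lambda>i j. a j i) = prod.swap (insert_letters m n a)"
proof (induction "length (letters m n a)" arbitrary: a rule: less_induct)
  case less
  show ?case
  proof (cases "letters m n a = []")
    case True
    then show ?thesis using letters_transpose_Nil[of n m a] by (simp add: insert_letters_def)
  next
    case False
    have "length (letters m n (bump a)) < length (letters m n a)"
      using length_letters_bump[of a m n] lpp_pos[OF False] by linarith
    note IH = less[OF this]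
    have ne: "letters n m (\<lambda>i j. a j i) \<noteq> []" using False letters_transpose_Nil by metis
    have P: "row_P n m (\<lambda>i j. a j i) = row_Q m n a" and Q: "row_Q n m (\<lambda>i j. a j i) = row_P m n a"
      using row_P_transpose[of n m a] row_P_transpose[of m n "\<lambda>i j. a j i"] by simp_all
    have B: "insert_letters n m (bump (\<lambda>i j. a j i)) = prod.swap (insert_letters m n (bump a))"
      unfolding bump_transpose[of a] by (rule IH)
    show ?thesis
      unfolding insert_letters_rec[OF False] insert_letters_rec[OF ne] P Q B by simp
  qed
qed

text \<open>In the step both predecessors are at most \<open>lpp a i j\<close>, which is exactly
  what \<open>bump\<close> subtracts from the minimum of the neighbours. This is what makes the
  second row no longer than the first.\<close>

lemma lpp_bump_le: "lpp (bump a) i j \<le> lpp a (i - 1) j \<and> lpp (bump a) i j \<le> lpp a i (j - 1)"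
proof (induction i arbitrary: j)
  case (Suc i)
  note IH = this
  show ?case
  proof (induction j)
    case (Suc j)
    have 1: "lpp (bump a) i (Suc j) \<le> lpp a i j" "lpp (bump a) (Suc i) j \<le> lpp a i j"
      using IH[of "Suc j"] Suc by simp_all
    show ?case using 1 bump_Suc[of a i j] unfolding lpp.simps(3)[of "bump a"] by (simp only: diff_Suc_1) linarith
  qed simp
qed simp

section \<open>Adding one letter\<close>

lemma lpp_le_sum: "lpp a i j \<le> (\<Sum>u=1..i. \<Sum>c=1..j. a u c)"
proof (induction a i j rule: lpp.induct)
  case (3 a i j)
  have "(\<Sum>u=1..i. \<Sum>c=1..Suc j. a u c) + a (Suc i) (Suc j) \<le> (\<Sum>u=1..Suc i. \<Sum>c=1..Suc j. a u c)"
    "(\<Sum>u=1..Suc i. \<Sum>c=1..j. a u c) + a (Suc i) (Suc j) \<le> (\<Sum>u=1..Suc i. \<Sum>c=1..Suc j. a u c)"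
    by (simp_all add: sum.distrib)
  then show ?case using 3 by simp
qed auto

lemma lpp_ge_row:
  assumes "1 \<le> i" "j0 \<le> j"
  shows "lpp a i j0 + (\<Sum>c=Suc j0..j. a i c) \<le> lpp a i j"
  using assms(2)
proof (induction j rule: dec_induct)
  case (step j)
  obtain i' where i: "i = Suc i'" using assms(1) by (cases i) auto
  show ?case using step i by simp
qed simp

lemma lpp_ge_col:
  assumes "1 \<le> j" "i0 \<le> i"
  shows "lpp a i0 j + (\<Sum>u=Suc i0..i. a u j) \<le> lpp a i j"
  using lpp_ge_row[OF assms, of "\<lambda>i j. a j i"] by (simp add: lpp_transpose[of a])

text \<open>The sum is the weight of the path down column \<open>l\<close> to row \<open>k\<close>
  and then along row \<open>k\<close>; the entry at the corner is counted once.\<close>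

lemma lpp_ge_hook:
  assumes "1 \<le> k" "1 \<le> l" "l \<le> j"
  shows "(\<Sum>u=1..k. a u l) + (\<Sum>c=Suc l..j. a k c) \<le> lpp a k j"
  using lpp_ge_col[of l 0 k a] lpp_ge_row[of k l j a] assms by simp

lemma sum_split_at:
  fixes f :: "nat \<Rightarrow> nat"
  assumes "1 \<le> k" "k \<le> m"
  shows "(\<Sum>i=1..m. f i) = (\<Sum>i=1..k-1. f i) + f k + (\<Sum>i=Suc k..m. f i)"
proof -
  have "{1..m} = {1..k-1} \<union> {k} \<union> {Suc k..m}" using assms by auto
  moreover have "sum f ({1..k-1} \<union> {k} \<union> {Suc k..m}) = (\<Sum>i=1..k-1. f i) + f k + (\<Sum>i=Suc k..m. f i)"
    using assms by (subst sum.union_disjoint; auto)+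
  ultimately show ?thesis by simp
qed

definition add_entry :: "nat \<Rightarrow> nat \<Rightarrow> (nat \<Rightarrow> nat \<Rightarrow> nat) \<Rightarrow> nat \<Rightarrow> nat \<Rightarrow> nat" where
  "add_entry k l a i j = a i j + (if i = k \<and> j = l then 1 else 0)"

lemma add_entry_transpose: "add_entry l k (\<lambda>i j. a j i) = (\<lambda>i j. add_entry k l a j i)"
  by (auto simp: add_entry_def fun_eq_iff)

text \<open>Equivalently, the entry \<open>(k, l)\<close> is at least the sum of all entries outside its row and column.\<close>

locale dominant_entry =
  fixes m n k l :: nat and a :: "nat \<Rightarrow> nat \<Rightarrow> nat"
  assumes k: "1 \<le> k" "k \<le> m" and l: "1 \<le> l" "l \<le> n"
    and dominant: "(\<Sum>i=1..m. \<Sum>j=1..n. a i j) \<le> (\<Sum>j=1..n. a k j) + (\<Sum>i=1..m. a i l)"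
begin

lemma transposed: "dominant_entry n m l k (\<lambda>i j. a j i)"
proof
  show "(\<Sum>i=1..n. \<Sum>j=1..m. a j i) \<le> (\<Sum>j=1..m. a j l) + (\<Sum>i=1..n. a k i)"
    using dominant by (subst sum.swap) simp
qed (use k l in auto)

text \<open>Cancel row \<open>k\<close> in \<open>dominant\<close>, and then the part of column
  \<open>l\<close> below row \<open>k\<close>, which is contained in the rows below.\<close>

lemma rows_above: "(\<Sum>i=1..k-1. \<Sum>j=1..n. a i j) \<le> (\<Sum>i=1..k. a i l)"
proof -
  have "(\<Sum>i=Suc k..m. a i l) \<le> (\<Sum>i=Suc k..m. \<Sum>j=1..n. a i j)"
    using l by (intro sum_mono member_le_sum) auto
  moreover have "(\<Sum>i=1..m. a i l) = (\<Sum>i=1..k. a i l) + (\<Sum>i=Suc k..m. a i l)"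
    using sum_split_at[OF k, of "\<lambda>i. a i l"] k sum_split_at[of k k "\<lambda>i. a i l"] by simp
  ultimately show ?thesis
    using dominant sum_split_at[OF k, of "\<lambda>i. \<Sum>j=1..n. a i j"] by linarith
qed

text \<open>A path ending above row \<open>k\<close> weighs no more than all rows above
  \<open>k\<close>, hence no more than the hook through \<open>(k, l)\<close>. The column
  \<open>j'\<close> may lie to the right of \<open>j\<close>.\<close>

lemma lpp_above_le:
  assumes "l \<le> j" "j' \<le> n"
  shows "lpp a (k - 1) j' \<le> lpp a k j"
proof -
  have "lpp a (k - 1) j' \<le> (\<Sum>i=1..k-1. \<Sum>j=1..j'. a i j)" by (rule lpp_le_sum)
  also have "\<dots> \<le> (\<Sum>i=1..k-1. \<Sum>j=1..n. a i j)"
    using assms by (intro sum_mono sum_mono2) auto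
  also have "\<dots> \<le> (\<Sum>i=1..k. a i l)" by (rule rows_above)
  also have "\<dots> \<le> lpp a k j" using lpp_ge_hook[OF k(1) l(1) assms(1), of a] by simp
  finally show ?thesis .
qed

lemma lpp_left_le: "k \<le> i \<Longrightarrow> i' \<le> m \<Longrightarrow> lpp a i' (l - 1) \<le> lpp a i l"
  using dominant_entry.lpp_above_le[OF transposed, of i i'] by (simp add: lpp_transpose[of a])

lemma lpp_add_entry:
  "i \<le> m \<Longrightarrow> j \<le> n \<Longrightarrow>
    lpp (add_entry k l a) i j = lpp a i j + (if k \<le> i \<and> l \<le> j then 1 else 0)"
proof (induction i arbitrary: j)
  case 0
  then show ?case using k by simp
next
  case (Suc i)
  note IH = this
  show ?case using \<open>j \<le> n\<close>
  proof (induction j)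
    case 0
    then show ?case using l by simp
  next
    case (Suc j)
    have e: "lpp (add_entry k l a) i (Suc j) = lpp a i (Suc j) + (if k \<le> i \<and> l \<le> Suc j then 1 else 0)"
      "lpp (add_entry k l a) (Suc i) j = lpp a (Suc i) j + (if k \<le> Suc i \<and> l \<le> j then 1 else 0)"
      using IH Suc by simp_all
    \<comment> \<open>Only where exactly one predecessor is raised could the maximum fail to rise;
      there the raised one was already at least as large as the other.\<close>
    have "lpp a i (Suc j) \<le> lpp a (Suc i) j" if "k = Suc i" "l \<le> j"
      using lpp_above_le[of j "Suc j"] that Suc by simp
    moreover have "lpp a (Suc i) j \<le> lpp a i (Suc j)" if "l = Suc j" "k \<le> i"
      using lpp_left_le[of i "Suc i"] that IH by simp
    moreover have "add_entry k l a (Suc i) (Suc j) = a (Suc i) (Suc j) + (if k = Suc i \<and> l = Suc j then 1 else 0)"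
      by (auto simp: add_entry_def)
    ultimately show ?case unfolding lpp.simps(3) e by (auto simp: max_def le_Suc_eq)
  qed
qed

text \<open>Where exactly one predecessor is raised, the other one attains the minimum and the
  diagonal predecessor is not raised; where both are raised, so is the diagonal one.\<close>

lemma bump_add_entry:
  assumes "1 \<le> i" "i \<le> m" "1 \<le> j" "j \<le> n"
  shows "bump (add_entry k l a) i j = bump a i j"
proof -
  obtain i' j' where ij: "i = Suc i'" "j = Suc j'" using assms by (cases i; cases j) auto
  have "lpp a i' (Suc j') \<le> lpp a (Suc i') j'" if "k = Suc i'" "l \<le> j'"
    using lpp_above_le[of j' "Suc j'"] that assms ij by simp
  moreover have "lpp a (Suc i') j' \<le> lpp a i' (Suc j')" if "l = Suc j'" "k \<le> i'"
    using lpp_left_le[of i' "Suc i'"] that assms ij by simp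
  ultimately show ?thesis
    using assms ij by (auto simp: bump_def lpp_add_entry min_def le_Suc_eq)
qed

end

section \<open>Where the new letters enter the first rows\<close>

lemma sorted_nth_le_iff: "sorted R \<Longrightarrow> i < length R \<Longrightarrow> R ! i \<le> v \<longleftrightarrow> i < count_le R v"
proof (induction R arbitrary: i)
  case (Cons x R)
  show ?case
  proof (cases "x \<le> v")
    case False
    then have "count_le R v = 0" "\<forall>y\<in>set (x # R). v < y"
      using Cons.prems by (auto intro!: count_le_none)
    then show ?thesis using False Cons.prems(2) nth_mem[OF Cons.prems(2)] by auto
  qed (use Cons in \<open>cases i; auto\<close>)
qed simp

text \<open>The admissible positions are those of the block of letters \<open>k\<close>, including
  both of its ends.\<close>

lemma sorted_insert_at:
  assumes "sorted R" "count_le R (k - 1) \<le> t" "t \<le> count_le R k" "1 \<le> k"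
  shows "sorted (take t R @ k # drop t R)"
proof -
  have "x \<le> k" if "x \<in> set (take t R)" for x
    using that sorted_nth_le_iff[OF assms(1)] assms(3) by (auto simp: in_set_conv_nth)
  moreover have "k \<le> x" if x: "x \<in> set (drop t R)" for x
  proof -
    obtain i where i: "i < length R - t" "x = R ! (t + i)" using x by (auto simp: in_set_conv_nth)
    then have "\<not> R ! (t + i) \<le> k - 1"
      using sorted_nth_le_iff[OF assms(1), of "t + i" "k - 1"] assms(2) by simp
    then show ?thesis using i by simp
  qed
  moreover have "x \<le> y" if "x \<in> set (take t R)" "y \<in> set (drop t R)" for x y
    using that calculation by (meson order_trans)
  ultimately show ?thesis using assms(1) by (auto simp: sorted_append sorted_wrt_take sorted_wrt_drop)
qed

lemma row_P_facts:
  "sorted (row_P m n a)" "set (row_P m n a) \<subseteq> {1..m}" "v \<le> m \<Longrightarrow> count_le (row_P m n a) v = lpp a v n"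
  using row_step_letters[OF row_step_letters_eq[of m n a]] by auto

context dominant_entry
begin

text \<open>The resulting row is the same wherever in the block of \<open>k\<close> the letter
  enters. The freedom in \<open>t\<close> is what later allows one column for both tableaux.\<close>

lemma row_P_add_entry:
  assumes "lpp a (k - 1) n \<le> t" "t \<le> lpp a k n"
  shows "row_P m n (add_entry k l a) = take t (row_P m n a) @ k # drop t (row_P m n a)"
    (is "_ = ?X")
  unfolding row_P_def[of m n "add_entry k l a"]
proof (rule eq_spell[symmetric])
  show "sorted ?X"
    using assms k row_P_facts(3)[of "k - 1" m n a] row_P_facts(3)[of k m n a]
    by (intro sorted_insert_at row_P_facts) auto
  show "set ?X \<subseteq> {1..m}"
    using row_P_facts(2)[of m n a] k by (auto dest: in_set_takeD in_set_dropD)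
  fix i assume i: "i \<in> {1..m}"
  have "count_list (row_P m n a) i = count_list (take t (row_P m n a) @ drop t (row_P m n a)) i"
    by simp
  then have "count_list ?X i = count_list (row_P m n a) i + (if i = k then 1 else 0)"
    unfolding count_list_append by simp
  also have "\<dots> = lpp a i n - lpp a (i - 1) n + (if i = k then 1 else 0)"
    using i by (simp add: row_P_def count_list_spell)
  also have "\<dots> = lpp (add_entry k l a) i n - lpp (add_entry k l a) (i - 1) n"
    using i l lpp_mono[of "i - 1" i n n a] by (auto simp: lpp_add_entry)
  finally show "count_list ?X i = lpp (add_entry k l a) i n - lpp (add_entry k l a) (i - 1) n" .
qed

lemma row_Q_add_entry:
  assumes "lpp a m (l - 1) \<le> t" "t \<le> lpp a m l"
  shows "row_Q m n (add_entry k l a) = take t (row_Q m n a) @ l # drop t (row_Q m n a)"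
  using dominant_entry.row_P_add_entry[OF transposed, of t] assms
  unfolding add_entry_transpose[of l k a] row_P_transpose[of n m a]
    row_P_transpose[of n m "add_entry k l a"] lpp_transpose[of a] by simp

end

lemma letters_cong:
  "(\<And>i j. 1 \<le> i \<Longrightarrow> i \<le> m \<Longrightarrow> 1 \<le> j \<Longrightarrow> j \<le> n \<Longrightarrow> a i j = b i j) \<Longrightarrow> letters m n a = letters m n b"
  unfolding letters_def
  by (intro arg_cong[of _ _ concat] map_cong refl arg_cong2[of _ _ _ _ map] spell_cong) auto

text \<open>By \<open>lpp_bump_le\<close>, passing to the bumped matrix does not increase the last
  passage time, which is the length of the first row.\<close>

lemma rows_le_lpp: "r \<in> set (fst (insert_letters m n a)) \<Longrightarrow> length r \<le> lpp a m n"
proof (induction "length (letters m n a)" arbitrary: a rule: less_induct)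
  case less
  show ?case
  proof (cases "letters m n a = []")
    case True
    then show ?thesis using less.prems by (simp add: insert_letters_def)
  next
    case False
    have "length (letters m n (bump a)) < length (letters m n a)"
      using length_letters_bump[of a m n] lpp_pos[OF False] by linarith
    note IH = less.hyps[OF this]
    have "lpp (bump a) m n \<le> lpp a (m - 1) n" using lpp_bump_le by blast
    also have "\<dots> \<le> lpp a m n" by (intro lpp_mono) auto
    finally have "lpp (bump a) m n \<le> lpp a m n" .
    then show ?thesis
      using less.prems IH insert_letters_rec[OF False] length_row_P[of m n a]
      by (fastforce intro: order_trans)
  qed
qed

section \<open>Bitableaux with an additional column of length one\<close>

lemma bitableau_Cons:
  "bitableau (R # P) (S # Q) =
    (\<Prod>c<length R. zminor ((if c < length R then [R ! c] else []) @ tab_column P c)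
       ((if c < length S then [S ! c] else []) @ tab_column Q c))"
  by (simp add: bitableau_def num_columns_def tab_column_def)

lemma tab_column_Nil: "\<forall>r\<in>set P. length r \<le> c \<Longrightarrow> tab_column P c = []"
  by (induction P) (auto simp: tab_column_def)

lemma zminor_single: "zminor [i] [j] = zvar i j"
  unfolding zminor_def by (subst det_single) (auto)

text \<open>Columns before \<open>t\<close> are unchanged, and column \<open>t\<close> contributes
  the variable. No lower row reaches column \<open>t\<close>, so the columns after it are single
  first-row entries, shifted by one.\<close>

lemma bitableau_insert_at:
  assumes len: "length R = length S" "t \<le> length R"
    and P: "\<forall>r\<in>set P. length r \<le> t" and Q: "\<forall>r\<in>set Q. length r \<le> t"
  shows "bitableau ((take t R @ k # drop t R) # P) ((take t S @ l # drop t S) # Q) =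
    zvar k l * bitableau (R # P) (S # Q)"
proof -
  define f where "f R S c = zminor ((if c < length R then [R ! c] else []) @ tab_column P c)
       ((if c < length S then [S ! c] else []) @ tab_column Q c)" for R S :: "nat list" and c
  let ?R = "take t R @ k # drop t R" and ?S = "take t S @ l # drop t S"
  have col: "tab_column P c = []" "tab_column Q c = []" if "t \<le> c" for c
    using P Q that by (auto intro!: tab_column_Nil)
  have lt: "f ?R ?S c = f R S c" if "c < t" for c
    using that len by (simp add: f_def nth_append)
  have eq: "f ?R ?S t = zvar k l"
    using len by (simp add: f_def col nth_append zminor_single)
  have gt: "f ?R ?S (Suc c) = f R S c" if "t \<le> c" for c
    using that len by (simp add: f_def col nth_append Suc_diff_le)
  have "bitableau (?R # P) (?S # Q) = (\<Prod>c<Suc (length R). f ?R ?S c)"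
    using len by (simp add: bitableau_Cons f_def)
  also have "{..<Suc (length R)} = {..<t} \<union> {t..<Suc (length R)}" using len by auto
  also have "(\<Prod>c\<in>{..<t} \<union> {t..<Suc (length R)}. f ?R ?S c) =
      (\<Prod>c<t. f ?R ?S c) * (\<Prod>c\<in>{t..<Suc (length R)}. f ?R ?S c)"
    by (intro prod.union_disjoint) auto
  also have "(\<Prod>c<t. f ?R ?S c) = (\<Prod>c<t. f R S c)"
    by (intro prod.cong) (auto simp: lt)
  also have "(\<Prod>c\<in>{t..<Suc (length R)}. f ?R ?S c) = zvar k l * (\<Prod>c\<in>{Suc t..<Suc (length R)}. f ?R ?S c)"
    using prod.atLeast_Suc_lessThan[of t "Suc (length R)" "f ?R ?S"] len(2) unfolding eq less_Suc_eq_le by blast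
  also have "(\<Prod>c\<in>{Suc t..<Suc (length R)}. f ?R ?S c) = (\<Prod>c\<in>{t..<length R}. f R S c)"
    unfolding prod.shift_bounds_Suc_ivl by (intro prod.cong) (auto simp: gt)
  also have "(\<Prod>c<t. f R S c) * (zvar k l * (\<Prod>c\<in>{t..<length R}. f R S c)) =
      zvar k l * ((\<Prod>c<t. f R S c) * (\<Prod>c\<in>{t..<length R}. f R S c))"
    by (simp add: ac_simps)
  also have "(\<Prod>c<t. f R S c) * (\<Prod>c\<in>{t..<length R}. f R S c) = (\<Prod>c\<in>{..<t} \<union> {t..<length R}. f R S c)"
    by (intro prod.union_disjoint[symmetric]) auto
  also have "{..<t} \<union> {t..<length R} = {..<length R}" using len by auto
  also have "(\<Prod>c<length R. f R S c) = bitableau (R # P) (S # Q)"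
    by (simp add: bitableau_Cons f_def)
  finally show ?thesis .
qed

lemma insert_letters_Nil: "letters m n a = [] \<Longrightarrow> insert_letters m n a = ([], [])"
  by (simp add: insert_letters_def)

text \<open>An empty first row on top of empty tableaux still gives the empty product, so in terms
  of bitableaux the recursion also covers the empty word.\<close>

lemma bitableau_insert_letters:
  "case_prod bitableau (insert_letters m n a) =
    bitableau (row_P m n a # fst (insert_letters m n (bump a))) (row_Q m n a # snd (insert_letters m n (bump a)))"
proof (cases "letters m n a = []")
  case True
  then have "length (row_P m n a) = 0" "letters m n (bump a) = []"
    using length_letters_bump[of a m n] length_row_P[of m n a] by auto
  then show ?thesis using True
    by (simp add: insert_letters_Nil bitableau_def num_columns_def)
qed (simp add: insert_letters_rec)

context dominant_entry
begin

theorem bitableau_add_entry: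
  "case_prod bitableau (insert_letters m n (add_entry k l a)) =
    zvar k l * case_prod bitableau (insert_letters m n a)"
proof -
  let ?IL = "insert_letters m n (bump a)"
  let ?c = "lpp (bump a) m n"
  \<comment> \<open>The first column beyond the lower rows that is not before the block of
    \<open>k\<close> in \<open>P\<close> or the block of \<open>l\<close> in \<open>Q\<close>;
    \<open>t1\<close> and \<open>t2\<close> say that it does not pass the ends of these
    blocks.\<close>
  define t where "t = max ?c (max (lpp a (k - 1) n) (lpp a m (l - 1)))"
  have len: "lpp a m n + length (letters m n (bump a)) = (\<Sum>i=1..m. \<Sum>j=1..n. a i j)"
    using length_letters_bump[of a m n] sum.swap[of "\<lambda>j i. a i j" "{1..m}" "{1..n}"]
    unfolding length_letters by simp
  have c: "?c \<le> length (letters m n (bump a))"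
    using length_letters_bump[of "bump a" m n] by simp
  have row: "(\<Sum>j=1..n. a k j) = (\<Sum>j=1..l. a k j) + (\<Sum>j=Suc l..n. a k j)"
    using sum_split_at[OF l, of "a k"] l sum_split_at[of l l "a k"] by simp
  have col: "(\<Sum>i=1..m. a i l) = (\<Sum>i=1..k. a i l) + (\<Sum>i=Suc k..m. a i l)"
    using sum_split_at[OF k, of "\<lambda>i. a i l"] k sum_split_at[of k k "\<lambda>i. a i l"] by simp
  have h1: "(\<Sum>i=1..k. a i l) + (\<Sum>j=Suc l..n. a k j) \<le> lpp a k n"
    using lpp_ge_hook[of k l n a] k l by simp
  have h2: "(\<Sum>j=1..l. a k j) + (\<Sum>i=Suc k..m. a i l) \<le> lpp a m l"
    using lpp_ge_hook[of l k m "\<lambda>i j. a j i"] k l by (simp add: lpp_transpose[of a])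
  have g: "lpp a k n \<le> lpp a m n" "lpp a m l \<le> lpp a m n"
    using k l by (auto intro!: lpp_mono)
  \<comment> \<open>By \<open>h1\<close> and \<open>h2\<close>, the sum of \<open>lpp a k n\<close>
    and \<open>lpp a m l\<close> is at least row plus column, hence at least the total, which is
    \<open>lpp a m n\<close> plus the number of bumped letters. Since neither exceeds
    \<open>lpp a m n\<close>, each is at least that number.\<close>
  have "?c \<le> lpp a k n" "?c \<le> lpp a m l"
    using len c dominant row col h1 h2 g by simp_all
  moreover have "lpp a (k - 1) n \<le> lpp a k n" "lpp a m (l - 1) \<le> lpp a m l"
    by (auto intro!: lpp_mono)
  moreover have "lpp a (k - 1) n \<le> lpp a m l"
    using lpp_above_le[of l n] lpp_mono[of k m l l a] k l by simp
  moreover have "lpp a m (l - 1) \<le> lpp a k n"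
    using lpp_left_le[of k m] lpp_mono[of k k l n a] k l by simp
  ultimately have t1: "t \<le> lpp a k n" and t2: "t \<le> lpp a m l"
    unfolding t_def by simp_all
  have bump_eq: "insert_letters m n (bump (add_entry k l a)) = ?IL"
    unfolding insert_letters_def using letters_cong[OF bump_add_entry] by simp
  have sh: "map length (fst ?IL) = map length (snd ?IL)"
    using insert_biletters_content[of "letters m n (bump a)"]
    by (metis insert_letters_def prod.collapse)
  have P: "\<forall>r\<in>set (fst ?IL). length r \<le> t"
    using rows_le_lpp[of _ m n "bump a"] unfolding t_def by fastforce
  have "length ` set (snd ?IL) = length ` set (fst ?IL)"
    using sh by (metis list.set_map)
  then have Q: "\<forall>r\<in>set (snd ?IL). length r \<le> t" using P by force
  have "lpp a (k - 1) n \<le> t" "lpp a m (l - 1) \<le> t" by (simp_all add: t_def)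
  note rows = row_P_add_entry[OF this(1) t1] row_Q_add_entry[OF this(2) t2]
  have "length (row_P m n a) = length (row_Q m n a)" "t \<le> length (row_P m n a)"
    using t1 g by (simp_all add: length_row_P length_row_Q)
  note * = bitableau_insert_at[OF this P Q]
  show ?thesis
    unfolding bitableau_insert_letters bump_eq rows by (rule *)
qed

end

section \<open>Relabelling\<close>

text \<open>The pushforward along \<open>h\<close>. On exponents it relabels matrix positions;
  \<open>push (push \<kappa>)\<close> renames the variables of a polynomial.\<close>

definition push :: "('a \<Rightarrow> 'b) \<Rightarrow> ('a \<Rightarrow>\<^sub>0 'c) \<Rightarrow> ('b \<Rightarrow>\<^sub>0 'c :: comm_monoid_add)" where
  "push h f = (\<Sum>x\<in>Poly_Mapping.keys f. Poly_Mapping.single (h x) (Poly_Mapping.lookup f x))"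

lemma poly_mapping_expansion:
  "f = (\<Sum>x\<in>Poly_Mapping.keys f. Poly_Mapping.single x (Poly_Mapping.lookup f x))"
proof (rule poly_mapping_eqI)
  fix y
  show "Poly_Mapping.lookup f y =
      Poly_Mapping.lookup (\<Sum>x\<in>Poly_Mapping.keys f. Poly_Mapping.single x (Poly_Mapping.lookup f x)) y"
    by (simp add: lookup_sum lookup_single when_def sum.delta' in_keys_iff)
qed

lemma lookup_push [simp]:
  assumes "inj h"
  shows "Poly_Mapping.lookup (push h f) (h x) = Poly_Mapping.lookup f x"
  using assms
  by (simp add: push_def lookup_sum lookup_single when_def inj_eq sum.delta' in_keys_iff)

lemma lookup_push_outside: "y \<notin> range h \<Longrightarrow> Poly_Mapping.lookup (push h f) y = 0"
  by (auto simp: push_def lookup_sum lookup_single when_def intro!: sum.neutral)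

lemma keys_push:
  assumes "inj h"
  shows "Poly_Mapping.keys (push h f) = h ` Poly_Mapping.keys f"
proof (intro equalityI subsetI)
  fix y assume y: "y \<in> Poly_Mapping.keys (push h f)"
  then obtain x where "y = h x" using lookup_push_outside[of y h f] by (auto simp: in_keys_iff)
  then show "y \<in> h ` Poly_Mapping.keys f" using y assms by (auto simp: in_keys_iff)
qed (use assms in \<open>auto simp: in_keys_iff\<close>)

lemma push_eqI:
  assumes "inj h" "\<And>x. Poly_Mapping.lookup g (h x) = Poly_Mapping.lookup f x"
    "\<And>y. y \<notin> range h \<Longrightarrow> Poly_Mapping.lookup g y = 0"
  shows "push h f = g"
proof (rule poly_mapping_eqI)
  fix y show "Poly_Mapping.lookup (push h f) y = Poly_Mapping.lookup g y"
    by (cases "y \<in> range h") (use assms in \<open>auto simp: lookup_push_outside\<close>)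
qed

lemma push_add: "inj h \<Longrightarrow> push h (f + g) = push h f + push h g"
  by (rule push_eqI) (auto simp: lookup_add lookup_push_outside)

lemma push_zero [simp]: "push h 0 = 0"
  by (simp add: push_def)

lemma push_single [simp]: "push h (Poly_Mapping.single x c) = Poly_Mapping.single (h x) c"
  by (simp add: push_def)

lemma push_sum: "inj h \<Longrightarrow> push h (\<Sum>i\<in>I. F i) = (\<Sum>i\<in>I. push h (F i))"
  by (induction I rule: infinite_finite_induct) (auto simp: push_add)

lemma inj_push: "inj h \<Longrightarrow> inj (push h)"
  by (rule injI, rule poly_mapping_eqI) (metis lookup_push)

lemma push_mult:
  fixes f g :: "('a :: monoid_add) \<Rightarrow>\<^sub>0 ('c :: comm_ring_1)" and h :: "'a \<Rightarrow> 'b :: monoid_add"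
  assumes "inj h" "\<And>x y. h (x + y) = h x + h y"
  shows "push h (f * g) = push h f * push h g"
proof -
  have "push h (f * g) = push h ((\<Sum>x\<in>Poly_Mapping.keys f. Poly_Mapping.single x (Poly_Mapping.lookup f x)) *
      (\<Sum>y\<in>Poly_Mapping.keys g. Poly_Mapping.single y (Poly_Mapping.lookup g y)))"
    using poly_mapping_expansion[of f] poly_mapping_expansion[of g] by simp
  also have "\<dots> = push h f * push h g"
    unfolding push_def[of h f] push_def[of h g] sum_product mult_single
    by (simp add: push_sum[OF assms(1)] assms(2))
  finally show ?thesis .
qed

lemma push_comm_ring_hom:
  fixes h :: "'a :: comm_monoid_add \<Rightarrow> 'b :: comm_monoid_add"
  assumes "inj h" "h 0 = 0" "\<And>x y. h (x + y) = h x + h y"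
  shows "comm_ring_hom (push h :: ('a \<Rightarrow>\<^sub>0 'c :: comm_ring_1) \<Rightarrow> _)"
proof
  show "push h (1 :: 'a \<Rightarrow>\<^sub>0 'c) = 1"
    using push_single[of h 0 "1 :: 'c"] assms(2) by simp
qed (use assms in \<open>auto simp: push_add push_mult\<close>)

text \<open>As a ring homomorphism, a renaming of variables passes through determinants and through
  the product over columns.\<close>

lemma zpoly_push_hom: "inj \<kappa> \<Longrightarrow> comm_ring_hom (push (push \<kappa>) :: zpoly \<Rightarrow> zpoly)"
  by (intro push_comm_ring_hom inj_push push_add) auto

lemma push_zvar: "push (push \<kappa>) (zvar i j) = (case \<kappa> (i, j) of (i', j') \<Rightarrow> zvar i' j')"
  by (simp add: zvar_def monomial_def split: prod.split)

lemma push_zminor: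
  assumes "inj f" "inj g"
  shows "push (push (map_prod f g)) (zminor I J) = zminor (map f I) (map g J)"
proof -
  interpret comm_ring_hom "push (push (map_prod f g)) :: zpoly \<Rightarrow> zpoly"
    by (intro zpoly_push_hom prod.inj_map assms)
  show ?thesis unfolding zminor_def hom_det[symmetric]
    by (intro arg_cong[of _ _ det] eq_matI) (auto simp: push_zvar)
qed

lemma push_swap_zminor:
  assumes "length I = length J"
  shows "push (push prod.swap) (zminor I J) = zminor J I"
proof -
  interpret comm_ring_hom "push (push prod.swap) :: zpoly \<Rightarrow> zpoly"
    by (intro zpoly_push_hom) simp
  let ?A = "mat (length J) (length I) (\<lambda>(a, b). zvar (J ! a) (I ! b))"
  have "push (push prod.swap) (zminor I J) = det (transpose_mat ?A)"
    unfolding zminor_def hom_det[symmetric]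
    by (intro arg_cong[of _ _ det] eq_matI) (auto simp: push_zvar)
  also have "\<dots> = zminor J I"
    unfolding zminor_def using assms by (intro det_transpose[of _ "length I"]) simp
  finally show ?thesis .
qed

section \<open>Renaming variables in bitableaux\<close>

lemma tab_column_map: "tab_column (map (map f) P) c = map f (tab_column P c)"
  by (induction P) (auto simp: tab_column_def)

lemma num_columns_map: "num_columns (map (map f) P) = num_columns P"
  by (cases P) (auto simp: num_columns_def)

lemma push_bitableau:
  assumes "inj f" "inj g"
  shows "push (push (map_prod f g)) (bitableau P Q) = bitableau (map (map f) P) (map (map g) Q)"
proof -
  interpret comm_ring_hom "push (push (map_prod f g)) :: zpoly \<Rightarrow> zpoly"
    by (intro zpoly_push_hom prod.inj_map assms)
  show ?thesis
    by (simp add: bitableau_def num_columns_map tab_column_map hom_prod push_zminor[OF assms])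
qed

lemma length_tab_column_filter:
  "length (tab_column P c) = length (filter (\<lambda>l. c < l) (map length P))"
  by (induction P) (auto simp: tab_column_def)

lemma length_tab_column:
  "map length P = map length Q \<Longrightarrow> length (tab_column P c) = length (tab_column Q c)"
  unfolding length_tab_column_filter by (rule arg_cong)

lemma num_columns_cong: "map length P = map length Q \<Longrightarrow> num_columns P = num_columns Q"
  by (cases P; cases Q) (auto simp: num_columns_def)

lemma push_swap_bitableau:
  assumes "map length P = map length Q"
  shows "push (push prod.swap) (bitableau P Q) = bitableau Q P"
proof -
  interpret comm_ring_hom "push (push prod.swap) :: zpoly \<Rightarrow> zpoly"
    by (intro zpoly_push_hom) simp
  show ?thesis
    unfolding bitableau_def hom_prod num_columns_cong[OF assms]
    by (intro prod.cong refl push_swap_zminor length_tab_column assms)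
qed

text \<open>Row insertion only compares entries, and a strictly increasing map preserves
  comparisons, equality and minima.\<close>

lemma row_insert_map:
  assumes f: "strict_mono f"
  shows "row_insert (map (map f) P) (f p) = map_prod (map (map f)) id (row_insert P p)"
proof (induction P arbitrary: p)
  case (Cons r P)
  have le: "f x \<le> f y \<longleftrightarrow> x \<le> y" and lt: "f x < f y \<longleftrightarrow> x < y" and eq: "f x = f y \<longleftrightarrow> x = y" for x y
    using f by (auto simp: strict_mono_less_eq strict_mono_less strict_mono_eq)
  show ?case
  proof (cases "\<forall>x\<in>set r. x \<le> p")
    case True
    then show ?thesis by (simp add: le)
  next
    case False
    have "{x \<in> set (map f r). f p < x} = f ` {x \<in> set r. p < x}" by (auto simp: lt)
    moreover have "f (Min {x \<in> set r. p < x}) = Min (f ` {x \<in> set r. p < x})"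
      using False f by (intro mono_Min_commute strict_mono_mono) (auto simp: not_le)
    ultimately have Min: "Min {x \<in> set (map f r). f p < x} = f (Min {x \<in> set r. p < x})" by simp
    define p' where "p' = Min {x \<in> set r. p < x}"
    have L: "(LEAST k. k < length (map f r) \<and> map f r ! k = f p') = (LEAST k. k < length r \<and> r ! k = p')"
      by (rule arg_cong[of _ _ Least]) (auto simp: fun_eq_iff eq)
    have F': "\<not> (\<forall>x\<in>set (map f r). x \<le> f p)" using False by (simp add: le)
    obtain P' i where PI: "row_insert P p' = (P', i)" by force
    have 1: "row_insert (r # P) p = (r[(LEAST k. k < length r \<and> r ! k = p') := p] # P', Suc i)"
      unfolding row_insert.simps if_not_P[OF False] Let_def p'_def[symmetric] PI by simp
    have 2: "row_insert (map (map f) (r # P)) (f p) =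
        ((map f r)[(LEAST k. k < length r \<and> r ! k = p') := f p] # map (map f) P', Suc i)"
      unfolding list.map row_insert.simps if_not_P[OF F'] Let_def Min p'_def[symmetric] L Cons PI by simp
    show ?thesis unfolding 1 2 by (simp add: map_update)
  qed
qed simp

text \<open>Labels of the second tableau are never compared, so \<open>g\<close> is
  arbitrary.\<close>

lemma insert_biletters_map:
  assumes "strict_mono f"
  shows "foldl insert_biletter (map (map f) P, map (map g) Q) (map (map_prod f g) w) =
    map_prod (map (map f)) (map (map g)) (foldl insert_biletter (P, Q) w)"
proof (induction w arbitrary: P Q)
  case (Cons x w)
  obtain p q where x: "x = (p, q)" by force
  obtain P' i where PI: "row_insert P p = (P', i)" by force
  have "insert_biletter (map (map f) P, map (map g) Q) (f p, g q) =
      (map (map f) P', map (map g) (add_box Q i q))"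
    using PI by (simp add: insert_biletter_def row_insert_map[OF assms] add_box_def map_update)
  moreover have "insert_biletter (P, Q) (p, q) = (P', add_box Q i q)"
    using PI by (simp add: insert_biletter_def)
  ultimately show ?case using Cons x by simp
qed simp

section \<open>Coefficients of the operator\<close>

definition rsk_coeff :: "nat \<Rightarrow> nat \<Rightarrow> exponent \<Rightarrow> exponent \<Rightarrow> complex" where
  "rsk_coeff m n \<beta> \<alpha> = Poly_Mapping.lookup (case_prod bitableau (rsk m n \<alpha>)) \<beta>"

lemma insert_letters_shape:
  "insert_letters m n a = (P, Q) \<Longrightarrow> map length P = map length Q"
  using insert_biletters_content by (simp add: insert_letters_def)

lemma inj_swap: "inj prod.swap"
  by simp

lemma rsk_coeff_transpose:
  "rsk_coeff n m (push prod.swap \<beta>) (push prod.swap \<alpha>) = rsk_coeff m n \<beta> \<alpha>"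
proof -
  obtain P Q where PQ: "insert_letters m n (\<lambda>i j. Poly_Mapping.lookup \<alpha> (i, j)) = (P, Q)" by force
  have l: "Poly_Mapping.lookup (push prod.swap \<alpha>) (i, j) = Poly_Mapping.lookup \<alpha> (j, i)" for i j
    using lookup_push[OF inj_swap, of \<alpha> "(j, i)"] by simp
  have "rsk n m (push prod.swap \<alpha>) = (Q, P)"
    unfolding rsk_eq_insert_letters l
    using insert_letters_transpose[of n m "\<lambda>i j. Poly_Mapping.lookup \<alpha> (i, j)"] PQ by simp
  then have "case_prod bitableau (rsk n m (push prod.swap \<alpha>)) = push (push prod.swap) (case_prod bitableau (rsk m n \<alpha>))"
    using PQ push_swap_bitableau[OF insert_letters_shape[OF PQ]] by (simp add: rsk_eq_insert_letters)
  then show ?thesis unfolding rsk_coeff_def by (simp add: inj_push)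
qed

text \<open>The increasing injection that misses exactly \<open>r\<close>; relabelling rows by it
  makes room for an empty row \<open>r\<close>.\<close>

definition skip :: "nat \<Rightarrow> nat \<Rightarrow> nat" where
  "skip r i = (if i < r then i else Suc i)"

lemma strict_mono_skip: "strict_mono (skip r)"
  by (auto simp: strict_mono_def skip_def)

lemma inj_skip: "inj (skip r)"
  using strict_mono_skip by (rule strict_mono_imp_inj_on)

lemma range_skip: "i \<in> range (skip r) \<longleftrightarrow> i \<noteq> r"
  by (cases i) (auto simp: skip_def image_iff intro: exI[of _ i] exI[of _ "i - 1"])

lemma inj_skip_row: "inj (map_prod (skip r) (id :: nat \<Rightarrow> nat))"
  by (intro prod.inj_map inj_skip) simp

lemma count_list_map_inj: "inj h \<Longrightarrow> count_list (map h xs) (h x) = count_list xs x"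
  by (induction xs) (auto simp: inj_eq)

lemma spell_skip:
  assumes "1 \<le> r" "r \<le> Suc m" "b r = 0" "\<And>i. b (skip r i) = h i"
  shows "spell b (Suc m) = map (skip r) (spell h m)"
proof (rule eq_spell[symmetric])
  have mono: "mono (skip r)" using strict_mono_skip by (rule strict_mono_mono)
  show "sorted (map (skip r) (spell h m))"
    using sorted_spell mono by (simp add: sorted_map mono_def sorted_wrt_mono_rel[of _ "(\<le>)"])
  show "set (map (skip r) (spell h m)) \<subseteq> {1..Suc m}"
    using set_spell[of h m] assms(1) by (fastforce simp: skip_def)
  fix i assume i: "i \<in> {1..Suc m}"
  show "count_list (map (skip r) (spell h m)) i = b i"
  proof (cases "i = r")
    case True
    then have "i \<notin> set (map (skip r) (spell h m))" using range_skip[of r r] by auto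
    then show ?thesis using True assms(3) by (simp add: count_notin)
  next
    case False
    then obtain i' where i': "i = skip r i'" using range_skip by blast
    then have "i' \<in> {1..m}" using i assms(1,2) by (auto simp: skip_def split: if_splits)
    moreover have "count_list (map (skip r) (spell h m)) i = count_list (spell h m) i'"
      unfolding i' by (rule count_list_map_inj[OF inj_skip])
    ultimately show ?thesis using i' assms(4) by (simp add: count_list_spell)
  qed
qed

text \<open>An empty row contributes no letters and only shifts the later row labels. This
  relabelling is strictly increasing, so it commutes with the insertion and renames the variables of
  the bitableau.\<close>

lemma rsk_coeff_skip_row:
  assumes "1 \<le> r" "r \<le> Suc m"
  shows "rsk_coeff (Suc m) n (push (map_prod (skip r) id) \<beta>) (push (map_prod (skip r) id) \<alpha>) =
    rsk_coeff m n \<beta> \<alpha>"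
proof -
  let ?\<kappa> = "map_prod (skip r) id"
  let ?a = "\<lambda>i j. Poly_Mapping.lookup \<alpha> (i, j)"
  let ?b = "\<lambda>i j. Poly_Mapping.lookup (push ?\<kappa> \<alpha>) (i, j)"
  have b: "?b (skip r i) j = ?a i j" for i j
    using lookup_push[OF inj_skip_row, of r \<alpha> "(i, j)"] by simp
  have "(r, j) \<notin> range ?\<kappa>" for j using range_skip[of r r] by auto
  then have br: "?b r j = 0" for j by (rule lookup_push_outside)
  have "spell (\<lambda>i. ?b i j) (Suc m) = map (skip r) (spell (\<lambda>i. ?a i j) m)" for j
    by (rule spell_skip[OF assms br b])
  then have "letters (Suc m) n ?b = map (map_prod (skip r) id) (letters m n ?a)"
    unfolding letters_def map_concat map_map by (simp only: map_map o_def map_prod_simp id_apply)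
  then have "rsk (Suc m) n (push ?\<kappa> \<alpha>) = map_prod (map (map (skip r))) (map (map id)) (rsk m n \<alpha>)"
    unfolding rsk_eq_insert_letters insert_letters_def
    using insert_biletters_map[OF strict_mono_skip, of r "[]" id "[]"] by simp
  moreover obtain P Q where PQ: "rsk m n \<alpha> = (P, Q)" by force
  ultimately have "case_prod bitableau (rsk (Suc m) n (push ?\<kappa> \<alpha>)) =
      push (push ?\<kappa>) (case_prod bitableau (rsk m n \<alpha>))"
    using push_bitableau[OF inj_skip, of "id :: nat \<Rightarrow> nat" r P Q] by simp
  then show ?thesis unfolding rsk_coeff_def by (simp add: inj_push inj_skip_row)
qed

text \<open>Multiplication by a variable is the pushforward along addition of its exponent.\<close>

lemma lookup_zvar_mult:
  "Poly_Mapping.lookup (zvar k l * f) (Poly_Mapping.single (k, l) 1 + \<beta>) = Poly_Mapping.lookup f \<beta>"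
proof -
  let ?E = "Poly_Mapping.single (k, l) (1 :: nat)"
  have inj: "inj ((+) ?E)" by simp
  have "zvar k l * f = zvar k l * (\<Sum>x\<in>Poly_Mapping.keys f. Poly_Mapping.single x (Poly_Mapping.lookup f x))"
    using poly_mapping_expansion[of f] by simp
  also have "\<dots> = push ((+) ?E) f"
    by (simp add: push_def zvar_def monomial_def sum_distrib_left mult_single)
  finally show ?thesis using lookup_push[OF inj, of f \<beta>] by simp
qed

lemma rsk_coeff_add_entry:
  assumes "dominant_entry m n k l (\<lambda>i j. Poly_Mapping.lookup \<alpha> (i, j))"
  shows "rsk_coeff m n (Poly_Mapping.single (k, l) 1 + \<beta>) (Poly_Mapping.single (k, l) 1 + \<alpha>) =
    rsk_coeff m n \<beta> \<alpha>"
proof -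
  let ?a = "\<lambda>i j. Poly_Mapping.lookup \<alpha> (i, j)"
  have "(\<lambda>i j. Poly_Mapping.lookup (Poly_Mapping.single (k, l) 1 + \<alpha>) (i, j)) = add_entry k l ?a"
    by (auto simp: fun_eq_iff add_entry_def lookup_add lookup_single)
  then show ?thesis
    unfolding rsk_coeff_def rsk_eq_insert_letters
    by (simp only: dominant_entry.bitableau_add_entry[OF assms] lookup_zvar_mult)
qed

lemma rsk_coeff_zero: "rsk_coeff m n 0 0 = 1"
proof -
  have "letters m n (\<lambda>i j. 0) = []"
    using length_letters[of m n "\<lambda>i j. 0"] by simp
  then show ?thesis
    by (simp add: rsk_coeff_def rsk_eq_insert_letters insert_letters_Nil bitableau_def num_columns_def)
qed

section \<open>Weights\<close>

text \<open>Exponents of products of listed variables with prescribed row and column indices. With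
  multisets, weights add under multiplication, and no bound on the indices has to be carried through
  minors and products.\<close>

definition content_exponents :: "nat multiset \<Rightarrow> nat multiset \<Rightarrow> exponent set" where
  "content_exponents I J =
    {\<Sum>x\<leftarrow>xs. Poly_Mapping.single x 1 |xs. mset (map fst xs) = I \<and> mset (map snd xs) = J}"

lemma content_exponents_single: "Poly_Mapping.single (i, j) 1 \<in> content_exponents {#i#} {#j#}"
  unfolding content_exponents_def by (intro CollectI exI[of _ "[(i, j)]"]) simp

lemma content_exponents_0: "0 \<in> content_exponents {#} {#}"
  unfolding content_exponents_def by (intro CollectI exI[of _ "[]"]) simp

lemma content_exponents_add:
  assumes "\<alpha> \<in> content_exponents I J" "\<beta> \<in> content_exponents I' J'"
  shows "\<alpha> + \<beta> \<in> content_exponents (I + I') (J + J')"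
proof -
  obtain xs ys where "\<alpha> = (\<Sum>x\<leftarrow>xs. Poly_Mapping.single x 1)" "\<beta> = (\<Sum>x\<leftarrow>ys. Poly_Mapping.single x 1)"
    "mset (map fst xs) = I" "mset (map snd xs) = J" "mset (map fst ys) = I'" "mset (map snd ys) = J'"
    using assms unfolding content_exponents_def by blast
  then show ?thesis unfolding content_exponents_def by (intro CollectI exI[of _ "xs @ ys"]) simp
qed

section \<open>Contents of minors and bitableaux\<close>

lemma keys_prod_content:
  assumes "\<And>i. i \<in> A \<Longrightarrow> Poly_Mapping.keys (F i :: zpoly) \<subseteq> content_exponents (M i) (N i)"
  shows "Poly_Mapping.keys (\<Prod>i\<in>A. F i) \<subseteq> content_exponents (\<Sum>i\<in>A. M i) (\<Sum>i\<in>A. N i)"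
  using assms
proof (induction A rule: infinite_finite_induct)
  case (insert x A)
  have "Poly_Mapping.keys (\<Prod>i\<in>A. F i) \<subseteq> content_exponents (\<Sum>i\<in>A. M i) (\<Sum>i\<in>A. N i)"
    using insert by simp
  moreover have "Poly_Mapping.keys (F x) \<subseteq> content_exponents (M x) (N x)" using insert.prems by simp
  ultimately show ?case using insert.hyps keys_mult[of "F x" "\<Prod>i\<in>A. F i"]
    by (auto intro!: content_exponents_add)
qed (simp_all add: content_exponents_0)

lemma sum_mset_nth: "(\<Sum>i\<in>{0..<length I}. {#I ! i#}) = mset I"
proof (induction I rule: rev_induct)
  case (snoc x I)
  have "(\<Sum>i\<in>{0..<length I}. {#(I @ [x]) ! i#}) = (\<Sum>i\<in>{0..<length I}. {#I ! i#})"
    by (intro sum.cong) (auto simp: nth_append)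
  then show ?case using snoc by simp
qed simp

text \<open>Every term of the Leibniz expansion takes one variable from each row and each column of
  the minor.\<close>

lemma keys_zminor:
  assumes "length I = length J"
  shows "Poly_Mapping.keys (zminor I J) \<subseteq> content_exponents (mset I) (mset J)"
proof -
  let ?n = "length I"
  let ?A = "mat (length I) (length J) (\<lambda>(a, b). zvar (I ! a) (J ! b))"
  have "zminor I J = (\<Sum>p\<in>{p. p permutes {0..<?n}}. signof p * (\<Prod>i = 0..<?n. ?A $$ (i, p i)))"
    unfolding zminor_def using assms by (intro det_def') auto
  moreover have "Poly_Mapping.keys (signof p * (\<Prod>i = 0..<?n. ?A $$ (i, p i)))
      \<subseteq> content_exponents (mset I) (mset J)" if p: "p permutes {0..<?n}" for p
  proof -
    have pi: "p i < ?n" if "i < ?n" for i using permutes_in_image[OF p, of i] that by simp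
    have "Poly_Mapping.keys (\<Prod>i = 0..<?n. ?A $$ (i, p i)) \<subseteq>
        content_exponents (\<Sum>i\<in>{0..<?n}. {#I ! i#}) (\<Sum>i\<in>{0..<?n}. {#J ! p i#})"
      using assms pi content_exponents_single
      by (intro keys_prod_content) (auto simp: zvar_def monomial_def)
    moreover have "(\<Sum>i\<in>{0..<?n}. {#J ! p i#}) = (\<Sum>i\<in>{0..<?n}. {#J ! i#})"
      using sum.permute[OF p, of "\<lambda>i. {#J ! i#}"] by (simp add: o_def)
    ultimately have "Poly_Mapping.keys (\<Prod>i = 0..<?n. ?A $$ (i, p i)) \<subseteq>
        content_exponents (mset I) (mset J)"
      using sum_mset_nth[of I] sum_mset_nth[of J] assms by simp
    moreover have "Poly_Mapping.keys (- f) = Poly_Mapping.keys f" for f :: zpoly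
      by (auto simp: in_keys_iff)
    ultimately show ?thesis by (auto simp: sign_def)
  qed
  ultimately show ?thesis
    using keys_sum[of "\<lambda>p. signof p * (\<Prod>i = 0..<?n. ?A $$ (i, p i))" "{p. p permutes {0..<?n}}"]
    by fastforce
qed

lemma sum_columns:
  assumes "\<forall>r\<in>set P. length r \<le> N"
  shows "(\<Sum>c<N. mset (tab_column P c)) = mset (concat P)"
  using assms
proof (induction P)
  case (Cons r P)
  have "tab_column (r # P) c = (if c < length r then [r ! c] else []) @ tab_column P c" for c
    by (simp add: tab_column_def)
  then have "(\<Sum>c<N. mset (tab_column (r # P) c)) =
      (\<Sum>c<N. (if c < length r then {#r ! c#} else {#}) + mset (tab_column P c))"
    by (intro sum.cong) auto
  also have "\<dots> = (\<Sum>c<N. if c < length r then {#r ! c#} else {#}) + (\<Sum>c<N. mset (tab_column P c))"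
    by (rule sum.distrib)
  also have "(\<Sum>c<N. if c < length r then {#r ! c#} else {#}) = (\<Sum>c\<in>{0..<length r}. {#r ! c#})"
    using Cons.prems by (intro sum.mono_neutral_cong_right) auto
  finally show ?case using Cons by (simp add: sum_mset_nth)
qed (simp add: tab_column_def)

lemma keys_bitableau:
  assumes "map length P = map length Q" "\<forall>r\<in>set P. length r \<le> num_columns P"
  shows "Poly_Mapping.keys (bitableau P Q) \<subseteq> content_exponents (mset (concat P)) (mset (concat Q))"
proof -
  have "length ` set P = length ` set Q" using assms(1) by (metis list.set_map)
  then have Q: "\<forall>r\<in>set Q. length r \<le> num_columns P" using assms(2) by (metis imageE imageI)
  show ?thesis
    using keys_prod_content[of "{..<num_columns P}" "\<lambda>c. zminor (tab_column P c) (tab_column Q c)",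
        OF keys_zminor[OF length_tab_column[OF assms(1)]]]
    unfolding bitableau_def sum_columns[OF assms(2)] sum_columns[OF Q] .
qed

section \<open>From multisets of indices to row and column sums\<close>

lemma count_list_fst:
  assumes "set xs \<subseteq> positions m n"
  shows "(\<Sum>j=1..n. count_list xs (i, j)) = count_list (map fst xs) i"
  using assms
proof (induction xs)
  case (Cons x xs)
  obtain p q where x: "x = (p, q)" by force
  have "q \<in> {1..n}" using Cons.prems x by (simp add: positions_def)
  then have "(\<Sum>j=1..n. if (p, q) = (i, j) then 1 else 0) = (if p = i then 1 else (0::nat))"
    by (cases "p = i") (simp_all add: sum.delta')
  moreover have "count_list (x # xs) (i, j) = count_list xs (i, j) + (if (p, q) = (i, j) then 1 else 0)" for j
    using x by simp
  ultimately show ?case using Cons x by (simp add: sum.distrib)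
qed simp

lemma count_list_snd:
  assumes "set xs \<subseteq> positions m n"
  shows "(\<Sum>i=1..m. count_list xs (i, j)) = count_list (map snd xs) j"
proof -
  have "set (map prod.swap xs) \<subseteq> positions n m" using assms by (auto simp: positions_def)
  from count_list_fst[OF this, of j]
  have "(\<Sum>i=1..m. count_list (map prod.swap xs) (prod.swap (i, j))) = count_list (map snd xs) j"
    by (simp add: o_def)
  then show ?thesis unfolding count_list_map_inj[OF inj_swap] .
qed

lemma lookup_sum_list_single:
  "Poly_Mapping.lookup (\<Sum>x\<leftarrow>xs. Poly_Mapping.single x 1) y = count_list xs y"
  by (induction xs) (auto simp: lookup_add lookup_single)

lemma set_letters: "set (letters m n a) \<subseteq> positions m n"
  using set_spell[of _ m] by (fastforce simp: letters_def positions_def simp del: upt_Suc)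

lemma count_list_letters:
  "count_list (letters m n a) (i, j) = (if (i, j) \<in> positions m n then a i j else 0)"
proof (induction n)
  case 0
  then show ?case by (simp add: positions_def)
next
  case (Suc n)
  have "count_list (map (\<lambda>p. (p, Suc n)) ws) (i, j) = (if j = Suc n then count_list ws i else 0)" for ws
    by (induction ws) auto
  then show ?case using Suc by (auto simp: count_list_append count_list_spell positions_def)
qed

lemma rows_le_num_columns:
  assumes "insert_letters m n a = (P, Q)" "r \<in> set P"
  shows "length r \<le> num_columns P"
proof -
  have ne: "letters m n a \<noteq> []" using assms by (auto simp: insert_letters_def)
  have "num_columns P = lpp a m n"
    using insert_letters_rec[OF ne] assms(1) by (auto simp: num_columns_def length_row_P)
  then show ?thesis using rows_le_lpp[of r m n a] assms by simp
qed

text \<open>A monomial of the bitableau has the content of the two tableaux, and these contain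
  exactly the row and column indices of the inserted biletters.\<close>

lemma rsk_coeff_weight:
  assumes "rsk_coeff m n \<beta> \<alpha> \<noteq> 0"
  shows "Poly_Mapping.keys \<beta> \<subseteq> positions m n"
    and "i \<in> {1..m} \<Longrightarrow> (\<Sum>j=1..n. Poly_Mapping.lookup \<beta> (i, j)) = (\<Sum>j=1..n. Poly_Mapping.lookup \<alpha> (i, j))"
    and "j \<in> {1..n} \<Longrightarrow> (\<Sum>i=1..m. Poly_Mapping.lookup \<beta> (i, j)) = (\<Sum>i=1..m. Poly_Mapping.lookup \<alpha> (i, j))"
proof -
  let ?w = "letters m n (\<lambda>i j. Poly_Mapping.lookup \<alpha> (i, j))"
  obtain P Q where PQ: "insert_letters m n (\<lambda>i j. Poly_Mapping.lookup \<alpha> (i, j)) = (P, Q)" by force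
  have "\<beta> \<in> Poly_Mapping.keys (bitableau P Q)"
    using assms PQ by (simp add: rsk_coeff_def rsk_eq_insert_letters in_keys_iff)
  then have "\<beta> \<in> content_exponents (mset (concat P)) (mset (concat Q))"
    using keys_bitableau[OF insert_letters_shape[OF PQ]] rows_le_num_columns[OF PQ] by blast
  then obtain xs where xs: "\<beta> = (\<Sum>x\<leftarrow>xs. Poly_Mapping.single x 1)"
    "mset (map fst xs) = mset (map fst ?w)" "mset (map snd xs) = mset (map snd ?w)"
    using insert_biletters_content[of ?w P Q] PQ
    unfolding content_exponents_def insert_letters_def by auto
  have "set (map fst xs) = set (map fst ?w)" "set (map snd xs) = set (map snd ?w)"
    using xs(2,3) by (metis set_mset_mset)+
  then have "fst ` set xs = fst ` set ?w" "snd ` set xs = snd ` set ?w"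
    by (simp_all only: set_map)
  moreover have "fst ` set ?w \<subseteq> {1..m}" "snd ` set ?w \<subseteq> {1..n}"
    using set_letters[of m n "\<lambda>i j. Poly_Mapping.lookup \<alpha> (i, j)"] by (auto simp: positions_def)
  ultimately have "fst ` set xs \<subseteq> {1..m}" "snd ` set xs \<subseteq> {1..n}"
    by simp_all
  then have pos: "set xs \<subseteq> positions m n" by (auto simp: positions_def)
  have lk: "Poly_Mapping.lookup \<beta> y = count_list xs y" for y
    unfolding xs(1) by (rule lookup_sum_list_single)
  show "Poly_Mapping.keys \<beta> \<subseteq> positions m n"
    using pos by (auto simp: in_keys_iff lk count_list_0_iff)
  show "(\<Sum>j=1..n. Poly_Mapping.lookup \<beta> (i, j)) = (\<Sum>j=1..n. Poly_Mapping.lookup \<alpha> (i, j))"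
    if i: "i \<in> {1..m}"
  proof -
    have "(\<Sum>j=1..n. Poly_Mapping.lookup \<beta> (i, j)) = count_list (map fst xs) i"
      unfolding lk by (rule count_list_fst[OF pos])
    also have "\<dots> = count_list (map fst ?w) i" using xs(2) by (metis count_mset)
    also have "\<dots> = (\<Sum>j=1..n. count_list ?w (i, j))" by (rule count_list_fst[OF set_letters, symmetric])
    also have "\<dots> = (\<Sum>j=1..n. Poly_Mapping.lookup \<alpha> (i, j))"
      using i by (intro sum.cong) (auto simp: count_list_letters positions_def)
    finally show ?thesis .
  qed
  show "(\<Sum>i=1..m. Poly_Mapping.lookup \<beta> (i, j)) = (\<Sum>i=1..m. Poly_Mapping.lookup \<alpha> (i, j))"
    if j: "j \<in> {1..n}"
  proof -
    have "(\<Sum>i=1..m. Poly_Mapping.lookup \<beta> (i, j)) = count_list (map snd xs) j"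
      unfolding lk by (rule count_list_snd[OF pos])
    also have "\<dots> = count_list (map snd ?w) j" using xs(3) by (metis count_mset)
    also have "\<dots> = (\<Sum>i=1..m. count_list ?w (i, j))" by (rule count_list_snd[OF set_letters, symmetric])
    also have "\<dots> = (\<Sum>i=1..m. Poly_Mapping.lookup \<alpha> (i, j))"
      using j by (intro sum.cong) (auto simp: count_list_letters positions_def)
    finally show ?thesis .
  qed
qed

section \<open>Matrices up to reordering\<close>

definition coeff_mat :: "nat \<Rightarrow> nat \<Rightarrow> exponent list \<Rightarrow> complex mat" where
  "coeff_mat m n bs = mat (length bs) (length bs) (\<lambda>(i, j). rsk_coeff m n (bs ! i) (bs ! j))"

lemma monomial_matrix_RSK_op: "monomial_matrix (RSK_op m n) bs = coeff_mat m n bs"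
  by (simp add: monomial_matrix_def coeff_mat_def RSK_op_monomial rsk_coeff_def)

text \<open>The order of the basis is existentially quantified. The fixed matrix
  \<open>RSK_weight \<sigma> \<pi>\<close> can therefore represent other weight spaces too, in an
  order transported from that of its own basis.\<close>

definition represents :: "complex mat \<Rightarrow> nat \<Rightarrow> nat \<Rightarrow> exponent set \<Rightarrow> bool" where
  "represents B m n S \<longleftrightarrow> (\<exists>bs. distinct bs \<and> set bs = S \<and> B = coeff_mat m n bs)"

lemma represents_enum_list: "finite S \<Longrightarrow> represents (coeff_mat m n (enum_list S)) m n S"
  unfolding represents_def using enum_list by blast

lemma represents_transfer:
  assumes "represents B m n S" "inj_on h S" "h ` S = S'"
    and "\<And>\<alpha> \<beta>. \<alpha> \<in> S \<Longrightarrow> \<beta> \<in> S \<Longrightarrow> rsk_coeff m' n' (h \<beta>) (h \<alpha>) = rsk_coeff m n \<beta> \<alpha>"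
  shows "represents B m' n' S'"
proof -
  obtain bs where bs: "distinct bs" "set bs = S" "B = coeff_mat m n bs"
    using assms(1) by (auto simp: represents_def)
  have "distinct (map h bs)" "set (map h bs) = S'"
    using bs assms by (auto simp: distinct_map)
  moreover have "B = coeff_mat m' n' (map h bs)"
    unfolding bs(3) coeff_mat_def using bs(2) assms(4) by (intro eq_matI) (auto simp: nth_mem)
  ultimately show ?thesis unfolding represents_def by blast
qed

text \<open>Concatenating the enumerations gives the block matrix; the hypothesis for
  \<open>(w, w')\<close> and for \<open>(w', w)\<close> clears the two off-diagonal blocks.\<close>

lemma represents_diag_block_mat:
  assumes "distinct ws" "\<And>w. w \<in> set ws \<Longrightarrow> represents (B w) m n (F w)"
    and "\<And>w w'. w \<in> set ws \<Longrightarrow> w' \<in> set ws \<Longrightarrow> w \<noteq> w' \<Longrightarrow>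
      F w \<inter> F w' = {} \<and> (\<forall>\<alpha>\<in>F w. \<forall>\<beta>\<in>F w'. rsk_coeff m n \<beta> \<alpha> = 0)"
  shows "represents (diag_block_mat (map B ws)) m n (\<Union>w\<in>set ws. F w)"
  using assms
proof (induction ws)
  case Nil
  show ?case unfolding represents_def by (intro exI[of _ "[]"]) (auto simp: coeff_mat_def)
next
  case (Cons w ws)
  have "represents (diag_block_mat (map B ws)) m n (\<Union>w\<in>set ws. F w)"
  proof (rule Cons.IH)
    show "F w \<inter> F w' = {} \<and> (\<forall>\<alpha>\<in>F w. \<forall>\<beta>\<in>F w'. rsk_coeff m n \<beta> \<alpha> = 0)"
      if "w \<in> set ws" "w' \<in> set ws" "w \<noteq> w'" for w w'
      using that by (intro Cons.prems(3)) simp_all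
  qed (use Cons.prems(1,2) in simp_all)
  then obtain cs where cs: "distinct cs" "set cs = (\<Union>w\<in>set ws. F w)"
    "diag_block_mat (map B ws) = coeff_mat m n cs"
    by (auto simp: represents_def)
  obtain bs where bs: "distinct bs" "set bs = F w" "B w = coeff_mat m n bs"
    using Cons.prems(2)[of w] by (auto simp: represents_def)
  have disj: "F w \<inter> F w' = {}" if "w' \<in> set ws" for w'
    using Cons.prems(3)[of w w'] Cons.prems(1) that by auto
  have "rsk_coeff m n \<beta> \<alpha> = 0 \<and> rsk_coeff m n \<alpha> \<beta> = 0" if \<alpha>: "\<alpha> \<in> set bs" and \<beta>: "\<beta> \<in> set cs" for \<alpha> \<beta>
  proof -
    obtain w' where w': "w' \<in> set ws" "\<beta> \<in> F w'" using \<beta> cs(2) by auto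
    then have "w \<noteq> w'" using Cons.prems(1) by auto
    then show ?thesis
      using Cons.prems(3)[of w w'] Cons.prems(3)[of w' w] w' \<alpha> bs(2) by auto
  qed
  then have "diag_block_mat (map B (w # ws)) = coeff_mat m n (bs @ cs)"
    unfolding list.map diag_block_mat.simps Let_def cs(3) bs(3)
    by (intro eq_matI) (auto simp: coeff_mat_def nth_append)
  moreover have "distinct (bs @ cs)" using bs cs disj by auto
  ultimately show ?case unfolding represents_def using bs cs by (intro exI[of _ "bs @ cs"]) auto
qed

lemma equal_up_to_reordering_coeff_mat:
  assumes "distinct bs" "distinct cs" "set bs = set cs"
  shows "equal_up_to_reordering (coeff_mat m n bs) (coeff_mat m n cs)"
proof -
  have "mset cs = mset bs" using assms by (simp add: set_eq_iff_mset_eq_distinct)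
  then obtain p where p: "p permutes {..<length bs}" "permute_list p bs = cs"
    by (rule mset_eq_permutation)
  have len: "length cs = length bs" using p(2) by auto
  have nth: "cs ! i = bs ! p i" if "i < length bs" for i
    using permute_list_nth[OF p(1) that] p(2) by simp
  have pi: "p i < length bs" if "i < length bs" for i
    using permutes_in_image[OF p(1), of i] that by simp
  have "coeff_mat m n cs = mat (length bs) (length bs) (\<lambda>(i, j). coeff_mat m n bs $$ (p i, p j))"
    by (intro eq_matI) (simp_all add: coeff_mat_def len nth pi)
  then show ?thesis
    unfolding equal_up_to_reordering_def using p(1)
    by (intro exI[of _ "length bs"] exI[of _ p]) (simp add: coeff_mat_def)
qed

lemma equal_up_to_reordering_RSK_degree:
  assumes "represents B m n (degree_exponents m n d)"
  shows "equal_up_to_reordering (RSK_degree m n d) B"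
  using assms enum_list[OF finite_degree_exponents[of m n d]]
  unfolding represents_def RSK_degree_def monomial_matrix_RSK_op
  by (auto intro!: equal_up_to_reordering_coeff_mat)

section \<open>Blocks of weight spaces\<close>

definition weight_block :: "wpair \<Rightarrow> complex mat \<Rightarrow> bool" where
  "weight_block w B \<longleftrightarrow>
    represents B (length (fst w)) (length (snd w)) (weight_exponents (fst w) (snd w))"

lemma weight_block_RSK_weight: "weight_block (\<sigma>, \<pi>) (RSK_weight \<sigma> \<pi>)"
  unfolding weight_block_def RSK_weight_def monomial_matrix_RSK_op
  using represents_enum_list[OF finite_weight_exponents] by simp

lemma weight_exponentsD:
  assumes "\<alpha> \<in> weight_exponents \<sigma> \<pi>"
  shows "Poly_Mapping.keys \<alpha> \<subseteq> positions (length \<sigma>) (length \<pi>)"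
    "i \<in> {1..length \<sigma>} \<Longrightarrow> (\<Sum>j=1..length \<pi>. Poly_Mapping.lookup \<alpha> (i, j)) = \<sigma> ! (i - 1)"
    "j \<in> {1..length \<pi>} \<Longrightarrow> (\<Sum>i=1..length \<sigma>. Poly_Mapping.lookup \<alpha> (i, j)) = \<pi> ! (j - 1)"
  using assms by (auto simp: weight_exponents_def)

lemma sum_nth_eq_sum_list: "(\<Sum>i=1..length xs. xs ! (i - 1)) = sum_list (xs :: nat list)"
proof -
  have "(\<Sum>i=1..length xs. xs ! (i - 1)) = (\<Sum>i\<in>{0..<length xs}. xs ! i)"
    by (rule sum.reindex_bij_witness[of _ Suc "\<lambda>i. i - 1"]) auto
  then show ?thesis by (simp add: sum_list_sum_nth)
qed

lemma weight_exponents_total: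
  assumes "\<alpha> \<in> weight_exponents \<sigma> \<pi>"
  shows "(\<Sum>i=1..length \<sigma>. \<Sum>j=1..length \<pi>. Poly_Mapping.lookup \<alpha> (i, j)) = sum_list \<sigma>"
  using weight_exponentsD(2)[OF assms] sum_nth_eq_sum_list[of \<sigma>] by simp

section \<open>Transposes and zero entries\<close>

lemma lookup_push_swap:
  "Poly_Mapping.lookup (push prod.swap \<alpha>) (i, j) = Poly_Mapping.lookup \<alpha> (j, i)"
  using lookup_push[OF inj_swap, of \<alpha> "(j, i)"] by simp

lemma push_swap_swap: "push prod.swap (push prod.swap \<alpha>) = \<alpha>"
  by (rule poly_mapping_eqI) (metis lookup_push_swap prod.collapse)

lemma push_swap_weight_exponents:
  "\<alpha> \<in> weight_exponents \<sigma> \<pi> \<Longrightarrow> push prod.swap \<alpha> \<in> weight_exponents \<pi> \<sigma>"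
  by (auto simp: weight_exponents_def keys_push lookup_push_swap positions_def)

lemma weight_block_swap:
  assumes "weight_block w B"
  shows "weight_block (prod.swap w) B"
  unfolding weight_block_def
proof (rule represents_transfer[OF assms[unfolded weight_block_def], of "push prod.swap"])
  show "inj_on (push prod.swap) (weight_exponents (fst w) (snd w))"
    using inj_push[OF inj_swap] by (rule inj_on_subset) simp
  have "\<alpha> \<in> push prod.swap ` weight_exponents (fst w) (snd w)"
    if "\<alpha> \<in> weight_exponents (snd w) (fst w)" for \<alpha>
    using push_swap_weight_exponents[OF that] push_swap_swap by (metis imageI)
  then show "push prod.swap ` weight_exponents (fst w) (snd w) =
      weight_exponents (fst (prod.swap w)) (snd (prod.swap w))"
    using push_swap_weight_exponents by fastforce
qed (simp add: rsk_coeff_transpose)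

lemma weight_exponents_skip_row:
  "push (map_prod (skip (Suc (length \<sigma>1))) id) \<alpha> \<in> weight_exponents (\<sigma>1 @ 0 # \<sigma>2) \<pi> \<longleftrightarrow>
    \<alpha> \<in> weight_exponents (\<sigma>1 @ \<sigma>2) \<pi>"
proof -
  let ?r = "Suc (length \<sigma>1)" and ?m = "length \<sigma>1 + length \<sigma>2" and ?n = "length \<pi>"
  let ?\<kappa> = "map_prod (skip ?r) (id :: nat \<Rightarrow> nat)"
  have lk: "Poly_Mapping.lookup (push ?\<kappa> \<alpha>) (skip ?r i, j) = Poly_Mapping.lookup \<alpha> (i, j)" for i j
    using lookup_push[OF inj_skip_row, of ?r \<alpha> "(i, j)"] by simp
  have "(?r, j) \<notin> range ?\<kappa>" for j using range_skip[of ?r ?r] by auto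
  then have lr: "Poly_Mapping.lookup (push ?\<kappa> \<alpha>) (?r, j) = 0" for j by (rule lookup_push_outside)
  have mem: "skip ?r i \<in> {1..Suc ?m} \<longleftrightarrow> i \<in> {1..?m}" for i by (auto simp: skip_def)
  have rows: "{1..Suc ?m} = insert ?r (skip ?r ` {1..?m})"
  proof (rule Set.set_eqI)
    fix i show "i \<in> {1..Suc ?m} \<longleftrightarrow> i \<in> insert ?r (skip ?r ` {1..?m})"
    proof (cases "i = ?r")
      case False
      then obtain i' where "i = skip ?r i'" using range_skip by blast
      then show ?thesis using False mem[of i'] by (auto dest: injD[OF inj_skip])
    qed auto
  qed
  have r: "?r \<notin> skip ?r ` {1..?m}" using range_skip[of ?r ?r] by auto
  have keys: "Poly_Mapping.keys (push ?\<kappa> \<alpha>) \<subseteq> positions (Suc ?m) ?n \<longleftrightarrow>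
      Poly_Mapping.keys \<alpha> \<subseteq> positions ?m ?n"
    using mem by (fastforce simp: keys_push[OF inj_skip_row] positions_def)
  have nth: "(\<sigma>1 @ 0 # \<sigma>2) ! (skip ?r i - 1) = (\<sigma>1 @ \<sigma>2) ! (i - 1)" if "i \<in> {1..?m}" for i
    using that by (auto simp: skip_def nth_append nth_Cons' simp flip: length_0_conv)
  have row: "(\<forall>i\<in>{1..Suc ?m}. (\<Sum>j=1..?n. Poly_Mapping.lookup (push ?\<kappa> \<alpha>) (i, j)) = (\<sigma>1 @ 0 # \<sigma>2) ! (i - 1)) \<longleftrightarrow>
      (\<forall>i\<in>{1..?m}. (\<Sum>j=1..?n. Poly_Mapping.lookup \<alpha> (i, j)) = (\<sigma>1 @ \<sigma>2) ! (i - 1))"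
    unfolding rows by (simp add: lk lr nth del: One_nat_def)
  have "(\<Sum>i=1..Suc ?m. Poly_Mapping.lookup (push ?\<kappa> \<alpha>) (i, j)) = (\<Sum>i=1..?m. Poly_Mapping.lookup \<alpha> (i, j))" for j
    unfolding rows using r
    by (simp add: lr lk sum.reindex[OF inj_on_subset[OF inj_skip]] o_def)
  with keys row show ?thesis by (simp add: weight_exponents_def del: atLeastAtMost_iff sum.cl_ivl_Suc)
qed

lemma weight_block_zero_row:
  assumes "weight_block (\<sigma>1 @ \<sigma>2, \<pi>) B"
  shows "weight_block (\<sigma>1 @ 0 # \<sigma>2, \<pi>) B"
  unfolding weight_block_def
proof (rule represents_transfer[OF assms[unfolded weight_block_def]])
  let ?r = "Suc (length \<sigma>1)"
  let ?\<kappa> = "map_prod (skip ?r) (id :: nat \<Rightarrow> nat)"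
  show "inj_on (push ?\<kappa>) (weight_exponents (fst (\<sigma>1 @ \<sigma>2, \<pi>)) (snd (\<sigma>1 @ \<sigma>2, \<pi>)))"
    using inj_push[OF inj_skip_row] by (rule inj_on_subset) simp
  have "\<beta> \<in> push ?\<kappa> ` weight_exponents (\<sigma>1 @ \<sigma>2) \<pi>" if \<beta>: "\<beta> \<in> weight_exponents (\<sigma>1 @ 0 # \<sigma>2) \<pi>" for \<beta>
  proof -
    \<comment> \<open>A vanishing row sum of natural numbers forces the whole row to vanish, so
      \<open>\<beta>\<close> lives on the range of the relabelling.\<close>
    have "(\<Sum>j=1..length \<pi>. Poly_Mapping.lookup \<beta> (?r, j)) = 0"
      using weight_exponentsD(2)[OF \<beta>, of ?r] by simp
    then have z: "Poly_Mapping.lookup \<beta> (?r, j) = 0" if "j \<in> {1..length \<pi>}" for j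
      using that by simp
    have "Poly_Mapping.lookup \<beta> (?r, j) = 0" for j
    proof (cases "j \<in> {1..length \<pi>}")
      case False
      then have "(?r, j) \<notin> Poly_Mapping.keys \<beta>"
        using weight_exponentsD(1)[OF \<beta>] by (auto simp: positions_def)
      then show ?thesis by (simp add: in_keys_iff)
    qed (rule z)
    moreover have "fst y = ?r" if y: "y \<notin> range ?\<kappa>" for y
    proof (rule ccontr)
      assume "fst y \<noteq> ?r"
      then obtain i where "fst y = skip ?r i" using range_skip by blast
      then have "y = ?\<kappa> (i, snd y)" by (simp add: prod_eq_iff)
      then show False using y by blast
    qed
    ultimately have "Poly_Mapping.lookup \<beta> y = 0" if "y \<notin> range ?\<kappa>" for y
      using that by (metis prod.collapse)
    \<comment> \<open>\<open>map_key\<close> pulls an exponent back along an injection; on exponents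
      supported in the range it is a right inverse of \<open>push\<close>.\<close>
    then have "push ?\<kappa> (Poly_Mapping.map_key ?\<kappa> \<beta>) = \<beta>"
      by (intro push_eqI[OF inj_skip_row]) (simp_all add: map_key.rep_eq[OF inj_skip_row])
    then show ?thesis using weight_exponents_skip_row[of \<sigma>1 "Poly_Mapping.map_key ?\<kappa> \<beta>" \<sigma>2 \<pi>] \<beta>
      by (metis imageI)
  qed
  then show "push ?\<kappa> ` weight_exponents (fst (\<sigma>1 @ \<sigma>2, \<pi>)) (snd (\<sigma>1 @ \<sigma>2, \<pi>)) =
      weight_exponents (fst (\<sigma>1 @ 0 # \<sigma>2, \<pi>)) (snd (\<sigma>1 @ 0 # \<sigma>2, \<pi>))"
    using weight_exponents_skip_row by fastforce
qed (simp add: rsk_coeff_skip_row)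

definition nonzeros :: "nat list \<Rightarrow> nat list" where
  "nonzeros xs = filter (\<lambda>x. x \<noteq> 0) xs"

text \<open>\<open>\<rho>\<close> is the prefix already treated; generalizing over it lets the
  induction pass a nonzero entry.\<close>

lemma weight_block_nonzeros_rows:
  "weight_block (\<rho> @ nonzeros \<sigma>, \<pi>) B \<Longrightarrow> weight_block (\<rho> @ \<sigma>, \<pi>) B"
proof (induction \<sigma> arbitrary: \<rho>)
  case (Cons x \<sigma>)
  show ?case
  proof (cases "x = 0")
    case True
    then show ?thesis using Cons weight_block_zero_row by (simp add: nonzeros_def)
  next
    case False
    then show ?thesis using Cons.IH[of "\<rho> @ [x]"] Cons.prems by (simp add: nonzeros_def)
  qed
qed (simp add: nonzeros_def)

lemma weight_block_nonzeros:
  assumes "weight_block (nonzeros \<sigma>, nonzeros \<pi>) B"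
  shows "weight_block (\<sigma>, \<pi>) B"
proof -
  have "weight_block (\<sigma>, nonzeros \<pi>) B"
    using assms weight_block_nonzeros_rows[of "[]"] by simp
  then have "weight_block (nonzeros \<pi>, \<sigma>) B" using weight_block_swap by fastforce
  then have "weight_block (\<pi>, \<sigma>) B"
    using weight_block_nonzeros_rows[of "[]"] by simp
  then show ?thesis using weight_block_swap by fastforce
qed

text \<open>The only exponent is \<open>0\<close>, and its bitableau is the empty product.\<close>

lemma weight_block_zero:
  assumes "sum_list \<sigma> = 0" "sum_list \<pi> = 0"
  shows "weight_block (\<sigma>, \<pi>) (1\<^sub>m 1)"
proof -
  have z: "\<sigma> ! i = 0" if "i < length \<sigma>" for i using assms(1) that by (simp add: sum_list_eq_0_iff)
  have z': "\<pi> ! i = 0" if "i < length \<pi>" for i using assms(2) that by (simp add: sum_list_eq_0_iff)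
  have "weight_exponents \<sigma> \<pi> = {0}"
  proof (intro equalityI subsetI)
    fix \<alpha> assume \<alpha>: "\<alpha> \<in> weight_exponents \<sigma> \<pi>"
    have "Poly_Mapping.lookup \<alpha> (i, j) = 0" if "(i, j) \<in> positions (length \<sigma>) (length \<pi>)" for i j
      using weight_exponentsD(2)[OF \<alpha>, of i] that z[of "i - 1"] by (auto simp: positions_def)
    then have "x \<notin> Poly_Mapping.keys \<alpha>" for x
      using weight_exponentsD(1)[OF \<alpha>] by (cases x) (auto simp: in_keys_iff)
    then have "Poly_Mapping.keys \<alpha> = {}" by blast
    then show "\<alpha> \<in> {0}" by simp
  qed (auto simp: weight_exponents_def z z')
  moreover have "(1\<^sub>m 1 :: complex mat) = coeff_mat (length \<sigma>) (length \<pi>) [0]"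
    by (intro eq_matI) (auto simp: coeff_mat_def rsk_coeff_zero)
  ultimately show ?thesis
    unfolding weight_block_def represents_def by (intro exI[of _ "[0]"]) simp
qed

section \<open>Covering pairs have the same block\<close>

lemma sum_indicator_row:
  "(\<Sum>j=1..n. (if i = k \<and> j = (l :: nat) then 1 else 0)) = (if i = k \<and> l \<in> {1..n} then 1 else (0 :: nat))"
proof (cases "i = k")
  case True
  then show ?thesis using sum.delta[of "{1..n}" l "\<lambda>_. 1 :: nat"] by simp
qed simp

lemma weight_exponents_add_entry:
  assumes "k < length \<sigma>" "l < length \<pi>"
  shows "Poly_Mapping.single (Suc k, Suc l) 1 + \<alpha> \<in>
      weight_exponents (\<sigma>[k := Suc (\<sigma> ! k)]) (\<pi>[l := Suc (\<pi> ! l)]) \<longleftrightarrow>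
    \<alpha> \<in> weight_exponents \<sigma> \<pi>"
proof -
  let ?\<beta> = "Poly_Mapping.single (Suc k, Suc l) 1 + \<alpha>"
  let ?m = "length \<sigma>" and ?n = "length \<pi>"
  have lk: "Poly_Mapping.lookup ?\<beta> (i, j) = (if i = Suc k \<and> j = Suc l then 1 else 0) + Poly_Mapping.lookup \<alpha> (i, j)" for i j
    by (auto simp: lookup_add lookup_single)
  have "Poly_Mapping.keys ?\<beta> = insert (Suc k, Suc l) (Poly_Mapping.keys \<alpha>)"
    by (auto simp: in_keys_iff lk split: if_splits simp del: One_nat_def)
  then have keys: "Poly_Mapping.keys ?\<beta> \<subseteq> positions ?m ?n \<longleftrightarrow> Poly_Mapping.keys \<alpha> \<subseteq> positions ?m ?n"
    using assms by (auto simp: positions_def)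
  have row: "(\<Sum>j=1..?n. Poly_Mapping.lookup ?\<beta> (i, j)) = \<sigma>[k := Suc (\<sigma> ! k)] ! (i - 1) \<longleftrightarrow>
      (\<Sum>j=1..?n. Poly_Mapping.lookup \<alpha> (i, j)) = \<sigma> ! (i - 1)" if "i \<in> {1..?m}" for i
    unfolding lk sum.distrib sum_indicator_row using assms that
    by (auto simp: nth_list_update Suc_diff_le)
  have col: "(\<Sum>i=1..?m. Poly_Mapping.lookup ?\<beta> (i, j)) = \<pi>[l := Suc (\<pi> ! l)] ! (j - 1) \<longleftrightarrow>
      (\<Sum>i=1..?m. Poly_Mapping.lookup \<alpha> (i, j)) = \<pi> ! (j - 1)" if "j \<in> {1..?n}" for j
    unfolding lk sum.distrib
    using sum_indicator_row[where i = j and k = "Suc l" and l = "Suc k" and n = ?m] assms that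
    by (cases j) (auto simp: nth_list_update conj_commute)
  show ?thesis unfolding weight_exponents_def using keys row col by simp
qed

text \<open>A row and a column overlap in a single entry, and their union lies inside the
  matrix.\<close>

lemma sum_le_cross:
  fixes f :: "nat \<Rightarrow> nat \<Rightarrow> nat"
  assumes "k \<in> {1..m}" "l \<in> {1..n}"
  shows "(\<Sum>j=1..n. f k j) + (\<Sum>i=1..m. f i l) \<le> (\<Sum>i=1..m. \<Sum>j=1..n. f i j) + f k l"
proof -
  have "(\<Sum>i\<in>{1..m} - {k}. f i l) \<le> (\<Sum>i\<in>{1..m} - {k}. \<Sum>j=1..n. f i j)"
    using assms by (intro sum_mono member_le_sum) auto
  moreover have "(\<Sum>i=1..m. f i l) = f k l + (\<Sum>i\<in>{1..m} - {k}. f i l)"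
    "(\<Sum>i=1..m. \<Sum>j=1..n. f i j) = (\<Sum>j=1..n. f k j) + (\<Sum>i\<in>{1..m} - {k}. \<Sum>j=1..n. f i j)"
    using assms by (intro sum.remove; simp)+
  ultimately show ?thesis by linarith
qed

text \<open>Adding a unit at the raised position is a bijection between the bases of the two weight
  spaces, and \<open>rsk_coeff_add_entry\<close> says that it preserves coefficients. List indices
  start at 0 and matrix positions at 1, hence \<open>(Suc k, Suc l)\<close>.\<close>

lemma weight_block_covers:
  assumes "covers v w" "weight_block v B"
  shows "weight_block w B"
proof -
  obtain \<sigma> \<pi> where v: "v = (\<sigma>, \<pi>)" by force
  obtain d k l where kl: "weight_pair d (\<sigma>, \<pi>)" "k < length \<sigma>" "l < length \<pi>" "\<sigma> ! k + \<pi> ! l \<ge> d"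
    "w = (\<sigma>[k := Suc (\<sigma> ! k)], \<pi>[l := Suc (\<pi> ! l)])"
    using assms(1) v by (auto simp: covers_def)
  let ?E = "Poly_Mapping.single (Suc k, Suc l) 1 :: exponent"
  have "represents B (length \<sigma>) (length \<pi>) (weight_exponents \<sigma> \<pi>)"
    using assms(2) v by (simp add: weight_block_def)
  then have "represents B (length \<sigma>) (length \<pi>) (weight_exponents (fst w) (snd w))"
  proof (rule represents_transfer[of _ _ _ _ "(+) ?E"])
    have "\<beta> \<in> (+) ?E ` weight_exponents \<sigma> \<pi>" if \<beta>: "\<beta> \<in> weight_exponents (fst w) (snd w)" for \<beta>
    proof -
      have len: "length (fst w) = length \<sigma>" "length (snd w) = length \<pi>" using kl(5) by simp_all
      have "sum_list (fst w) = Suc d"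
        using kl(1,2,5) member_le_sum_list[OF nth_mem[OF kl(2)]]
        by (simp add: weight_pair_def sum_list_update)
      then have "(\<Sum>i=1..length \<sigma>. \<Sum>j=1..length \<pi>. Poly_Mapping.lookup \<beta> (i, j)) = Suc d"
        using weight_exponents_total[OF \<beta>] len by simp
      moreover have "(\<Sum>j=1..length \<pi>. Poly_Mapping.lookup \<beta> (Suc k, j)) = Suc (\<sigma> ! k)"
        "(\<Sum>i=1..length \<sigma>. Poly_Mapping.lookup \<beta> (i, Suc l)) = Suc (\<pi> ! l)"
        using weight_exponentsD(2)[OF \<beta>, of "Suc k"] weight_exponentsD(3)[OF \<beta>, of "Suc l"] kl by simp_all
      \<comment> \<open>The raised row and column sums add up to at least \<open>d + 2\<close>, more
        than the total \<open>Suc d\<close>; so their common entry is positive and \<open>?E\<close>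
        can be subtracted.\<close>
      ultimately have pos: "1 \<le> Poly_Mapping.lookup \<beta> (Suc k, Suc l)"
        using sum_le_cross[of "Suc k" "length \<sigma>" "Suc l" "length \<pi>" "\<lambda>i j. Poly_Mapping.lookup \<beta> (i, j)"] kl
        by simp
      have "?E + (\<beta> - ?E) = \<beta>"
        using pos by (intro poly_mapping_eqI) (auto simp: lookup_add lookup_minus lookup_single when_def)
      then show ?thesis
        using \<beta> weight_exponents_add_entry[OF kl(2,3), of "\<beta> - ?E"] kl(5) by (metis fst_conv imageI snd_conv)
    qed
    then show "(+) ?E ` weight_exponents \<sigma> \<pi> = weight_exponents (fst w) (snd w)"
      using weight_exponents_add_entry[OF kl(2,3)] kl(5) by fastforce
    fix \<alpha> \<beta> assume \<alpha>: "\<alpha> \<in> weight_exponents \<sigma> \<pi>"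
    have "dominant_entry (length \<sigma>) (length \<pi>) (Suc k) (Suc l) (\<lambda>i j. Poly_Mapping.lookup \<alpha> (i, j))"
      using weight_exponents_total[OF \<alpha>] weight_exponentsD(2)[OF \<alpha>, of "Suc k"]
        weight_exponentsD(3)[OF \<alpha>, of "Suc l"] kl
      by unfold_locales (auto simp: weight_pair_def)
    then show "rsk_coeff (length \<sigma>) (length \<pi>) (?E + \<beta>) (?E + \<alpha>) = rsk_coeff (length \<sigma>) (length \<pi>) \<beta> \<alpha>"
      by (rule rsk_coeff_add_entry)
  qed simp
  then show ?thesis using kl(5) by (simp add: weight_block_def)
qed

lemma weight_block_wp_le:
  assumes "wp_le v w" "weight_block v B"
  shows "weight_block w B"
  using assms unfolding wp_le_def
  by (induction rule: rtranclp_induct) (auto intro: weight_block_covers)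

section \<open>Decomposition into weight spaces\<close>

definition weight_pairs :: "nat \<Rightarrow> nat \<Rightarrow> nat \<Rightarrow> wpair set" where
  "weight_pairs m n d = {w. length (fst w) = m \<and> length (snd w) = n \<and> weight_pair d w}"

lemma degree_exponents_eq_Union:
  "degree_exponents m n d = (\<Union>w\<in>weight_pairs m n d. weight_exponents (fst w) (snd w))"
proof (intro equalityI subsetI)
  fix \<alpha> assume \<alpha>: "\<alpha> \<in> degree_exponents m n d"
  define \<sigma> where "\<sigma> = map (\<lambda>i. \<Sum>j=1..n. Poly_Mapping.lookup \<alpha> (i, j)) [1..<Suc m]"
  define \<pi> where "\<pi> = map (\<lambda>j. \<Sum>i=1..m. Poly_Mapping.lookup \<alpha> (i, j)) [1..<Suc n]"
  have len: "length \<sigma> = m" "length \<pi> = n" by (simp_all add: \<sigma>_def \<pi>_def)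
  have mem: "\<alpha> \<in> weight_exponents \<sigma> \<pi>"
    unfolding weight_exponents_def len using \<alpha>
    by (auto simp: degree_exponents_def \<sigma>_def \<pi>_def simp del: upt_Suc)
  have tot: "(\<Sum>i=1..m. \<Sum>j=1..n. Poly_Mapping.lookup \<alpha> (i, j)) = d"
    using \<alpha> by (simp add: degree_exponents_def positions_def sum.cartesian_product)
  then have "sum_list \<sigma> = d" using weight_exponents_total[OF mem] len by simp
  moreover have "sum_list \<pi> = d"
    using weight_exponents_total[OF push_swap_weight_exponents[OF mem]] tot len
      sum.swap[of "\<lambda>i j. Poly_Mapping.lookup \<alpha> (i, j)" "{1..n}" "{1..m}"]
    by (simp add: lookup_push_swap)
  ultimately have "(\<sigma>, \<pi>) \<in> weight_pairs m n d" using len by (simp add: weight_pairs_def weight_pair_def)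
  then show "\<alpha> \<in> (\<Union>w\<in>weight_pairs m n d. weight_exponents (fst w) (snd w))" using mem by force
next
  fix \<alpha> assume "\<alpha> \<in> (\<Union>w\<in>weight_pairs m n d. weight_exponents (fst w) (snd w))"
  then obtain w where w: "w \<in> weight_pairs m n d" "\<alpha> \<in> weight_exponents (fst w) (snd w)" by blast
  then show "\<alpha> \<in> degree_exponents m n d"
    using weight_exponents_total[OF w(2)] weight_exponentsD(1)[OF w(2)]
    by (auto simp: degree_exponents_def positions_def weight_pairs_def weight_pair_def sum.cartesian_product)
qed

lemma weight_exponents_eqI:
  assumes "length \<sigma> = length \<sigma>'" "length \<pi> = length \<pi>'"
    "\<alpha> \<in> weight_exponents \<sigma> \<pi>" "\<beta> \<in> weight_exponents \<sigma>' \<pi>'"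
    "\<And>i. i \<in> {1..length \<sigma>} \<Longrightarrow> (\<Sum>j=1..length \<pi>. Poly_Mapping.lookup \<beta> (i, j)) = (\<Sum>j=1..length \<pi>. Poly_Mapping.lookup \<alpha> (i, j))"
    "\<And>j. j \<in> {1..length \<pi>} \<Longrightarrow> (\<Sum>i=1..length \<sigma>. Poly_Mapping.lookup \<beta> (i, j)) = (\<Sum>i=1..length \<sigma>. Poly_Mapping.lookup \<alpha> (i, j))"
  shows "\<sigma> = \<sigma>' \<and> \<pi> = \<pi>'"
proof
  show "\<sigma> = \<sigma>'"
  proof (rule nth_equalityI)
    fix i assume "i < length \<sigma>"
    then show "\<sigma> ! i = \<sigma>' ! i"
      using assms(5)[of "Suc i"] weight_exponentsD(2)[OF assms(3), of "Suc i"]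
        weight_exponentsD(2)[OF assms(4), of "Suc i"] assms(1,2) by simp
  qed (rule assms(1))
  show "\<pi> = \<pi>'"
  proof (rule nth_equalityI)
    fix j assume "j < length \<pi>"
    then show "\<pi> ! j = \<pi>' ! j"
      using assms(6)[of "Suc j"] weight_exponentsD(3)[OF assms(3), of "Suc j"]
        weight_exponentsD(3)[OF assms(4), of "Suc j"] assms(1,2) by simp
  qed (rule assms(2))
qed

lemma weight_exponents_orthogonal:
  assumes "w \<in> weight_pairs m n d" "w' \<in> weight_pairs m n d" "w \<noteq> w'"
  shows "weight_exponents (fst w) (snd w) \<inter> weight_exponents (fst w') (snd w') = {}"
    and "\<forall>\<alpha>\<in>weight_exponents (fst w) (snd w). \<forall>\<beta>\<in>weight_exponents (fst w') (snd w').
      rsk_coeff m n \<beta> \<alpha> = 0"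
proof -
  have len: "length (fst w) = m" "length (snd w) = n" "length (fst w') = m" "length (snd w') = n"
    using assms by (auto simp: weight_pairs_def)
  have eqI: "w = w'" if "fst w = fst w' \<and> snd w = snd w'" using that by (simp add: prod_eq_iff)
  show "weight_exponents (fst w) (snd w) \<inter> weight_exponents (fst w') (snd w') = {}"
    using weight_exponents_eqI[of "fst w" "fst w'" "snd w" "snd w'"] len eqI assms(3) by auto
  show "\<forall>\<alpha>\<in>weight_exponents (fst w) (snd w). \<forall>\<beta>\<in>weight_exponents (fst w') (snd w').
      rsk_coeff m n \<beta> \<alpha> = 0"
  proof (intro ballI, rule ccontr)
    fix \<alpha> \<beta>
    assume mem: "\<alpha> \<in> weight_exponents (fst w) (snd w)" "\<beta> \<in> weight_exponents (fst w') (snd w')"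
      and nz: "rsk_coeff m n \<beta> \<alpha> \<noteq> 0"
    have "fst w = fst w' \<and> snd w = snd w'"
      using rsk_coeff_weight(2,3)[OF nz]
      by (intro weight_exponents_eqI[OF _ _ mem]) (simp_all only: len)
    then show False using eqI assms(3) by simp
  qed
qed

lemma finite_weight_pairs_of_length: "finite (weight_pairs m n d)"
  by (rule finite_subset[OF _ finite_weight_pairs[of m n d]]) (auto simp: weight_pairs_def)

theorem equal_up_to_reordering_weight_blocks:
  assumes "distinct ws" "set ws = weight_pairs m n d" "\<And>w. w \<in> set ws \<Longrightarrow> weight_block w (B w)"
  shows "equal_up_to_reordering (RSK_degree m n d) (diag_block_mat (map B ws))"
proof (rule equal_up_to_reordering_RSK_degree)
  have "represents (diag_block_mat (map B ws)) m n (\<Union>w\<in>set ws. weight_exponents (fst w) (snd w))"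
  proof (rule represents_diag_block_mat[OF assms(1)])
    fix w assume w: "w \<in> set ws"
    then have "length (fst w) = m" "length (snd w) = n" using assms(2) by (auto simp: weight_pairs_def)
    then show "represents (B w) m n (weight_exponents (fst w) (snd w))"
      using assms(3)[OF w] by (simp add: weight_block_def)
  qed (use weight_exponents_orthogonal assms(2) in auto)
  then show "represents (diag_block_mat (map B ws)) m n (degree_exponents m n d)"
    unfolding degree_exponents_eq_Union assms(2) .
qed

section \<open>Reduction of weight pairs\<close>

definition lower :: "nat \<Rightarrow> nat list \<Rightarrow> nat list" where
  "lower k xs = xs[k := xs ! k - 1]"

lemma length_lower [simp]: "length (lower k xs) = length xs"
  by (simp add: lower_def)

lemma nth_lower: "k < length xs \<Longrightarrow> lower k xs ! j = (if j = k then xs ! k - 1 else xs ! j)"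
  by (simp add: lower_def nth_list_update)

lemma lower_commute: "lower k (lower k' xs) = lower k' (lower k xs)"
  by (cases "k = k'") (simp_all add: lower_def list_update_swap nth_list_update_neq)

lemma nth_le_sum_list: "k < length xs \<Longrightarrow> xs ! k \<le> sum_list (xs :: nat list)"
  by (simp add: member_le_sum_list)

lemma sum_list_lower: "k < length xs \<Longrightarrow> 1 \<le> xs ! k \<Longrightarrow> Suc (sum_list (lower k xs)) = sum_list xs"
  using nth_le_sum_list[of k xs] by (simp add: lower_def sum_list_update)

lemma nth_add_le_sum_list:
  assumes "k < length xs" "l < length xs" "k \<noteq> l"
  shows "xs ! k + xs ! l \<le> sum_list (xs :: nat list)"
proof -
  have "(\<Sum>i\<in>{k, l}. xs ! i) \<le> (\<Sum>i\<in>{0..<length xs}. xs ! i)"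
    using assms by (intro sum_mono2) auto
  then show ?thesis using assms by (simp add: sum_list_sum_nth)
qed

text \<open>The cover is read from above. The degree and both entries drop by one, so the bound
  \<open>d\<close> on the lower pair becomes \<open>D + 2\<close> on a pair of degree
  \<open>Suc D\<close>.\<close>

lemma covers_iff_lower:
  "covers v w \<longleftrightarrow> (\<exists>D k l. weight_pair (Suc D) w \<and> k < length (fst w) \<and> l < length (snd w) \<and>
    D + 2 \<le> fst w ! k + snd w ! l \<and> v = (lower k (fst w), lower l (snd w)))"
proof
  assume "covers v w"
  then obtain \<sigma> \<pi> d k l where *: "v = (\<sigma>, \<pi>)" "weight_pair d (\<sigma>, \<pi>)" "k < length \<sigma>" "l < length \<pi>"
    "\<sigma> ! k + \<pi> ! l \<ge> d" "w = (\<sigma>[k := Suc (\<sigma> ! k)], \<pi>[l := Suc (\<pi> ! l)])"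
    by (auto simp: covers_def)
  have "weight_pair (Suc d) w"
    using * nth_le_sum_list[of k \<sigma>] nth_le_sum_list[of l \<pi>]
    by (simp add: weight_pair_def sum_list_update)
  then show "\<exists>D k l. weight_pair (Suc D) w \<and> k < length (fst w) \<and> l < length (snd w) \<and>
    D + 2 \<le> fst w ! k + snd w ! l \<and> v = (lower k (fst w), lower l (snd w))"
    using * by (intro exI[of _ d] exI[of _ k] exI[of _ l]) (simp add: lower_def)
next
  assume "\<exists>D k l. weight_pair (Suc D) w \<and> k < length (fst w) \<and> l < length (snd w) \<and>
    D + 2 \<le> fst w ! k + snd w ! l \<and> v = (lower k (fst w), lower l (snd w))"
  then obtain D k l where *: "weight_pair (Suc D) w" "k < length (fst w)" "l < length (snd w)"
    "D + 2 \<le> fst w ! k + snd w ! l" "v = (lower k (fst w), lower l (snd w))" by blast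
  \<comment> \<open>No entry exceeds the degree \<open>Suc D\<close>, so two entries with sum at
    least \<open>D + 2\<close> are both positive.\<close>
  have pos: "1 \<le> fst w ! k" "1 \<le> snd w ! l"
    using * nth_le_sum_list[of k "fst w"] nth_le_sum_list[of l "snd w"] by (auto simp: weight_pair_def)
  have "weight_pair D v"
    using * pos sum_list_lower[of k "fst w"] sum_list_lower[of l "snd w"] by (simp add: weight_pair_def)
  moreover have "w = ((fst v)[k := Suc (fst v ! k)], (snd v)[l := Suc (snd v ! l)])"
    using * pos by (simp add: lower_def prod_eq_iff)
  moreover have "k < length (fst v)" "l < length (snd v)" "D \<le> fst v ! k + snd v ! l"
    using * pos by (simp_all add: nth_lower)
  ultimately show "covers v w"
    unfolding covers_def case_prod_beta prod.collapse by blast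
qed

lemma covers_weight_pair: "covers v w \<Longrightarrow> \<exists>d. weight_pair d v \<and> weight_pair (Suc d) w"
proof -
  assume c: "covers v w"
  then obtain d where "weight_pair d v" by (auto simp: covers_def)
  moreover from c obtain D k l where *: "weight_pair (Suc D) w" "k < length (fst w)" "l < length (snd w)"
    "D + 2 \<le> fst w ! k + snd w ! l" "v = (lower k (fst w), lower l (snd w))"
    unfolding covers_iff_lower by blast
  have "1 \<le> fst w ! k" using * nth_le_sum_list[of l "snd w"] by (auto simp: weight_pair_def)
  then have "sum_list (fst v) = D" using * sum_list_lower[of k "fst w"] by (simp add: weight_pair_def)
  ultimately show ?thesis using *(1) by (auto simp: weight_pair_def)
qed

lemma covers_swap:
  assumes "covers v w"
  shows "covers (prod.swap v) (prod.swap w)"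
proof -
  obtain D k l where *: "weight_pair (Suc D) w" "k < length (fst w)" "l < length (snd w)"
    "D + 2 \<le> fst w ! k + snd w ! l" "v = (lower k (fst w), lower l (snd w))"
    using assms unfolding covers_iff_lower by blast
  then show ?thesis unfolding covers_iff_lower
    by (intro exI[of _ D] exI[of _ l] exI[of _ k]) (simp add: weight_pair_def)
qed

lemma wp_le_swap: "wp_le v w \<Longrightarrow> wp_le (prod.swap v) (prod.swap w)"
  unfolding wp_le_def
  by (induction rule: rtranclp_induct) (auto intro: rtranclp.rtrancl_into_rtrancl covers_swap)

lemma wp_le_length:
  assumes "wp_le v w"
  shows "length (fst v) = length (fst w)" "length (snd v) = length (snd w)"
  using equivclp_covers_length[of v w] assms unfolding wp_le_def
  by (auto dest: rtranclp_into_equivclp)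

text \<open>After the step at \<open>(k, l)\<close> the degree and \<open>\<pi> ! l\<close> have
  dropped by one while \<open>\<sigma> ! k'\<close> is unchanged, so the step at
  \<open>(k', l)\<close> is still allowed.\<close>

lemma covers_lower_lower:
  assumes "weight_pair (Suc D) (\<sigma>, \<pi>)" "k < length \<sigma>" "k' < length \<sigma>" "l < length \<pi>" "k \<noteq> k'"
    "D + 2 \<le> \<sigma> ! k + \<pi> ! l" "D + 2 \<le> \<sigma> ! k' + \<pi> ! l"
  shows "covers (lower k' (lower k \<sigma>), lower l (lower l \<pi>)) (lower k \<sigma>, lower l \<pi>)"
proof -
  have pos: "1 \<le> \<sigma> ! k" "1 \<le> \<sigma> ! k'" "1 \<le> \<pi> ! l"
    using assms nth_le_sum_list[of k \<sigma>] nth_le_sum_list[of k' \<sigma>] nth_le_sum_list[of l \<pi>]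
    by (auto simp: weight_pair_def)
  \<comment> \<open>Two entries of \<open>\<sigma>\<close> are positive, so its sum
    \<open>Suc D\<close> is at least 2.\<close>
  then obtain D' where D': "D = Suc D'"
    using nth_add_le_sum_list[of k \<sigma> k'] assms by (cases D) (auto simp: weight_pair_def)
  show ?thesis unfolding covers_iff_lower
    using assms pos D' sum_list_lower[of k \<sigma>] sum_list_lower[of l \<pi>]
    by (intro exI[of _ D'] exI[of _ k'] exI[of _ l]) (simp add: weight_pair_def nth_lower)
qed

text \<open>Two different down-steps from a pair share their row or their column, since
  \<open>\<sigma>\<^sub>k + \<sigma>\<^sub>k' + \<pi>\<^sub>l + \<pi>\<^sub>l'\<close> is at most twice the degree if \<open>k \<noteq> k'\<close> and \<open>l \<noteq> l'\<close>; hence they commute.\<close>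

lemma strong_confluentp_covers: "strong_confluentp covers\<inverse>\<inverse>"
proof (rule strong_confluentpI)
  fix x y z assume "covers\<inverse>\<inverse> x y" "covers\<inverse>\<inverse> x z"
  then have yx: "covers y x" and zx: "covers z x" by auto
  obtain \<sigma> \<pi> where x: "x = (\<sigma>, \<pi>)" by force
  obtain D k l where 1: "weight_pair (Suc D) (\<sigma>, \<pi>)" "k < length \<sigma>" "l < length \<pi>"
    "D + 2 \<le> \<sigma> ! k + \<pi> ! l" "y = (lower k \<sigma>, lower l \<pi>)"
    using yx x unfolding covers_iff_lower by auto
  obtain D' k' l' where 2: "weight_pair (Suc D') (\<sigma>, \<pi>)" "k' < length \<sigma>" "l' < length \<pi>"
    "D' + 2 \<le> \<sigma> ! k' + \<pi> ! l'" "z = (lower k' \<sigma>, lower l' \<pi>)"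
    using zx x unfolding covers_iff_lower by auto
  have D: "D' = D" using 1 2 by (simp add: weight_pair_def)
  have "k = k' \<or> l = l'"
  proof (rule ccontr)
    assume "\<not> (k = k' \<or> l = l')"
    then have "\<sigma> ! k + \<sigma> ! k' \<le> Suc D" "\<pi> ! l + \<pi> ! l' \<le> Suc D"
      using 1(1-3) 2(2,3) nth_add_le_sum_list[of k \<sigma> k'] nth_add_le_sum_list[of l \<pi> l']
      by (simp_all add: weight_pair_def)
    then show False using 1(4) 2(4) D by linarith
  qed
  then consider "y = z" | "k \<noteq> k'" "l = l'" | "k = k'" "l \<noteq> l'" using 1 2 by auto
  then show "\<exists>u. covers\<inverse>\<inverse>\<^sup>*\<^sup>* y u \<and> covers\<inverse>\<inverse>\<^sup>=\<^sup>= z u"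
  proof cases
    case 1
    then show ?thesis by (intro exI[of _ y]) simp
  next
    case column: 2
    have "covers (lower k' (lower k \<sigma>), lower l (lower l \<pi>)) y"
      "covers (lower k' (lower k \<sigma>), lower l (lower l \<pi>)) z"
      using covers_lower_lower[of D \<sigma> \<pi> k k' l] covers_lower_lower[of D \<sigma> \<pi> k' k l] 1 2 D column
      by (simp_all add: lower_commute[of k])
    then show ?thesis by (intro exI[of _ "(lower k' (lower k \<sigma>), lower l (lower l \<pi>))"]) auto
  next
    case 3
    have "weight_pair (Suc D) (\<pi>, \<sigma>)" using 1 by (simp add: weight_pair_def)
    then have "covers (lower l' (lower l \<pi>), lower k (lower k \<sigma>)) (lower l \<pi>, lower k \<sigma>)"
      "covers (lower l' (lower l \<pi>), lower k (lower k \<sigma>)) (lower l' \<pi>, lower k \<sigma>)"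
      using covers_lower_lower[of D \<pi> \<sigma> l l' k] covers_lower_lower[of D \<pi> \<sigma> l' l k] 1 2 D 3
      by (simp_all add: lower_commute[of l] add.commute)
    from this[THEN covers_swap] have "covers (lower k (lower k \<sigma>), lower l' (lower l \<pi>)) y"
      "covers (lower k (lower k \<sigma>), lower l' (lower l \<pi>)) z"
      using 1 2 3 by simp_all
    then show ?thesis by (intro exI[of _ "(lower k (lower k \<sigma>), lower l' (lower l \<pi>))"]) auto
  qed
qed

section \<open>Minimal elements and uniqueness of reductions\<close>

lemma wp_minimal_iff: "wp_minimal v \<longleftrightarrow> (\<exists>d. weight_pair d v) \<and> (\<nexists>u. covers u v)"
proof -
  have "u \<noteq> v" if "covers u v" for u
    using covers_weight_pair[OF that] by (auto simp: weight_pair_def)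
  moreover have "u = v" if "wp_le u v" "\<nexists>u. covers u v" for u
    using that unfolding wp_le_def by (metis rtranclp.cases)
  ultimately show ?thesis unfolding wp_minimal_def wp_le_def by blast
qed

text \<open>Confluence gives equivalent pairs a common lower bound; below a minimal \<open>v\<close>
  there is only \<open>v\<close> itself.\<close>

lemma reduces_to_iff: "reduces_to w v \<longleftrightarrow> wp_le v w \<and> wp_minimal v"
proof
  assume r: "reduces_to w v"
  then have "equivclp (covers\<inverse>\<inverse>) w v" unfolding reduces_to_def by simp
  then have "((covers\<inverse>\<inverse>)\<^sup>*\<^sup>* OO ((covers\<inverse>\<inverse>)\<inverse>\<inverse>)\<^sup>*\<^sup>*) w v"
    by (simp only: semiconfluentp_equivclp[OF strong_confluentp_into_semiconfluentp[OF strong_confluentp_covers]])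
  then obtain u where u: "wp_le u w" "wp_le u v"
    unfolding wp_le_def by (auto simp: rtranclp_conversep)
  then show "wp_le v w \<and> wp_minimal v" using r unfolding reduces_to_def wp_minimal_def by blast
next
  assume "wp_le v w \<and> wp_minimal v"
  then show "reduces_to w v" unfolding reduces_to_def wp_le_def
    by (auto intro: equivclp_sym rtranclp_into_equivclp)
qed

lemma reduces_to_unique:
  assumes "reduces_to w v" "reduces_to w v'"
  shows "v = v'"
proof -
  have "reduces_to v v'"
    using assms unfolding reduces_to_def by (meson equivclp_sym equivclp_trans)
  then show ?thesis using assms(1) unfolding reduces_to_iff wp_minimal_def by blast
qed

lemma reduces_to_exists: "weight_pair d w \<Longrightarrow> \<exists>v. reduces_to w v"
proof (induction d arbitrary: w)
  case 0
  have "\<not> covers u w" for u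
    using covers_weight_pair[of u w] 0 unfolding weight_pair_def by (metis Zero_not_Suc)
  then have "wp_minimal w" unfolding wp_minimal_iff using 0 by blast
  then show ?case unfolding reduces_to_iff wp_le_def by blast
next
  case (Suc d)
  show ?case
  proof (cases "\<exists>u. covers u w")
    case True
    then obtain u where u: "covers u w" by blast
    then have "weight_pair d u" using covers_weight_pair[OF u] Suc.prems by (auto simp: weight_pair_def)
    then obtain v where "wp_le v u" "wp_minimal v" using Suc.IH unfolding reduces_to_iff by blast
    then show ?thesis using u unfolding reduces_to_iff wp_le_def
      by (meson rtranclp.rtrancl_into_rtrancl)
  next
    case False
    then have "wp_minimal w" using Suc.prems unfolding wp_minimal_iff by blast
    then show ?thesis unfolding reduces_to_iff wp_le_def by blast
  qed
qed

definition reduction :: "wpair \<Rightarrow> wpair" where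
  "reduction w = (THE v. reduces_to w v)"

lemma reduces_to_reduction: "weight_pair d w \<Longrightarrow> reduces_to w v \<longleftrightarrow> v = reduction w"
  unfolding reduction_def using reduces_to_exists reduces_to_unique by (metis theI_unique)

lemma wp_minimal_swap:
  assumes "wp_minimal v"
  shows "wp_minimal (prod.swap v)"
proof -
  have "\<not> covers u (prod.swap v)" for u
    using covers_swap[of u "prod.swap v"] assms unfolding wp_minimal_iff swap_swap by blast
  moreover have "\<exists>d. weight_pair d (prod.swap v)"
    using assms by (auto simp: wp_minimal_iff weight_pair_def)
  ultimately show ?thesis by (simp add: wp_minimal_iff)
qed

lemma reduction_swap:
  assumes "weight_pair d w"
  shows "reduction (prod.swap w) = prod.swap (reduction w)"
proof -
  have "weight_pair d (prod.swap w)" using assms by (simp add: weight_pair_def)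
  moreover have "reduces_to (prod.swap w) (prod.swap (reduction w))"
    using reduces_to_reduction[OF assms] wp_minimal_swap wp_le_swap unfolding reduces_to_iff by blast
  ultimately show ?thesis using reduces_to_reduction by metis
qed

lemma wp_le_weight_pair:
  assumes "wp_le v w" "weight_pair d w"
  shows "\<exists>d'\<le>d. weight_pair d' v"
  using assms unfolding wp_le_def
proof (induction arbitrary: d rule: rtranclp_induct)
  case (step y z)
  obtain e where e: "weight_pair e y" "weight_pair (Suc e) z" using covers_weight_pair step by blast
  then show ?case using step.IH[OF e(1)] step.prems by (auto simp: weight_pair_def intro: le_SucI)
qed auto

text \<open>A single entry equals the degree, so in positive degree it allows a down-step together
  with any nonzero entry of \<open>\<pi>\<close>.\<close>

lemma minimal_single:
  assumes "wp_minimal (\<sigma>, \<pi>)" "length \<sigma> = 1"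
  shows "sum_list \<sigma> = 0"
proof (rule ccontr)
  assume "sum_list \<sigma> \<noteq> 0"
  then obtain D where D: "sum_list \<sigma> = Suc D" by (cases "sum_list \<sigma>") auto
  obtain s where s: "\<sigma> = [s]" using assms(2) by (auto simp: length_Suc_conv)
  have "sum_list \<pi> = Suc D" using assms(1) D by (auto simp: wp_minimal_def weight_pair_def)
  then obtain l where l: "l < length \<pi>" "\<pi> ! l \<noteq> 0"
    by (metis in_set_conv_nth nat.distinct(1) sum_list_eq_0_iff)
  have "covers (lower 0 \<sigma>, lower l \<pi>) (\<sigma>, \<pi>)"
    unfolding covers_iff_lower using l D s \<open>sum_list \<pi> = Suc D\<close>
    by (intro exI[of _ D] exI[of _ 0] exI[of _ l]) (simp add: weight_pair_def)
  then show False using assms(1) unfolding wp_minimal_iff by blast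
qed

section \<open>Reductions of pairs without zeros\<close>

definition positive :: "wpair \<Rightarrow> bool" where
  "positive w \<longleftrightarrow> 0 \<notin> set (fst w) \<and> 0 \<notin> set (snd w)"

lemma positive_swap [simp]: "positive (prod.swap w) \<longleftrightarrow> positive w"
  by (auto simp: positive_def)

lemma nth_less_sum_list:
  assumes "0 \<notin> set xs" "2 \<le> length xs" "l < length xs"
  shows "xs ! l < sum_list (xs :: nat list)"
proof -
  define k where "k = (if l = 0 then 1 else 0 :: nat)"
  have k: "k < length xs" "k \<noteq> l" using assms(2,3) by (auto simp: k_def)
  then have "0 < xs ! k" using assms(1) by (metis gr0I nth_mem)
  then show ?thesis using nth_add_le_sum_list[of k xs l] k assms by simp
qed

lemma not_zero_lower:
  assumes "0 \<notin> set xs" "k < length xs" "2 \<le> xs ! k"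
  shows "0 \<notin> set (lower k xs)"
  using assms by (auto simp: in_set_conv_nth nth_lower split: if_splits)

text \<open>With at least two positive entries in each component, every entry is below the degree.
  The inequality of a down-step then forces both lowered entries to be at least 2.\<close>

lemma covers_positive:
  assumes "covers v w" "positive w" "2 \<le> length (fst w)" "2 \<le> length (snd w)"
  shows "positive v"
proof -
  obtain D k l where *: "weight_pair (Suc D) w" "k < length (fst w)" "l < length (snd w)"
    "D + 2 \<le> fst w ! k + snd w ! l" "v = (lower k (fst w), lower l (snd w))"
    using assms(1) unfolding covers_iff_lower by blast
  have "fst w ! k < Suc D" "snd w ! l < Suc D"
    using nth_less_sum_list[of "fst w" k] nth_less_sum_list[of "snd w" l] assms * 
    by (simp_all add: positive_def weight_pair_def)
  then have "2 \<le> fst w ! k" "2 \<le> snd w ! l" using *(4) by linarith+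
  then show ?thesis
    using not_zero_lower[of "fst w" k] not_zero_lower[of "snd w" l] * assms(2) by (simp add: positive_def)
qed

lemma wp_le_positive:
  assumes "wp_le v w" "positive w" "2 \<le> length (fst w)" "2 \<le> length (snd w)"
  shows "positive v"
  using assms unfolding wp_le_def
proof (induction rule: converse_rtranclp_induct)
  case (step y z)
  then show ?case using covers_positive[of y z] wp_le_length[of z w] by (simp add: wp_le_def)
qed auto

lemma minimal_reduced:
  assumes "wp_minimal v" "weight_pair d v"
  shows "reduced v"
proof (rule ccontr)
  assume "\<not> reduced v"
  obtain \<sigma> \<pi> where v: "v = (\<sigma>, \<pi>)" by force
  define s p where "s = Max (insert 0 (set \<sigma>))" and "p = Max (insert 0 (set \<pi>))"
  have gt: "d < s + p" using \<open>\<not> reduced v\<close> assms(2) v by (auto simp: reduced_def s_def p_def)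
  have mem: "s \<in> insert 0 (set \<sigma>)" "p \<in> insert 0 (set \<pi>)"
    unfolding s_def p_def by (intro Max_in; simp)+
  then have "s \<le> sum_list \<sigma>" "p \<le> sum_list \<pi>" by (auto intro: member_le_sum_list)
  then have le: "s \<le> d" "p \<le> d" using assms(2) v by (simp_all add: weight_pair_def)
  \<comment> \<open>Neither maximum is the inserted \<open>0\<close>, since the other one would then
    exceed \<open>d\<close>.\<close>
  then have "s \<in> set \<sigma>" "p \<in> set \<pi>" using mem gt by auto
  then obtain k l where kl: "k < length \<sigma>" "\<sigma> ! k = s" "l < length \<pi>" "\<pi> ! l = p"
    by (auto simp: in_set_conv_nth)
  obtain D where D: "d = Suc D" using gt le by (cases d) auto
  have "covers (lower k \<sigma>, lower l \<pi>) v"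
    unfolding covers_iff_lower using kl gt D assms(2) v
    by (intro exI[of _ D] exI[of _ k] exI[of _ l]) simp
  then show False using assms(1) unfolding wp_minimal_iff by blast
qed

section \<open>Normalized pairs\<close>

definition lex_ge :: "nat list \<Rightarrow> nat list \<Rightarrow> bool" where
  "lex_ge \<sigma> \<pi> \<longleftrightarrow> \<sigma> = \<pi> \<or> (\<exists>i<length \<sigma>. \<sigma> ! i > \<pi> ! i \<and> (\<forall>j<i. \<sigma> ! j = \<pi> ! j))"

lemma normalized_iff:
  "normalized (\<sigma>, \<pi>) \<longleftrightarrow>
    positive (\<sigma>, \<pi>) \<and> (length \<sigma> < length \<pi> \<or> length \<sigma> = length \<pi> \<and> lex_ge \<sigma> \<pi>)"
  by (auto simp: normalized_def positive_def lex_ge_def)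

lemma lex_ge_linear:
  assumes "length \<sigma> = length \<pi>"
  shows "lex_ge \<sigma> \<pi> \<or> lex_ge \<pi> \<sigma>"
proof (cases "\<sigma> = \<pi>")
  case False
  define i where "i = (LEAST i. i < length \<sigma> \<and> \<sigma> ! i \<noteq> \<pi> ! i)"
  have ex: "\<exists>i. i < length \<sigma> \<and> \<sigma> ! i \<noteq> \<pi> ! i" using False assms by (auto simp: list_eq_iff_nth_eq)
  have i: "i < length \<sigma>" "\<sigma> ! i \<noteq> \<pi> ! i" using LeastI_ex[OF ex] by (auto simp: i_def)
  have "\<sigma> ! j = \<pi> ! j" if "j < i" for j
    using not_less_Least[of j "\<lambda>i. i < length \<sigma> \<and> \<sigma> ! i \<noteq> \<pi> ! i"] that i(1) by (auto simp: i_def)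
  then show ?thesis using i assms unfolding lex_ge_def by (metis linorder_neqE_nat)
qed (simp add: lex_ge_def)

lemma lex_ge_antisym:
  assumes "lex_ge \<sigma> \<pi>" "lex_ge \<pi> \<sigma>"
  shows "\<sigma> = \<pi>"
proof (rule ccontr)
  assume "\<sigma> \<noteq> \<pi>"
  then obtain i i' where "\<sigma> ! i > \<pi> ! i" "\<forall>j<i. \<sigma> ! j = \<pi> ! j" "\<pi> ! i' > \<sigma> ! i'" "\<forall>j<i'. \<pi> ! j = \<sigma> ! j"
    using assms unfolding lex_ge_def by metis
  then show False by (cases i i' rule: linorder_cases) auto
qed

lemma positive_normalized: "positive w \<Longrightarrow> normalized w \<or> normalized (prod.swap w)"
  using lex_ge_linear[of "fst w" "snd w"] by (cases w) (auto simp: normalized_iff positive_def)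

lemma normalized_positive: "normalized w \<Longrightarrow> positive w"
  by (cases w) (simp add: normalized_iff)

lemma normalized_swap_eq:
  assumes "normalized w" "normalized (prod.swap w)"
  shows "prod.swap w = w"
  using assms lex_ge_antisym by (cases w) (auto simp: normalized_iff)

lemma length_2_of_sum:
  assumes "0 \<notin> set xs" "k < length xs" "l < length xs" "k \<noteq> l" "sum_list (xs :: nat list) \<le> xs ! k + xs ! l"
  shows "length xs = 2"
proof -
  have "{0..<length xs} - {k, l} = {}"
  proof (rule ccontr)
    assume "{0..<length xs} - {k, l} \<noteq> {}"
    then obtain i where "i \<in> {0..<length xs} - {k, l}" by blast
    then have i: "i < length xs" "i \<noteq> k" "i \<noteq> l" by auto
    have "(\<Sum>i\<in>{i, k, l}. xs ! i) \<le> (\<Sum>i\<in>{0..<length xs}. xs ! i)"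
      using assms i by (intro sum_mono2) auto
    then have "xs ! i + (xs ! k + xs ! l) \<le> sum_list xs" using assms i by (simp add: sum_list_sum_nth)
    moreover have "xs ! i \<noteq> 0" using assms(1) i(1) by (metis nth_mem)
    ultimately show False using assms(5) by simp
  qed
  then have "{0..<length xs} = {k, l}" using assms by auto
  then have "card {0..<length xs} = card {k, l}" by simp
  then show ?thesis using assms(4) by simp
qed

text \<open>The lexicographic order can only be lost in a down-step with \<open>\<sigma>\<^sub>k = \<pi>\<^sub>k + 1\<close>; this forces
  \<open>\<pi>\<^sub>k + \<pi>\<^sub>l\<close> to be the degree, so that \<open>\<pi>\<close> has only two entries and the two components become
  equal.\<close>

lemma lex_ge_lower:
  assumes len: "length \<sigma> = length \<pi>" and pos: "positive (\<sigma>, \<pi>)" and ge: "lex_ge \<sigma> \<pi>"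
    and w: "weight_pair (Suc D) (\<sigma>, \<pi>)" and kl: "k < length \<sigma>" "l < length \<pi>"
    and step: "D + 2 \<le> \<sigma> ! k + \<pi> ! l"
  shows "lex_ge (lower k \<sigma>) (lower l \<pi>)"
proof -
  \<comment> \<open>If the components agree at \<open>k\<close> or at \<open>l\<close>, the step
    inequality bounds two entries of one and the same component; for \<open>k \<noteq> l\<close>
    their sum would exceed its total. This keeps steps with \<open>k \<noteq> l\<close> away from
    the common prefix of \<open>\<sigma>\<close> and \<open>\<pi>\<close>.\<close>
  have two: "k = l" if "\<sigma> ! k = \<pi> ! k \<or> \<sigma> ! l = \<pi> ! l"
  proof (rule ccontr)
    assume "k \<noteq> l"
    then have "\<sigma> ! k + \<sigma> ! l \<le> Suc D" "\<pi> ! k + \<pi> ! l \<le> Suc D"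
      using nth_add_le_sum_list[of k \<sigma> l] nth_add_le_sum_list[of k \<pi> l] w kl len
      by (simp_all add: weight_pair_def)
    then show False using that step by auto
  qed
  show ?thesis
  proof (cases "\<sigma> = \<pi>")
    case True
    then show ?thesis using two by (simp add: lex_ge_def)
  next
    case False
    then obtain i where i: "i < length \<sigma>" "\<sigma> ! i > \<pi> ! i" "\<forall>j<i. \<sigma> ! j = \<pi> ! j"
      using ge by (auto simp: lex_ge_def)
    have posi: "\<pi> ! i \<noteq> 0" using pos i(1) len by (metis nth_mem positive_def snd_conv)
    have wit: ?thesis if "lower l \<pi> ! i < lower k \<sigma> ! i" "\<forall>j<i. lower k \<sigma> ! j = lower l \<pi> ! j"
      using that i(1) by (auto simp: lex_ge_def)
    consider "k = l" | "k \<noteq> l" "k \<noteq> i" | "k \<noteq> l" "k = i" "\<pi> ! i < \<sigma> ! i - 1"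
      | "k \<noteq> l" "k = i" "\<sigma> ! i = Suc (\<pi> ! i)" using i(2) by linarith
    then show ?thesis
    proof cases
      case 1
      show ?thesis by (rule wit) (use 1 i posi kl in \<open>auto simp: nth_lower\<close>)
    next
      case 2
      have "i \<le> k" "i \<le> l" using two 2 i(3) by (metis leI)+
      then show ?thesis using 2 i kl by (intro wit) (auto simp: nth_lower)
    next
      case 3
      have "i \<le> l" using two 3 i(3) by (metis leI)
      then show ?thesis using 3 i kl by (intro wit) (auto simp: nth_lower)
    next
      case 4
      have "i < l" using two 4 i(3) by (metis linorder_neqE_nat)
      have "sum_list \<pi> \<le> \<pi> ! k + \<pi> ! l" using step w 4 by (auto simp: weight_pair_def)
      then have l2: "length \<pi> = 2"
        using length_2_of_sum[of \<pi> k l] pos kl len 4 by (simp add: positive_def)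
      obtain a b c e where abce: "\<sigma> = [a, b]" "\<pi> = [c, e]"
        using l2 len by (auto simp: length_Suc_conv numeral_2_eq_2)
      have "l = 1" "k = 0" "i = 0" using \<open>i < l\<close> kl l2 4 by auto
      then have "lower k \<sigma> = lower l \<pi>"
        using 4 w abce by (auto simp: lower_def weight_pair_def)
      then show ?thesis by (simp add: lex_ge_def)
    qed
  qed
qed

lemma lex_ge_wp_le:
  assumes "wp_le v w" "lex_ge (fst w) (snd w)" "length (fst w) = length (snd w)" "2 \<le> length (fst w)" "positive w"
  shows "lex_ge (fst v) (snd v)"
  using assms(1) unfolding wp_le_def
proof (induction rule: converse_rtranclp_induct)
  case (step y z)
  have z: "wp_le z w" using step by (simp add: wp_le_def)
  note len = wp_le_length[OF z]
  have "positive z" using wp_le_positive[OF z] assms by simp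
  obtain D k l where "weight_pair (Suc D) z" "k < length (fst z)" "l < length (snd z)"
    "D + 2 \<le> fst z ! k + snd z ! l" "y = (lower k (fst z), lower l (snd z))"
    using step(1) unfolding covers_iff_lower by blast
  then show ?case using lex_ge_lower[of "fst z" "snd z" D k l] step.IH \<open>positive z\<close> len assms by simp
qed (use assms in simp)

text \<open>If \<open>w\<close> were not normalized, its transpose would be, with components of
  equal length. The lexicographic order survives the way down, so \<open>v\<close> would be ordered
  both ways and hence symmetric.\<close>

lemma normalized_of_reduction:
  assumes "wp_le v w" "normalized v" "prod.swap v \<noteq> v" "positive w" "2 \<le> length (fst w)" "2 \<le> length (snd w)"
  shows "normalized w"
proof (rule ccontr)
  assume "\<not> normalized w"
  obtain \<sigma> \<pi> \<tau> \<rho> where vw: "v = (\<sigma>, \<pi>)" "w = (\<tau>, \<rho>)" by force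
  have sw: "normalized (prod.swap w)" using positive_normalized assms(4) \<open>\<not> normalized w\<close> by blast
  note len = wp_le_length[OF assms(1)]
  have eq: "length \<tau> = length \<rho>" "lex_ge \<rho> \<tau>"
    using sw assms(2) len vw by (auto simp: normalized_iff)
  have "positive (\<rho>, \<tau>)" using assms(4) vw by (simp add: positive_def)
  then have "lex_ge \<pi> \<sigma>"
    using lex_ge_wp_le[OF wp_le_swap[OF assms(1)]] eq assms(6) vw by simp
  moreover have "lex_ge \<sigma> \<pi>" using assms(2) len eq vw by (auto simp: normalized_iff)
  ultimately show False using lex_ge_antisym[of \<sigma> \<pi>] assms(3) vw by simp
qed

section \<open>Counting\<close>

lemma sum_list_nonzeros: "sum_list (nonzeros xs) = sum_list xs"
  by (induction xs) (auto simp: nonzeros_def)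

lemma zero_notin_nonzeros: "0 \<notin> set (nonzeros xs)"
  by (simp add: nonzeros_def)

lemma finite_nonzeros_eq: "finite {xs. length xs = m \<and> nonzeros xs = ys}"
proof (rule finite_subset)
  show "{xs. length xs = m \<and> nonzeros xs = ys} \<subseteq> {xs. set xs \<subseteq> insert 0 (set ys) \<and> length xs = m}"
    by (auto simp: nonzeros_def)
qed (simp add: finite_lists_length_eq)

text \<open>Such a list is determined by the positions of its nonzero entries; distinguishing
  whether the first entry is zero gives Pascal's rule.\<close>

lemma card_nonzeros_eq:
  "0 \<notin> set ys \<Longrightarrow> card {xs. length xs = m \<and> nonzeros xs = ys} = m choose length ys"
proof (induction m arbitrary: ys)
  case 0
  have "{xs. length xs = 0 \<and> nonzeros xs = ys} = (if ys = [] then {[]} else {})"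
    by (auto simp: nonzeros_def)
  then show ?case by (cases ys) auto
next
  case (Suc m)
  let ?S = "\<lambda>m ys. {xs. length xs = m \<and> nonzeros xs = ys}"
  show ?case
  proof (cases ys)
    case Nil
    have "?S (Suc m) [] = (#) 0 ` ?S m []"
      by (auto simp: nonzeros_def length_Suc_conv image_iff split: if_splits)
    then show ?thesis using Nil Suc.IH[of "[]"] by (simp add: card_image)
  next
    case (Cons y zs)
    have "y \<noteq> 0" using Suc.prems Cons by auto
    then have eq: "?S (Suc m) ys = (#) 0 ` ?S m ys \<union> (#) y ` ?S m zs"
      using Cons by (auto simp: nonzeros_def length_Suc_conv image_iff split: if_splits)
    have "card (?S (Suc m) ys) = card ((#) 0 ` ?S m ys) + card ((#) y ` ?S m zs)"
      unfolding eq using \<open>y \<noteq> 0\<close> by (intro card_Un_disjoint finite_imageI finite_nonzeros_eq) auto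
    also have "\<dots> = (m choose length ys) + (m choose length zs)"
      using Suc.IH[of ys] Suc.IH[of zs] Suc.prems Cons by (simp add: card_image)
    finally show ?thesis using Cons by simp
  qed
qed

definition strip :: "wpair \<Rightarrow> wpair" where
  "strip w = (nonzeros (fst w), nonzeros (snd w))"

lemma positive_strip: "positive (strip w)"
  by (simp add: positive_def strip_def zero_notin_nonzeros)

lemma weight_pair_strip: "weight_pair d (strip w) \<longleftrightarrow> weight_pair d w"
  by (simp add: weight_pair_def strip_def sum_list_nonzeros)

lemma card_strip_in:
  assumes "finite U" "\<And>u. u \<in> U \<Longrightarrow> weight_pair d u \<and> positive u \<and> length (fst u) = p \<and> length (snd u) = q"
  shows "card {w \<in> weight_pairs m n d. strip w \<in> U} = card U * ((m choose p) * (n choose q))"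
proof -
  define F where "F u = {xs. length xs = m \<and> nonzeros xs = fst u} \<times> {xs. length xs = n \<and> nonzeros xs = snd u}" for u
  have "{w \<in> weight_pairs m n d. strip w \<in> U} = (\<Union>u\<in>U. F u)"
  proof (intro equalityI subsetI)
    fix w assume "w \<in> {w \<in> weight_pairs m n d. strip w \<in> U}"
    moreover from this have "w \<in> F (strip w)" by (cases w) (simp add: F_def weight_pairs_def strip_def)
    ultimately show "w \<in> (\<Union>u\<in>U. F u)" by blast
  next
    fix w assume "w \<in> (\<Union>u\<in>U. F u)"
    then obtain u where u: "u \<in> U" "w \<in> F u" by blast
    then have "strip w = u" by (auto simp: F_def strip_def)
    then have "weight_pair d w" using assms(2)[OF u(1)] weight_pair_strip by blast
    then show "w \<in> {w \<in> weight_pairs m n d. strip w \<in> U}"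
      using u \<open>strip w = u\<close> by (auto simp: F_def weight_pairs_def)
  qed
  also have "card (\<Union>u\<in>U. F u) = (\<Sum>u\<in>U. card (F u))"
    using assms(1)
    by (intro card_UN_disjoint) (auto simp: F_def finite_nonzeros_eq prod_eq_iff)
  also have "\<dots> = (\<Sum>u\<in>U. (m choose p) * (n choose q))"
    using assms(2) by (intro sum.cong) (auto simp: F_def card_cartesian_product card_nonzeros_eq positive_def)
  finally show ?thesis by simp
qed

lemma nonzeros_single_iff:
  assumes "sum_list xs = d"
  shows "length (nonzeros xs) = 1 \<longleftrightarrow> nonzeros xs = [d]"
  using sum_list_nonzeros[of xs] assms by (auto simp: length_Suc_conv)

text \<open>A weight pair reduces to degree \<open>0\<close> iff one of its components has a single nonzero entry.\<close>

lemma card_trivial_pairs: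
  assumes "0 < d"
  shows "card {w \<in> weight_pairs m n d. length (fst (strip w)) = 1 \<or> length (snd (strip w)) = 1} =
    block_mult0 m n d"
proof -
  \<comment> \<open>Lists with sole nonzero entry \<open>d\<close> (\<open>X\<close>, with
    \<open>m\<close> elements) and all weak compositions of \<open>d\<close> (\<open>Y\<close>,
    stars and bars). Inclusion-exclusion for \<open>X m \<times> Y n\<close> and
    \<open>Y m \<times> X n\<close> gives the three terms of \<open>block_mult0\<close>.\<close>
  define X where "X m = {xs. length xs = m \<and> nonzeros xs = [d]}" for m
  define Y where "Y m = {xs :: nat list. length xs = m \<and> sum_list xs = d}" for m
  have sub: "X m \<subseteq> Y m" for m
  proof
    fix xs assume "xs \<in> X m"
    then show "xs \<in> Y m" using sum_list_nonzeros[of xs] by (simp add: X_def Y_def)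
  qed
  have X: "card (X m) = m" for m using card_nonzeros_eq[of "[d]" m] assms by (simp add: X_def)
  have Y: "card (Y m) = (d + m - 1) choose d" for m by (simp add: Y_def card_length_sum_list)
  have finY: "finite (Y m)" for m
    by (rule finite_subset[OF _ finite_lists_length_eq[of "{..d}" m]])
      (auto simp: Y_def intro: member_le_sum_list)
  have finX: "finite (X m)" for m by (rule finite_subset[OF sub finY])
  have "{w \<in> weight_pairs m n d. length (fst (strip w)) = 1 \<or> length (snd (strip w)) = 1} =
      X m \<times> Y n \<union> Y m \<times> X n"
    using nonzeros_single_iff sub
    by (fastforce simp: weight_pairs_def weight_pair_def strip_def X_def Y_def)
  moreover have "(X m \<times> Y n) \<inter> (Y m \<times> X n) = X m \<times> X n" using sub by auto
  ultimately show ?thesis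
    using card_Un_Int[of "X m \<times> Y n" "Y m \<times> X n"] finX finY
    by (simp add: card_cartesian_product X Y block_mult0_def mult.commute)
qed

text \<open>If \<open>\<sigma>\<close> had the single entry \<open>d'\<close>, any positive entry of
  \<open>\<pi>\<close> would violate reducedness; normalization then bounds the length of
  \<open>\<pi>\<close>.\<close>

lemma block_index_length:
  assumes "v \<in> block_index d"
  shows "2 \<le> length (fst v)" "2 \<le> length (snd v)"
proof -
  obtain \<sigma> \<pi> where v: "v = (\<sigma>, \<pi>)" by force
  obtain d' where *: "normalized v" "reduced v" "weight_pair d' v" "0 < d'"
    using assms by (auto simp: block_index_def)
  have "Max (insert 0 (set \<sigma>)) + Max (insert 0 (set \<pi>)) \<le> d'"
    using *(2,3) v by (auto simp: reduced_def weight_pair_def)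
  moreover have s: "sum_list \<sigma> = d'" "sum_list \<pi> = d'" using *(3) v by (simp_all add: weight_pair_def)
  have "\<pi> \<noteq> []" using s(2) *(4) by (cases \<pi>) simp_all
  then have "hd \<pi> \<in> set \<pi>" by simp
  then have "0 < hd \<pi>" "hd \<pi> \<le> Max (insert 0 (set \<pi>))" using *(1) v by (auto simp: normalized_def intro: gr0I)
  ultimately have "Max (insert 0 (set \<sigma>)) < d'" by linarith
  then have "length \<sigma> \<noteq> 1" using *(3) v by (auto simp: weight_pair_def length_Suc_conv)
  moreover have "\<sigma> \<noteq> []" using s(1) *(4) by (cases \<sigma>) simp_all
  ultimately have "2 \<le> length \<sigma>" by (cases \<sigma>; cases "tl \<sigma>") auto
  moreover have "length \<sigma> \<le> length \<pi>" using *(1) v by (auto simp: normalized_def)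
  ultimately show "2 \<le> length (fst v)" "2 \<le> length (snd v)" using v by auto
qed

section \<open>Types of weight pairs\<close>

lemma reduction_facts:
  assumes "weight_pair d w"
  shows "wp_le (reduction w) w" "wp_minimal (reduction w)"
    "length (fst (reduction w)) = length (fst w)" "length (snd (reduction w)) = length (snd w)"
proof -
  have r: "reduces_to w (reduction w)" using reduces_to_reduction[OF assms] by blast
  then show le: "wp_le (reduction w) w" and "wp_minimal (reduction w)" unfolding reduces_to_iff by auto
  show "length (fst (reduction w)) = length (fst w)" "length (snd (reduction w)) = length (snd w)"
    using wp_le_length[OF le] by auto
qed

text \<open>\<open>None\<close> marks a one-dimensional identity block. Otherwise the type is the
  normalized one among the reduction and its transpose, which labels the block since transposes
  share their matrix.\<close>

definition block_type :: "wpair \<Rightarrow> wpair option" where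
  "block_type w =
    (let u = strip w; v = reduction u
     in if length (fst u) = 1 \<or> length (snd u) = 1 then None
        else Some (if normalized v then v else prod.swap v))"

lemma block_type_eq_None:
  "block_type w = None \<longleftrightarrow> length (fst (strip w)) = 1 \<or> length (snd (strip w)) = 1"
  by (simp add: block_type_def Let_def)

lemma card_block_type_None:
  "0 < d \<Longrightarrow> card {w \<in> weight_pairs m n d. block_type w = None} = block_mult0 m n d"
  unfolding block_type_eq_None by (rule card_trivial_pairs)

lemma block_type_eq_Some:
  assumes "v \<in> block_index d" "weight_pair d w"
  shows "block_type w = Some v \<longleftrightarrow> reduction (strip w) = v \<or> reduction (strip w) = prod.swap v"
proof -
  have u: "weight_pair d (strip w)" using assms(2) by (simp add: weight_pair_strip)
  note red = reduction_facts[OF u]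
  have nv: "normalized v" using assms(1) by (simp add: block_index_def)
  show ?thesis
  proof
    assume "block_type w = Some v"
    then show "reduction (strip w) = v \<or> reduction (strip w) = prod.swap v"
      by (auto simp: block_type_def Let_def split: if_splits)
  next
    assume r: "reduction (strip w) = v \<or> reduction (strip w) = prod.swap v"
    then have "2 \<le> length (fst (strip w))" "2 \<le> length (snd (strip w))"
      using red block_index_length[OF assms(1)] by auto
    moreover have "(if normalized (reduction (strip w)) then reduction (strip w)
        else prod.swap (reduction (strip w))) = v"
      using r nv normalized_swap_eq[of v] by auto
    ultimately show "block_type w = Some v" by (simp add: block_type_def Let_def)
  qed
qed

text \<open>\<open>U x\<close> collects the pairs without zeros that reduce to \<open>x\<close>. For
  \<open>\<sigma> = \<pi>\<close> there is one such class, containing both orders. Otherwise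
  \<open>U v\<close> consists of normalized pairs by \<open>normalized_of_reduction\<close>, and its
  disjoint transpose \<open>U (prod.swap v)\<close> supplies the summand with \<open>m\<close> and
  \<open>n\<close> exchanged.\<close>

lemma card_block_type_Some:
  assumes v: "v \<in> block_index d"
  shows "card {w \<in> weight_pairs m n d. block_type w = Some v} = block_mult (fst v) (snd v) m n d"
proof -
  obtain \<sigma> \<pi> where vsp: "v = (\<sigma>, \<pi>)" by force
  have nv: "normalized v" using v by (simp add: block_index_def)
  note len2 = block_index_length[OF v]
  define U where "U x = {u. weight_pair d u \<and> positive u \<and> reduction u = x}" for x
  have fin: "finite (U x)" for x
    by (rule finite_subset[OF _ finite_reducing[of d "fst x" "snd x"]])
      (auto simp: U_def reduces_to_reduction)
  have U: "weight_pair d u \<and> positive u \<and> length (fst u) = length (fst x) \<and> length (snd u) = length (snd x)"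
    if "u \<in> U x" for u x
    using that reduction_facts(3,4)[of d u] by (auto simp: U_def)
  have set_eq: "{w \<in> weight_pairs m n d. block_type w = Some v} =
      {w \<in> weight_pairs m n d. strip w \<in> U v} \<union> {w \<in> weight_pairs m n d. strip w \<in> U (prod.swap v)}"
    using block_type_eq_Some[OF v] positive_strip weight_pair_strip
    by (auto simp: U_def weight_pairs_def)
  have finW: "finite {w \<in> weight_pairs m n d. P w}" for P
    using finite_weight_pairs_of_length[of m n d] by simp
  show ?thesis
  proof (cases "\<sigma> = \<pi>")
    case True
    have "normalized u \<or> normalized (prod.swap u) \<longleftrightarrow> positive u" for u
      using positive_normalized normalized_positive positive_swap by blast
    then have "U v = {w. weight_pair d w \<and> reduces_to w (\<sigma>, \<pi>) \<and>
             (normalized w \<or> \<sigma> = \<pi> \<and> normalized (prod.swap w))}"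
      using True vsp by (auto simp: U_def reduces_to_reduction)
    then have "card (U v) = num_reducing \<sigma> \<pi> d" by (simp add: num_reducing_def)
    then show ?thesis
      using set_eq card_strip_in[OF fin[of v] U, where m = m and n = n] True vsp by (simp add: block_mult_def)
  next
    case False
    have ne: "prod.swap v \<noteq> v" using False vsp by auto
    have "normalized u" if "u \<in> U v" for u
      using normalized_of_reduction[of v u] that nv ne len2 U[OF that] reduction_facts(1)[of d u]
      by (auto simp: U_def)
    then have "U v = {w. weight_pair d w \<and> reduces_to w (\<sigma>, \<pi>) \<and>
             (normalized w \<or> \<sigma> = \<pi> \<and> normalized (prod.swap w))}"
      using False vsp normalized_positive by (auto simp: U_def reduces_to_reduction)
    then have A: "card (U v) = num_reducing \<sigma> \<pi> d" by (simp add: num_reducing_def)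
    have "U (prod.swap v) = prod.swap ` U v"
    proof (intro equalityI subsetI)
      fix u assume u: "u \<in> U (prod.swap v)"
      then have "prod.swap u \<in> U v"
        using reduction_swap[of d u] by (auto simp: U_def weight_pair_def)
      then show "u \<in> prod.swap ` U v" by (metis image_eqI swap_swap)
    next
      fix u assume "u \<in> prod.swap ` U v"
      then obtain x where x: "u = prod.swap x" "x \<in> U v" by blast
      then show "u \<in> U (prod.swap v)"
        using reduction_swap[of d x] positive_swap[of x] by (simp add: U_def weight_pair_def)
    qed
    then have A': "card (U (prod.swap v)) = num_reducing \<sigma> \<pi> d"
      using A by (simp add: card_image)
    have "{w \<in> weight_pairs m n d. strip w \<in> U v} \<inter> {w \<in> weight_pairs m n d. strip w \<in> U (prod.swap v)} = {}"
      using ne by (auto simp: U_def)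
    then have "card {w \<in> weight_pairs m n d. block_type w = Some v} =
        card {w \<in> weight_pairs m n d. strip w \<in> U v} + card {w \<in> weight_pairs m n d. strip w \<in> U (prod.swap v)}"
      unfolding set_eq by (intro card_Un_disjoint finW)
    then show ?thesis
      using card_strip_in[OF fin[of v] U, where m = m and n = n] card_strip_in[OF fin[of "prod.swap v"] U, where m = m and n = n]
        A A' False vsp by (simp add: block_mult_def algebra_simps)
  qed
qed

definition type_block :: "wpair option \<Rightarrow> complex mat" where
  "type_block t = (case t of None \<Rightarrow> 1\<^sub>m 1 | Some (\<sigma>, \<pi>) \<Rightarrow> RSK_weight \<sigma> \<pi>)"

lemma type_block_None: "type_block None = 1\<^sub>m 1"
  by (simp add: type_block_def)

lemma weight_block_type:
  assumes "w \<in> weight_pairs m n d" "0 < d"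
  shows "weight_block w (type_block (block_type w))"
    "block_type w \<in> insert None (Some ` block_index d)"
proof -
  define u v where "u = strip w" and "v = reduction u"
  have wu: "weight_pair d u" using assms(1) by (simp add: u_def weight_pair_strip weight_pairs_def)
  have red: "wp_le v u" "wp_minimal v" "length (fst v) = length (fst u)" "length (snd v) = length (snd u)"
    using reduction_facts[OF wu] by (simp_all add: v_def)
  obtain d' where d': "d' \<le> d" "weight_pair d' v" using wp_le_weight_pair[OF red(1) wu] by blast
  have up: "weight_block w B" if "weight_block v B" for B
    using weight_block_nonzeros[of "fst w" "snd w" B] weight_block_wp_le[OF red(1) that]
    by (simp add: u_def strip_def)
  have "weight_block w (type_block (block_type w)) \<and> block_type w \<in> insert None (Some ` block_index d)"
  proof (cases "length (fst u) = 1 \<or> length (snd u) = 1")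
    case True
    \<comment> \<open>The reduction keeps lengths, so it is a minimal pair with a component of
      length one and has degree \<open>0\<close>.\<close>
    have "sum_list (fst v) = 0 \<or> sum_list (snd v) = 0"
      using True minimal_single[of "fst v" "snd v"] minimal_single[of "snd v" "fst v"]
        wp_minimal_swap[OF red(2)] red by (auto simp: prod.swap_def)
    then have "sum_list (fst v) = 0" "sum_list (snd v) = 0"
      using d'(2) unfolding weight_pair_def by metis+
    then have "weight_block v (1\<^sub>m 1)" using weight_block_zero by (metis prod.collapse)
    moreover have "block_type w = None" using True by (simp add: block_type_def Let_def u_def)
    ultimately show ?thesis using up by (simp add: type_block_def)
  next
    case False
    define b where "b = (if normalized v then v else prod.swap v)"
    have bt: "block_type w = Some b" using False by (simp add: block_type_def Let_def u_def v_def b_def)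
    have "sum_list (fst u) = d" "sum_list (snd u) = d" using wu by (simp_all add: weight_pair_def)
    then have "length (fst u) \<noteq> 0" "length (snd u) \<noteq> 0"
      using assms(2) by (metis length_0_conv less_irrefl sum_list.Nil)+
    then have len: "2 \<le> length (fst u)" "2 \<le> length (snd u)" using False by linarith+
    have pv: "positive v" using wp_le_positive[OF red(1) _ len] positive_strip by (simp add: u_def)
    \<comment> \<open>The reduction keeps its nonempty components free of zeros, so it cannot have
      degree \<open>0\<close>.\<close>
    have "0 < d'"
    proof (rule gr0I)
      assume "d' = 0"
      then have "\<forall>x\<in>set (fst v). x = 0" using d' by (simp add: weight_pair_def sum_list_eq_0_iff)
      moreover have "hd (fst v) \<in> set (fst v)" using len red by (intro hd_in_set) auto
      ultimately show False using pv by (auto simp: positive_def)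
    qed
    moreover have "normalized b" using positive_normalized[OF pv] by (auto simp: b_def)
    moreover have "weight_pair d' b" using d' by (auto simp: b_def weight_pair_def)
    moreover have "wp_minimal b" using red(2) wp_minimal_swap by (auto simp: b_def)
    ultimately have "b \<in> block_index d"
      using d'(1) minimal_reduced unfolding block_index_def by blast
    moreover have "weight_block v (RSK_weight (fst b) (snd b))"
      using weight_block_RSK_weight[of "fst b" "snd b"] weight_block_swap[of b]
      by (auto simp: b_def split: if_splits)
    ultimately show ?thesis using up bt by (simp add: type_block_def case_prod_beta)
  qed
  then show "weight_block w (type_block (block_type w))"
    "block_type w \<in> insert None (Some ` block_index d)" by auto
qed

text \<open>This orders the weight pairs so that equal types are consecutive and the types follow
  \<open>ts\<close>; the list of blocks then literally has the
  \<open>replicate\<close>/\<open>concat\<close> form of the final statement.\<close>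

lemma list_grouped_by:
  assumes "finite W" "f ` W \<subseteq> set ts" "distinct ts"
  obtains ws where "distinct ws" "set ws = W"
    "map f ws = concat (map (\<lambda>t. replicate (card {w \<in> W. f w = t}) t) ts)"
proof -
  have "\<exists>ws. distinct ws \<and> set ws = W \<and>
    map f ws = concat (map (\<lambda>t. replicate (card {w \<in> W. f w = t}) t) ts)"
    using assms
  proof (induction ts arbitrary: W)
    case (Cons t ts)
    let ?V = "{w \<in> W. f w = t}" and ?W = "{w \<in> W. f w \<noteq> t}"
    obtain ws where ws: "distinct ws" "set ws = ?W"
      "map f ws = concat (map (\<lambda>t. replicate (card {w \<in> ?W. f w = t}) t) ts)"
      using Cons.IH[of ?W] Cons.prems by auto
    have "map (\<lambda>s. replicate (card {w \<in> ?W. f w = s}) s) ts = map (\<lambda>s. replicate (card {w \<in> W. f w = s}) s) ts"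
    proof (intro map_cong refl)
      fix s assume "s \<in> set ts"
      then have "{w \<in> ?W. f w = s} = {w \<in> W. f w = s}" using Cons.prems(3) by auto
      then show "replicate (card {w \<in> ?W. f w = s}) s = replicate (card {w \<in> W. f w = s}) s" by simp
    qed
    then have ws3: "map f ws = concat (map (\<lambda>t. replicate (card {w \<in> W. f w = t}) t) ts)"
      using ws(3) by (simp only:)
    obtain vs where vs: "distinct vs" "set vs = ?V"
      using finite_distinct_list[of ?V] Cons.prems(1) by auto
    have "map f vs = replicate (length vs) t"
      using vs(2) by (intro replicate_eqI) auto
    moreover have "length vs = card ?V" using vs distinct_card by metis
    ultimately have "map f (vs @ ws) = concat (map (\<lambda>t. replicate (card {w \<in> W. f w = t}) t) (t # ts))"
      using ws3 by simp
    moreover have "distinct (vs @ ws)" "set (vs @ ws) = W" using vs ws by auto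
    ultimately show ?case by blast
  qed simp
  then show thesis using that by blast
qed

text \<open>For \<open>d = 0\<close> the formula for the number of identity blocks reads
  \<open>m + n - m * n\<close>, which in general differs from the dimension 1 of the degree-0 space;
  hence the assumption \<open>0 < d\<close>.\<close>

theorem theorem3p22:
  fixes m n d :: nat
  assumes "0 < d"
  shows "equal_up_to_reordering (RSK_degree m n d)
    (diag_block_mat
      (replicate (block_mult0 m n d) (1\<^sub>m 1) @
       concat (map (\<lambda>(\<sigma>, \<pi>). replicate (block_mult \<sigma> \<pi> m n d) (RSK_weight \<sigma> \<pi>))
         (enum_list (block_index d)))))"
proof -
  let ?W = "weight_pairs m n d" and ?bs = "enum_list (block_index d)"
  note bs = enum_list[OF finite_block_index[of d]]
  have "block_type ` ?W \<subseteq> set (None # map Some ?bs)"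
    using weight_block_type(2)[OF _ assms] bs(2) by force
  moreover have "distinct (None # map Some ?bs)" using bs(1) by (simp add: distinct_map)
  ultimately obtain ws where ws: "distinct ws" "set ws = ?W"
    "map block_type ws =
      concat (map (\<lambda>t. replicate (card {w \<in> ?W. block_type w = t}) t) (None # map Some ?bs))"
    by (rule list_grouped_by[OF finite_weight_pairs_of_length])
  have some: "map (\<lambda>b. replicate (card {w \<in> ?W. block_type w = Some b}) (type_block (Some b))) ?bs =
      map (\<lambda>(\<sigma>, \<pi>). replicate (block_mult \<sigma> \<pi> m n d) (RSK_weight \<sigma> \<pi>)) ?bs"
    using card_block_type_Some[of _ d m n] bs(2)
    by (intro map_cong refl) (auto simp: type_block_def)
  have "map (type_block \<circ> block_type) ws = map type_block (map block_type ws)" by simp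
  also have "\<dots> = replicate (block_mult0 m n d) (1\<^sub>m 1) @
      concat (map (\<lambda>b. replicate (card {w \<in> ?W. block_type w = Some b}) (type_block (Some b))) ?bs)"
    unfolding ws(3) by (simp add: map_concat o_def card_block_type_None[OF assms] type_block_None)
  finally have "map (type_block \<circ> block_type) ws =
      replicate (block_mult0 m n d) (1\<^sub>m 1) @
      concat (map (\<lambda>(\<sigma>, \<pi>). replicate (block_mult \<sigma> \<pi> m n d) (RSK_weight \<sigma> \<pi>)) ?bs)"
    unfolding some .
  moreover have "equal_up_to_reordering (RSK_degree m n d) (diag_block_mat (map (type_block \<circ> block_type) ws))"
    using weight_block_type(1)[OF _ assms] ws by (intro equal_up_to_reordering_weight_blocks) auto
  ultimately show ?thesis by simp
qed

end
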